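(* Let $M\geq 2$ be a real number, let $q\geq 1$ be an integer, and let $a$ be a non-zero integer. Let $x,y,z$ be real numbers with $2\leq y\leq z<x$. Define \[\mathrm{Kl}_y(M,x;a,q):=\sum_{m\sim M}\bigg|\sum_{\substack{n<x\\ P^+(n)\leq y\\ (n,\,mq)=1}}e\Big(\frac{a\overline{n}}{m}\Big)\bigg|.\] Then, for any small $\eta>0$, \[\mathrm{Kl}_y(M,x;a,q)\ll_\eta (|a|xM)^{\eta}\Big(1+\frac{|a|}{xM}\Big)^{1/2}\big(Mx^{1/2}y^{1/2}z^{1/2}+x^{3/2}M^{1/2}z^{-1/4}\big)+Mz.\]
   Context: $m\sim M$ means $M<m\leq 2M$ ($m$ an integer). $e(t)=e^{2\pi i t}$. For $(n,m)=1$, $\overline{n}$ denotes an inverse of $n$ modulo $m$, i.e. $n\overline{n}\equiv 1\pmod m$. $P^+(n)$ denotes the largest prime factor of $n$, with $P^+(1)=1$. *)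

theory Defs
  imports "HOL-Analysis.Analysis" "HOL-Number_Theory.Number_Theory"
begin

definition e :: "real \<Rightarrow> complex" where
  "e t = exp (2 * of_real pi * \<i> * of_real t)"

text \<open>The value at \<open>0\<close> is irrelevant; it is also set to \<open>1\<close>.\<close>

definition largest_prime_factor :: "nat \<Rightarrow> nat" where
  "largest_prime_factor n = (if n \<le> 1 then 1 else Max (prime_factors n))"

text \<open>
  The library function \<open>modular_inverse m n\<close> (modulus first) is the inverse of \<open>n\<close> modulo \<open>m\<close>
  for coprime \<open>m\<close>, \<open>n\<close>; the summand depends only on its residue class modulo \<open>m\<close>.
\<close>

definition Kl :: "real \<Rightarrow> real \<Rightarrow> real \<Rightarrow> int \<Rightarrow> nat \<Rightarrow> real" where
  "Kl y M x a q =
     (\<Sum>m | M < real m \<and> real m \<le> 2 * M.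
        norm (\<Sum>n | n \<ge> 1 \<and> real n < x \<and> real (largest_prime_factor n) \<le> y \<and> coprime n (m * q).
          e (real_of_int (a * modular_inverse (int m) (int n)) / real m)))"

end

theory Submission
  imports Defs "Berlekamp_Zassenhaus.Finite_Field" "HOL-Algebra.Algebraic_Closure_Type"
begin

hide_const (open) Divisibility.prime Divisibility.irreducible Coset.order up_ring.coeff
  up_ring.monom Polynomials.lead_coeff Polynomials.degree module.smult

text \<open>
  A \<open>y\<close>-smooth number \<open>n > z\<close> has a divisor \<open>l\<close> with \<open>z < l \<le> y z\<close>, namely its least divisor
  exceeding \<open>z\<close>. Writing \<open>n = k l\<close>, the Cauchy-Schwarz inequality over \<open>m\<close> for fixed \<open>l\<close> leads to
  sums over \<open>m \<sim> M\<close> of \<open>e(t c'/m)\<close> with \<open>c = k\<^sub>1 k\<^sub>2 l\<close>, \<open>t = a (k\<^sub>2 - k\<^sub>1)\<close> and \<open>c'\<close> the inverse of \<open>c\<close>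
  modulo \<open>m\<close>. By reciprocity they turn into incomplete Kloosterman sums modulo \<open>c\<close>, twisted by
  \<open>e(t/(m c))\<close>; partial summation removes the twist at the cost of \<open>1 + |a|/(n M)\<close>, and completion
  together with the Weil bound gives \<open>O(c\<^bsup>1/2+\<epsilon>\<^esup> + M (t, c)/c)\<close>.

  The Weil bound for primes \<open>p\<close> is obtained from the Kloosterman sums \<open>S\<^sub>n\<close> over the fields with
  \<open>p\<^sup>n\<close> elements. Counting monic polynomials shows that the L-function is a quadratic polynomial,
  so that \<open>S\<^sub>n = - (\<alpha>\<^sup>n + \<beta>\<^sup>n)\<close> with \<open>|\<alpha> \<beta>| \<le> p\<close>, and Stepanov's method yields
  \<open>S\<^sub>2\<^sub>m = O(p\<^sup>m)\<close> for fixed \<open>p\<close>; hence \<open>|\<alpha>|, |\<beta>| \<le> \<surd>p\<close>.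
\<close>

section \<open>Stepanov's method\<close>

text \<open>Smoothness serves only to supply, for each n > z, one divisor l in (z, y z]. Fixing one
  l per n leaves the cofactors k in sets without structure, and Cauchy-Schwarz needs none. The n <=
  z are estimated trivially and give M z. The other n are cut into dyadic ranges, since both the
  cost of the twist and the main term M (t, c)/c call for a lower bound on c. Up to small factors
  one l contributes M (x/l)^(1/2) + x^(3/2) M^(1/2) l^(-5/4); summation over z < l <= y z gives the
  two terms of the theorem.

  In the Weil bound the obstacle is that Stepanov's method bounds the number of x of prescribed
  trace from above only. As these numbers add up to the number of all nonzero x, and the character
  sums to zero over the prime field, upper bounds are enough. Extensions of even degree are taken
  because there the trace has the form w + w^Q with Q^2 the size of the field. The constant
  depending on p disappears as m tends to infinity, because |\<alpha> \<beta>| <= p excludes two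
  large roots that cancel.\<close>

lemma underdetermined_poly_system:
  fixes f :: "'i \<Rightarrow> 'a::field poly"
  assumes "finite I" "card I > E" "\<And>i. i \<in> I \<Longrightarrow> f i = 0 \<or> degree (f i) < E"
  shows "\<exists>c. (\<exists>i\<in>I. c i \<noteq> 0) \<and> (\<Sum>i\<in>I. smult (c i) (f i)) = 0"
  using assms
proof (induction E arbitrary: I f)
  case 0
  from 0 have "\<And>i. i \<in> I \<Longrightarrow> f i = 0" by auto
  moreover from 0 obtain i where "i \<in> I" by fastforce
  ultimately show ?case by (intro exI[of _ "\<lambda>_. 1"]) auto
next
  case (Suc E)
  show ?case
  proof (cases "\<forall>i\<in>I. coeff (f i) E = 0")
    case True
    have "f i = 0 \<or> degree (f i) < E" if "i \<in> I" for i
    proof -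
      have "degree (f i) \<le> E" using Suc.prems(3)[OF that] by auto
      then show ?thesis using True that leading_coeff_0_iff[of "f i"] by (metis le_neq_implies_less)
    qed
    then show ?thesis using Suc.IH[of I f] Suc.prems by auto
  next
    case False
    then obtain j where j: "j \<in> I" "coeff (f j) E \<noteq> 0" by auto
    define g where "g i = f i - smult (coeff (f i) E / coeff (f j) E) (f j)" for i
    have "g i = 0 \<or> degree (g i) < E" if "i \<in> I - {j}" for i
    proof -
      have "degree (f i) \<le> E" "degree (f j) \<le> E"
        using Suc.prems(3)[of i] Suc.prems(3)[of j] that j by auto
      then have "degree (g i) \<le> E"
        unfolding g_def by (intro degree_diff_le) (auto intro: order_trans[OF degree_smult_le])
      moreover have "coeff (g i) E = 0" using j by (simp add: g_def)
      ultimately show ?thesis using leading_coeff_0_iff[of "g i"] by (metis le_neq_implies_less)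
    qed
    moreover have "finite (I - {j})" "card (I - {j}) > E" using Suc.prems j by auto
    ultimately obtain c where c: "\<exists>i\<in>I-{j}. c i \<noteq> 0" "(\<Sum>i\<in>I-{j}. smult (c i) (g i)) = 0"
      using Suc.IH[of "I - {j}" g] by blast
    define c' where "c' i = (if i = j then - (\<Sum>i\<in>I-{j}. c i * (coeff (f i) E / coeff (f j) E)) else c i)" for i
    have "(\<Sum>i\<in>I. smult (c' i) (f i)) = smult (c' j) (f j) + (\<Sum>i\<in>I-{j}. smult (c' i) (f i))"
      using j Suc.prems by (simp add: sum.remove)
    also have "(\<Sum>i\<in>I-{j}. smult (c' i) (f i)) = (\<Sum>i\<in>I-{j}. smult (c i) (g i) + smult (c i * (coeff (f i) E / coeff (f j) E)) (f j))"
      by (intro sum.cong) (auto simp: c'_def g_def smult_diff_right)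
    also have "\<dots> = smult (\<Sum>i\<in>I-{j}. c i * (coeff (f i) E / coeff (f j) E)) (f j)"
      using c(2) by (simp add: sum.distrib smult_sum)
    finally have "(\<Sum>i\<in>I. smult (c' i) (f i)) = 0" by (simp add: c'_def)
    moreover have "\<exists>i\<in>I. c' i \<noteq> 0" using c(1) by (auto simp: c'_def)
    ultimately show ?thesis by blast
  qed
qed

lemma sum_distinct_degree_nonzero:
  fixes f :: "'i \<Rightarrow> 'a::field poly"
  assumes "finite I" "\<And>i. i \<in> I \<Longrightarrow> f i \<noteq> 0" "inj_on (\<lambda>i. degree (f i)) I"
    and "\<exists>i\<in>I. c i \<noteq> 0"
  shows "(\<Sum>i\<in>I. smult (c i) (f i)) \<noteq> 0"
proof -
  define J where "J = {i\<in>I. c i \<noteq> 0}"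
  have J: "finite J" "J \<noteq> {}" using assms by (auto simp: J_def)
  define d where "d = Max ((\<lambda>i. degree (f i)) ` J)"
  have "d \<in> (\<lambda>i. degree (f i)) ` J" unfolding d_def using J by (intro Max_in) auto
  then obtain j where j: "j \<in> J" "degree (f j) = d" by auto
  have eq: "(\<Sum>i\<in>I. smult (c i) (f i)) = (\<Sum>i\<in>J. smult (c i) (f i))"
    by (intro sum.mono_neutral_right) (use assms in \<open>auto simp: J_def\<close>)
  have "coeff (\<Sum>i\<in>J. smult (c i) (f i)) d = (\<Sum>i\<in>J. c i * coeff (f i) d)"
    by (simp add: coeff_sum)
  also have "\<dots> = (\<Sum>i\<in>{j}. c i * coeff (f i) d)"
  proof (intro sum.mono_neutral_right ballI)
    fix i assume i: "i \<in> J - {j}"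
    have "degree (f i) \<le> d" unfolding d_def using i J by (intro Max_ge) auto
    moreover have "degree (f i) \<noteq> d" using assms(3) i j by (auto simp: J_def inj_on_def)
    ultimately show "c i * coeff (f i) d = 0" by (simp add: coeff_eq_0)
  qed (use J j in auto)
  also have "\<dots> \<noteq> 0" using j assms(2)[of j] by (auto simp: J_def)
  finally show ?thesis unfolding eq by auto
qed

locale char_p_closure =
  fixes p :: nat and K :: "'k::alg_closed_field itself"
  assumes CHARp: "CHAR('k) = p" and p_prime: "prime p" and p_odd: "p > 2"
begin

lemma prime_CHAR: "prime CHAR('k)" using CHARp p_prime by simp

lemma p_pos: "p > 0" and p_gt1: "p > 1" using p_odd by auto

lemma frob_add: "(x + y :: 'k) ^ (p ^ n) = x ^ (p ^ n) + y ^ (p ^ n)"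
  using freshmans_dream'[OF prime_CHAR, of "p ^ n" n] CHARp by simp

lemma frob_sum: "(\<Sum>i\<in>A. f i :: 'k) ^ (p ^ n) = (\<Sum>i\<in>A. f i ^ (p ^ n))"
  using freshmans_dream_sum'[OF prime_CHAR, of "p ^ n" n] CHARp by simp

lemma frob_minus: "(- x :: 'k) ^ (p ^ n) = - (x ^ (p ^ n))"
proof -
  have "x ^ (p ^ n) + (- x) ^ (p ^ n) = 0"
    using frob_add[of x "-x" n] p_pos by (simp add: power_0_left)
  then show ?thesis by (simp add: eq_neg_iff_add_eq_0 add.commute)
qed

lemma frob_diff: "(x - y :: 'k) ^ (p ^ n) = x ^ (p ^ n) - y ^ (p ^ n)"
  using frob_add[of x "-y" n] by (simp add: frob_minus)

lemma frob_iter: "(x :: 'k) ^ p = x \<Longrightarrow> x ^ (p ^ n) = x"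
proof (induction n)
  case (Suc n)
  have "x ^ (p ^ Suc n) = (x ^ p) ^ (p ^ n)" by (simp flip: power_mult)
  then show ?case using Suc by simp
qed simp

text \<open>
  At the points in question \<open>x\<^bsup>Q*Q\<^esup> = x\<close> and \<open>w(x)\<^sup>Q = t - w(x)\<close>, so the \<open>Q\<close>-th power of a combination of
  the polynomials \<open>P\<close> below agrees there with a combination of the \<open>H\<close>. The latter can be made
  to vanish identically by counting coefficients, while the \<open>P\<close> have distinct degrees.
\<close>

lemma stepanov_bound:
  fixes a b t :: 'k and n :: nat
  assumes a: "a ^ p = a" "a \<noteq> 0" and b: "b ^ p = b"
  defines "r \<equiv> p ^ n" and "Q \<equiv> p ^ Suc n"
  defines "w \<equiv> (\<lambda>x. \<Sum>s<Suc n. a * x ^ (p ^ s) + b / x ^ (p ^ s))"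
  assumes XX: "\<And>x. x \<in> XX \<Longrightarrow> x \<noteq> 0 \<and> x ^ (Q * Q) = x \<and> w x + w x ^ Q = t"
  shows "finite XX \<and> card XX \<le> r * Q + 4 * Q"
proof -
  have r_pos: "r > 0" "Q > 0" "r \<le> Q" using p_pos by (auto simp: r_def Q_def)
  have Q_eq: "Q = p * r" by (simp add: Q_def r_def)
  have s_le: "p ^ s \<le> r" if "s < Suc n" for s
    unfolding r_def using that p_pos by (intro power_increasing) auto
  \<comment> \<open>\<open>W\<close> is x^r w(x): as p^s <= r, the factor x^r clears all
    denominators, and the term s = n gives the exact degree 2 r.\<close>
  define W where "W = (\<Sum>s<Suc n. monom a (r + p ^ s) + monom b (r - p ^ s))"
  have W_eval: "poly W x = x ^ r * w x" if "x \<noteq> 0" for x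
  proof -
    have "poly W x = (\<Sum>s<Suc n. a * x ^ (r + p ^ s) + b * x ^ (r - p ^ s))"
      by (simp add: W_def poly_sum poly_monom)
    also have "\<dots> = (\<Sum>s<Suc n. x ^ r * (a * x ^ (p ^ s) + b / x ^ (p ^ s)))"
      using that s_le by (intro sum.cong refl) (auto simp: field_simps power_add power_diff)
    finally show ?thesis unfolding w_def sum_distrib_left .
  qed
  have W_deg_le: "degree W \<le> 2 * r"
    unfolding W_def
  proof (intro degree_sum_le degree_add_le)
    fix s assume "s \<in> {..<Suc n}"
    then have "p ^ s \<le> r" using s_le by auto
    then show "degree (monom a (r + p ^ s)) \<le> 2 * r" "degree (monom b (r - p ^ s)) \<le> 2 * r"
      by (auto intro!: order_trans[OF degree_monom_le])
  qed auto
  have W_coeff: "coeff W (2 * r) = a"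
  proof -
    have "coeff W (2 * r) = (\<Sum>s<Suc n. (if s = n then a else 0))"
      unfolding W_def coeff_sum
    proof (intro sum.cong refl)
      fix s assume s: "s \<in> {..<Suc n}"
      have "r + p ^ s = 2 * r \<longleftrightarrow> s = n"
        unfolding r_def using p_gt1 by (simp add: power_inject_exp)
      moreover have "r - p ^ s \<noteq> 2 * r" using r_pos by simp
      ultimately show "coeff (monom a (r + p ^ s) + monom b (r - p ^ s)) (2 * r) = (if s = n then a else 0)"
        by simp
    qed
    then show ?thesis by simp
  qed
  have W_deg: "degree W = 2 * r" using W_deg_le W_coeff a le_degree[of W "2 * r"] by simp
  have W_nz: "W \<noteq> 0" using W_coeff a by auto
  \<comment> \<open>Letting \<open>k\<close> run over two values more than \<open>r\<close> makes
    the number r Q + 2 Q of unknowns exceed the number \<open>E\<close> of coefficients for every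
    \<open>n\<close>.\<close>
  define I where "I = {..<r} \<times> {..<p} \<times> {..<r + 2}"
  have finI: "finite I" and cardI: "card I = r * Q + 2 * Q"
    by (auto simp: I_def card_cartesian_product Q_eq algebra_simps)
  \<comment> \<open>Up to a fixed power of x, \<open>H\<close> is what the Q-th power of
    \<open>P\<close> becomes on \<open>XX\<close>: x^((i + k Q) Q) turns into x^(i Q + k), and w
    into t - w. The factor with exponent r (p - 1 - j) makes the power of x that accompanies w^j in
    \<open>P\<close> independent of \<open>j\<close>.\<close>
  define H where "H = (\<lambda>(i, j, k). monom 1 (i * Q + k) * (monom t r - W) ^ j * monom 1 (r * (p - 1 - j)) :: 'k poly)"
  define P where "P = (\<lambda>(i, j, k). monom 1 (i + k * Q) * W ^ j * monom 1 (r * (p - 1 - j)) :: 'k poly)"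
  \<comment> \<open>One more than the degree bound (r - 1) Q + (r + 1) + 2 r (p - 1) for the
    \<open>H\<close>.\<close>
  define E where "E = r * Q + Q - r + 2"
  have degV: "degree (monom t r - W) \<le> 2 * r"
    using W_deg by (intro degree_diff_le) (auto intro!: order_trans[OF degree_monom_le])
  have H_deg: "degree (H x) < E" if "x \<in> I" for x
  proof -
    obtain i j k where x: "x = (i, j, k)" "i < r" "j < p" "k < r + 2" using \<open>x \<in> I\<close> by (auto simp: I_def)
    have "degree (H x) \<le> (i * Q + k) + j * (2 * r) + r * (p - 1 - j)"
      unfolding H_def x prod.case
      by (intro order_trans[OF degree_mult_le] add_mono degree_monom_le
            order_trans[OF degree_power_le]) (use degV in auto)
    also have "j * (2 * r) + r * (p - 1 - j) = r * (j + (p - 1))"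
    proof -
      define v where "v = p - 1 - j"
      have "p - 1 = v + j" using x(3) by (simp add: v_def)
      then show ?thesis by (simp add: algebra_simps)
    qed
    then have "(i * Q + k) + j * (2 * r) + r * (p - 1 - j) = i * Q + k + r * (j + (p - 1))" by simp
    also have "\<dots> \<le> (r - 1) * Q + (r + 1) + r * ((p - 1) + (p - 1))"
      using x by (intro add_mono mult_mono) auto
    also have "\<dots> < E"
    proof -
      obtain r' where r': "r = Suc r'" using r_pos by (cases r) auto
      obtain p' where p': "p = Suc p'" using p_pos by (cases p) auto
      show ?thesis unfolding E_def Q_eq r' p' by (simp add: algebra_simps)
    qed
    finally show ?thesis .
  qed
  have "card I > E"
  proof -
    have "p * 1 \<le> p * r" using r_pos by (intro mult_le_mono) auto
    then have "Q + r > 2" unfolding Q_eq using p_odd by linarith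
    then show ?thesis unfolding cardI E_def using r_pos by simp
  qed
  then have "\<exists>c. (\<exists>i\<in>I. c i \<noteq> 0) \<and> (\<Sum>i\<in>I. smult (c i) (H i)) = 0"
    using H_deg by (intro underdetermined_poly_system[OF finI, of E H]) auto
  then obtain c where c: "\<exists>i\<in>I. c i \<noteq> 0" "(\<Sum>i\<in>I. smult (c i) (H i)) = 0"
    by (elim exE conjE)
  \<comment> \<open>The Q-th power of a combination of the \<open>P\<close> carries the Q-th powers
    of its coefficients, so the solution \<open>c\<close> for the \<open>H\<close> must be replaced
    by Q-th roots.\<close>
  have "\<exists>y. y ^ Q = c i" for i using nth_root_exists[of Q "c i"] r_pos by auto
  then obtain d where d: "\<And>i. d i ^ Q = c i" by metis
  \<comment> \<open>As Q = p r, the degree is r (p - 1) plus a mixed radix number with digits i < r,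
    j < p and leading part k; different triples therefore give different degrees.\<close>
  have P_deg: "P (i, j, k) \<noteq> 0 \<and> degree (P (i, j, k)) = i + r * j + Q * k + r * (p - 1)" if "j < p" for i j k
  proof -
    have "degree (P (i, j, k)) = (i + k * Q) + j * (2 * r) + r * (p - 1 - j)"
      unfolding P_def prod.case using W_nz
      by (simp add: degree_mult_eq degree_power_eq W_deg degree_monom_eq monom_eq_0_iff)
    also have "j * (2 * r) + r * (p - 1 - j) = r * (j + (p - 1))"
    proof -
      define v where "v = p - 1 - j"
      have "p - 1 = v + j" using that by (simp add: v_def)
      then show ?thesis by (simp add: algebra_simps)
    qed
    then have "(i + k * Q) + j * (2 * r) + r * (p - 1 - j) = i + r * j + Q * k + r * (p - 1)"
      by (simp add: algebra_simps)
    finally show ?thesis using W_nz by (simp add: P_def monom_eq_0_iff)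
  qed
  define PP where "PP = (\<Sum>i\<in>I. smult (d i) (P i))"
  have "PP \<noteq> 0" unfolding PP_def
  proof (rule sum_distinct_degree_nonzero)
    show "inj_on (\<lambda>i. degree (P i)) I"
    proof (rule inj_onI, clarsimp simp: I_def)
      fix i j k i' j' k'
      assume *: "i < r" "j < p" "i' < r" "j' < p" "degree (P (i, j, k)) = degree (P (i', j', k'))"
      then have "i + r * j + Q * k + r * (p - 1) = i' + r * j' + Q * k' + r * (p - 1)"
        using P_deg by metis
      then have "i + r * j + Q * k = i' + r * j' + Q * k'" by (rule add_right_imp_eq)
      then have eq: "i + r * (j + p * k) = i' + r * (j' + p * k')"
        by (simp add: Q_eq algebra_simps)
      then have "i = i'" using * by (metis mod_less mod_mult_self2)
      moreover from this eq have "j + p * k = j' + p * k'" using r_pos by auto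
      moreover from this have "j = j'" using * by (metis mod_less mod_mult_self2)
      ultimately show "i = i' \<and> j = j' \<and> k = k'" using p_pos by auto
    qed
    show "P i \<noteq> 0" if "i \<in> I" for i using that P_deg by (auto simp: I_def)
    show "\<exists>i\<in>I. d i \<noteq> 0" using c(1) d r_pos by (metis power_0_left less_irrefl)
  qed (use finI in auto)
  have "degree PP \<le> r * Q + 4 * Q"
    unfolding PP_def
  proof (intro degree_sum_le order_trans[OF degree_smult_le])
    fix x assume "x \<in> I"
    then obtain i j k where x: "x = (i, j, k)" "i < r" "j < p" "k < r + 2" by (auto simp: I_def)
    have "degree (P x) = i + r * j + Q * k + r * (p - 1)" using P_deg x by auto
    also have "\<dots> \<le> r + r * p + Q * (r + 1) + r * p" using x by (intro add_mono mult_mono) auto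
    also have "\<dots> \<le> r * Q + 4 * Q" using r_pos by (simp add: Q_eq algebra_simps)
    finally show "degree (P x) \<le> r * Q + 4 * Q" .
  qed (use finI in auto)
  moreover have "XX \<subseteq> {x. poly PP x = 0}"
  proof safe
    fix x assume "x \<in> XX"
    then have x: "x \<noteq> 0" "x ^ (Q * Q) = x" "w x ^ Q = t - w x" using XX by (auto simp: algebra_simps)
    have term_eq: "x ^ (r * (p - 1)) * (d i * poly (P i) x) ^ Q = x ^ (r * Q * (p - 1)) * (c i * poly (H i) x)"
      if "i \<in> I" for i
    proof -
      obtain u j k where i: "i = (u, j, k)" "j < p" using \<open>i \<in> I\<close> by (auto simp: I_def)
      define v where "v = p - 1 - j"
      have pm: "p - 1 = v + j" using i by (auto simp: v_def)
      have xkQ: "x ^ (k * Q * Q) = x ^ k" using x(2) by (metis mult.assoc mult.commute power_mult)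
      have "poly (P i) x = x ^ (u + k * Q) * (x ^ r * w x) ^ j * x ^ (r * (p - 1 - j))"
        by (simp add: P_def i poly_monom W_eval[OF x(1)])
      then have "poly (P i) x ^ Q = x ^ (u * Q) * x ^ (k * Q * Q) * (x ^ (r * j * Q) * (w x ^ Q) ^ j) * x ^ (r * (p - 1 - j) * Q)"
        by (simp add: power_mult_distrib power_add mult_ac flip: power_mult)
      also have "\<dots> = x ^ (u * Q + k) * (t - w x) ^ j * x ^ (r * Q * (p - 1))"
        unfolding xkQ x(3) v_def[symmetric] pm by (simp add: power_add algebra_simps)
      finally have 1: "poly (P i) x ^ Q = x ^ (u * Q + k) * (t - w x) ^ j * x ^ (r * Q * (p - 1))" .
      have "poly (H i) x = x ^ (u * Q + k) * (t * x ^ r - x ^ r * w x) ^ j * x ^ (r * (p - 1 - j))"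
        by (simp add: H_def i poly_monom W_eval[OF x(1)])
      also have "(t * x ^ r - x ^ r * w x) ^ j = (t - w x) ^ j * x ^ (r * j)"
      proof -
        have "t * x ^ r - x ^ r * w x = (t - w x) * x ^ r" by (simp add: algebra_simps)
        then show ?thesis by (simp add: power_mult_distrib flip: power_mult)
      qed
      finally have 2: "poly (H i) x = x ^ (u * Q + k) * (t - w x) ^ j * x ^ (r * (p - 1))"
        unfolding v_def[symmetric] pm by (simp add: power_add algebra_simps)
      show ?thesis by (simp add: power_mult_distrib d 1 2 mult_ac)
    qed
    have "x ^ (r * (p - 1)) * poly PP x ^ Q = x ^ (r * (p - 1)) * (\<Sum>i\<in>I. (d i * poly (P i) x) ^ Q)"
      by (simp only: PP_def poly_sum poly_smult Q_def frob_sum)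
    also have "\<dots> = x ^ (r * Q * (p - 1)) * (\<Sum>i\<in>I. c i * poly (H i) x)"
      unfolding sum_distrib_left by (intro sum.cong refl term_eq)
    also have "(\<Sum>i\<in>I. c i * poly (H i) x) = poly (\<Sum>i\<in>I. smult (c i) (H i)) x"
      by (simp add: poly_sum)
    finally show "poly PP x = 0" using c(2) x r_pos by simp
  qed
  ultimately show ?thesis
    using \<open>PP \<noteq> 0\<close> poly_roots_finite[of PP] card_mono[of "{x. poly PP x = 0}" XX] card_poly_roots_bound[of PP]
    by (meson finite_subset le_trans)
qed

end

section \<open>Finite subfields of the closure and polynomials over the prime field\<close>

lemma sum_lessThan_add: "(\<Sum>i<m+k. f i) = (\<Sum>i<m. f i) + (\<Sum>i<k. f (m + i))"
  for f :: "nat \<Rightarrow> 'a::comm_monoid_add"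
  by (induction k) (auto simp: add.assoc)

lemma sum_order_eq_degree:
  fixes f :: "'a::alg_closed_field poly"
  assumes "f \<noteq> 0"
  shows "(\<Sum>x | poly f x = 0. order x f) = degree f"
proof -
  obtain A where A: "size A = degree f" "f = smult (lead_coeff f) (\<Prod>x\<in>#A. [:-x, 1:])"
    using alg_closed_imp_factorization[OF assms] by blast
  have "(\<Prod>x\<in>#A. [:-x, 1:]) \<noteq> 0 \<and> proots (\<Prod>x\<in>#A. [:-x, 1:]) = A"
    by (induction A) (auto simp: proots_mult simp del: mult_pCons_left mult_pCons_right)
  then have "proots f = A" using A assms by (metis leading_coeff_0_iff proots_smult)
  then have "size (proots f) = degree f" using A by simp
  then show ?thesis using assms by (simp add: size_multiset_overloaded_eq)
qed

lemma prod_linear_powers_dvd: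
  fixes f :: "'a::field poly"
  assumes "f \<noteq> 0" "finite J" "inj_on c J" "\<And>i. i \<in> J \<Longrightarrow> [:-c i, 1:] ^ k dvd f"
  shows "(\<Prod>i\<in>J. [:-c i, 1:]) ^ k dvd f"
  using assms(2-4)
proof (induction J rule: finite_induct)
  case (insert j J)
  define G where "G = (\<Prod>i\<in>J. [:-c i, 1:]) ^ k"
  have "G dvd f" using insert by (auto simp: G_def)
  then obtain h where h: "f = G * h" by (auto simp: dvd_def)
  have nz: "G * h \<noteq> 0" using h assms(1) by auto
  have "poly G (c j) \<noteq> 0" using insert by (auto simp: G_def poly_prod inj_on_def)
  then have "order (c j) G = 0" by (rule order_0I)
  then have "order (c j) f = order (c j) h" using order_mult[OF nz] h by simp
  moreover have "k \<le> order (c j) f" using insert.prems(2)[of j] assms(1) order_divides by blast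
  ultimately have "[:-c j, 1:] ^ k dvd h" using order_divides by metis
  then have "G * [:-c j, 1:] ^ k dvd f" unfolding h by (intro mult_dvd_mono) auto
  then show ?case using insert by (simp add: G_def power_mult_distrib mult.commute del: mult_pCons_left mult_pCons_right)
qed auto

context char_p_closure
begin

text \<open>For n > 0 this is the subfield with p^n elements, as the fixed points of the n-th
  iterate of Frobenius; \<open>Fq 0\<close> is the whole closure.\<close>

definition Fq :: "nat \<Rightarrow> 'k set" where "Fq n = {x. x ^ (p ^ n) = x}"

lemma Fq_add: "x \<in> Fq n \<Longrightarrow> y \<in> Fq n \<Longrightarrow> x + y \<in> Fq n"
  by (simp add: Fq_def frob_add)
lemma Fq_mult: "x \<in> Fq n \<Longrightarrow> y \<in> Fq n \<Longrightarrow> x * y \<in> Fq n"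
  by (simp add: Fq_def power_mult_distrib)
lemma Fq_minus: "x \<in> Fq n \<Longrightarrow> - x \<in> Fq n"
  by (simp add: Fq_def frob_minus)
lemma Fq_divide: "x \<in> Fq n \<Longrightarrow> y \<in> Fq n \<Longrightarrow> x / y \<in> Fq n"
  by (simp add: Fq_def power_divide)
lemma Fq_0 [simp]: "0 \<in> Fq n" and Fq_1 [simp]: "1 \<in> Fq n"
  using p_pos by (auto simp: Fq_def power_0_left)
lemma Fq1_iff: "x \<in> Fq 1 \<longleftrightarrow> x ^ p = x" by (simp add: Fq_def)

lemmas Fq_closed = Fq_add Fq_mult Fq_minus Fq_divide Fq_0 Fq_1

lemma of_nat_p_power: "n > 0 \<Longrightarrow> of_nat (p ^ n) = (0 :: 'k)"
  using CHARp by (metis dvd_power of_nat_eq_0_iff_char_dvd)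

text \<open>X^(p^n) - X has derivative -1, so its roots are simple and there are as many as its
  degree.\<close>

lemma card_Fq:
  assumes "n > 0"
  shows "finite (Fq n)" "card (Fq n) = p ^ n"
proof -
  define f :: "'k poly" where "f = monom 1 (p ^ n) - monom 1 1"
  have q: "p ^ n > 1" using p_gt1 assms by (rule one_less_power)
  have "coeff f (p ^ n) = 1" using q by (simp add: f_def)
  moreover have "degree f \<le> p ^ n" unfolding f_def
    using q by (intro degree_diff_le) (auto intro!: order_trans[OF degree_monom_le])
  ultimately have f: "f \<noteq> 0" "degree f = p ^ n"
    using le_degree[of f "p ^ n"] by auto
  have roots: "{x. poly f x = 0} = Fq n" by (auto simp: f_def poly_monom Fq_def)
  show "finite (Fq n)" using poly_roots_finite[OF f(1)] roots by simp
  have "pderiv f = - 1" using assms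
    by (simp add: f_def pderiv_diff pderiv_monom of_nat_p_power[OF assms] flip: of_nat_power)
  have "order x f = 1" if "poly f x = 0" for x
  proof -
    have "order x f \<noteq> 0" using that f order_root by blast
    moreover have "\<not> 2 \<le> order x f"
    proof
      assume "2 \<le> order x f"
      then have "[:-x, 1:] ^ 2 dvd f" using order_divides by blast
      then obtain g where "f = [:-x, 1:] ^ 2 * g" by (auto simp: dvd_def)
      then have "poly (pderiv f) x = 0"
        by (simp add: pderiv_mult power2_eq_square del: mult_pCons_left mult_pCons_right)
      then show False using \<open>pderiv f = - 1\<close> by simp
    qed
    ultimately show ?thesis by simp
  qed
  then have "(\<Sum>x | poly f x = 0. order x f) = card (Fq n)"
    by (simp flip: roots)
  then show "card (Fq n) = p ^ n" using sum_order_eq_degree[OF f(1)] f(2) by simp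
qed

definition frob_poly :: "'k poly \<Rightarrow> 'k poly" where
  "frob_poly f = map_poly (\<lambda>c. c ^ p) f"

lemma coeff_frob_poly [simp]: "coeff (frob_poly f) i = coeff f i ^ p"
  using p_pos by (simp add: frob_poly_def coeff_map_poly)

lemma frob_poly_mult: "frob_poly (f * g) = frob_poly f * frob_poly g"
  by (intro poly_eqI) (simp add: coeff_mult power_mult_distrib frob_sum[where n = 1, simplified])

lemma frob_poly_1 [simp]: "frob_poly 1 = 1"
  using p_pos by (intro poly_eqI) (simp add: power_0_left)

lemma frob_poly_prod: "frob_poly (prod f A) = (\<Prod>i\<in>A. frob_poly (f i))"
  by (induction A rule: infinite_finite_induct) (auto simp: frob_poly_mult)

lemma frob_poly_power: "frob_poly (f ^ n) = frob_poly f ^ n"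
  by (induction n) (auto simp: frob_poly_mult)

lemma frob_poly_linear: "frob_poly [:-x, 1:] = [:- (x ^ p), 1:]"
  using p_pos frob_minus[of x 1]
  by (intro poly_eqI) (auto simp: coeff_pCons power_0_left split: nat.splits)

text \<open>Frobenius-invariance of the coefficients expresses that the polynomial is defined over
  the prime field, without leaving polynomials over the closure, where all roots are available. The
  root 0 is excluded because b / x has its pole there.\<close>

definition RF :: "nat \<Rightarrow> 'k poly set" where
  "RF N = {f. degree f = N \<and> coeff f N = 1 \<and> coeff f 0 \<noteq> 0 \<and> frob_poly f = f}"

lemma RF_coeff: "f \<in> RF N \<Longrightarrow> coeff f i \<in> Fq 1"
  unfolding RF_def Fq1_iff by (metis (mono_tags, lifting) coeff_frob_poly mem_Collect_eq)

lemma RF_nonzero: "f \<in> RF N \<Longrightarrow> f \<noteq> 0" by (auto simp: RF_def)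

lemma finite_RF: "finite (RF N)"
proof (rule finite_subset)
  show "RF N \<subseteq> Poly ` {xs. set xs \<subseteq> Fq 1 \<and> length xs \<le> Suc N}"
  proof
    fix f assume f: "f \<in> RF N"
    have "set (coeffs f) \<subseteq> Fq 1"
      using RF_coeff[OF f] by (auto simp: coeffs_def)
    moreover have "length (coeffs f) \<le> Suc N" using f RF_nonzero[OF f]
      by (simp add: length_coeffs_degree RF_def)
    ultimately show "f \<in> Poly ` {xs. set xs \<subseteq> Fq 1 \<and> length xs \<le> Suc N}"
      by (intro image_eqI[of _ _ "coeffs f"]) auto
  qed
  show "finite (Poly ` {xs. set xs \<subseteq> Fq 1 \<and> length xs \<le> Suc N})"
    by (intro finite_imageI finite_lists_length_le card_Fq) auto
qed

lemma RF_mult: "f \<in> RF N \<Longrightarrow> g \<in> RF M \<Longrightarrow> f * g \<in> RF (N + M)"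
  using coeff_mult_degree_sum[of f g] degree_mult_eq[of f g] RF_nonzero[of f N] RF_nonzero[of g M]
  by (auto simp: RF_def frob_poly_mult coeff_mult_0)

lemma RF_cancel:
  assumes "f \<in> RF N" "f * g \<in> RF M" "N \<le> M"
  shows "g \<in> RF (M - N)"
proof -
  have nz: "f \<noteq> 0" "g \<noteq> 0" using assms RF_nonzero by force+
  have deg: "degree g = M - N" using assms nz by (auto simp: RF_def degree_mult_eq)
  have "coeff (f * g) M = coeff f N * coeff g (M - N)"
    using coeff_mult_degree_sum[of f g] assms deg by (simp add: RF_def)
  moreover have "f * frob_poly g = f * g" using assms by (auto simp: RF_def frob_poly_mult)
  ultimately show ?thesis using assms nz deg by (auto simp: RF_def coeff_mult_0)
qed

lemma RF_0: "RF 0 = {1}"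
  using frob_poly_1 by (auto simp: RF_def elim!: degree_eq_zeroE simp: one_pCons)

text \<open>For x in \<open>Fq n\<close> this is the characteristic polynomial of x over the prime
  field in the field with p^n elements, that is, a power of the minimal polynomial of x.\<close>

definition phi :: "'k \<Rightarrow> nat \<Rightarrow> 'k poly" where
  "phi x n = (\<Prod>i<n. [:- (x ^ (p ^ i)), 1:])"

lemma degree_phi: "degree (phi x n) = n"
  unfolding phi_def by (subst degree_prod_eq_sum_degree) auto

lemma phi_nonzero: "phi x n \<noteq> 0" by (auto simp: phi_def)

text \<open>Frobenius moves each linear factor to the next one, and x^(p^n) = x closes the
  cycle.\<close>

lemma phi_RF:
  assumes "x \<in> Fq n" "x \<noteq> 0"
  shows "phi x n \<in> RF n"
proof -
  define h where "h i = [:- (x ^ (p ^ i)), 1:]" for i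
  have "frob_poly (phi x n) = (\<Prod>i<n. h (Suc i))"
    by (simp add: phi_def frob_poly_prod frob_poly_linear h_def mult.commute flip: power_mult)
  moreover have "h 0 * (\<Prod>i<n. h (Suc i)) = h n * (\<Prod>i<n. h i)"
    by (metis prod.lessThan_Suc prod.lessThan_Suc_shift mult.commute)
  moreover have "h n = h 0" "h 0 \<noteq> 0" using assms by (auto simp: h_def Fq_def)
  ultimately have "frob_poly (phi x n) = (\<Prod>i<n. h i)" by (metis mult_left_cancel)
  then have "frob_poly (phi x n) = phi x n" by (simp add: phi_def h_def)
  moreover have "lead_coeff (phi x n) = 1" by (simp add: phi_def lead_coeff_prod)
  moreover have "coeff (phi x n) 0 \<noteq> 0"
    using assms by (simp add: phi_def poly_prod flip: poly_0_coeff_0)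
  ultimately show ?thesis by (simp add: RF_def degree_phi)
qed

lemma frob_inj: "(x :: 'k) ^ (p ^ n) = y ^ (p ^ n) \<Longrightarrow> x = y"
  using frob_diff[of x y n] by simp

lemma frob_shift_cancel:
  assumes "i \<le> j" "(x :: 'k) ^ (p ^ i) = x ^ (p ^ j)"
  shows "x \<in> Fq (j - i)"
proof -
  have "x ^ (p ^ j) = (x ^ (p ^ (j - i))) ^ (p ^ i)"
    using assms(1) by (simp add: power_add[symmetric] flip: power_mult)
  then have "x = x ^ (p ^ (j - i))" using assms(2) frob_inj[of x i] by metis
  then show ?thesis by (simp add: Fq_def)
qed

lemma Fq_mult_period: "x \<in> Fq d \<Longrightarrow> x ^ (p ^ (i + k * d)) = x ^ (p ^ i)"
proof (induction k)
  case (Suc k)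
  have "x ^ (p ^ (i + Suc k * d)) = (x ^ (p ^ d)) ^ (p ^ (i + k * d))"
    by (simp add: power_add algebra_simps flip: power_mult)
  then show ?case using Suc by (simp add: Fq_def)
qed simp

text \<open>Let d be the degree of x over the prime field. Then x lies in \<open>Fq n\<close>
  exactly when d divides n, and \<open>phi x (k * d)\<close> is the k-th power of the minimal
  polynomial. The n that are counted are therefore the k d with k up to the multiplicity of x. This
  replaces factorization into irreducible polynomials over the prime field.\<close>

lemma card_phi_dvd:
  assumes f: "f \<in> RF N" and x: "poly f x = 0"
  shows "card {n \<in> {1..N}. x \<in> Fq n \<and> phi x n dvd f} = order x f"
proof -
  have f0: "f \<noteq> 0" using f by (rule RF_nonzero)
  have root_step: "[:-(y ^ p), 1:] ^ k dvd f" if y: "[:-y, 1:] ^ k dvd f" for y k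
  proof -
    obtain h where "f = [:-y, 1:] ^ k * h" using y by (rule dvdE)
    then have "frob_poly f = [:-(y ^ p), 1:] ^ k * frob_poly h"
      by (simp only: frob_poly_mult frob_poly_power frob_poly_linear)
    then show ?thesis using f by (auto simp: RF_def)
  qed
  have roots: "[:-(x ^ (p ^ i)), 1:] ^ k dvd f" if "k \<le> order x f" for i k
  proof (induction i)
    case 0
    then show ?case using that order_divides[of x k f] by simp
  next
    case (Suc i)
    then show ?case using root_step[of "x ^ (p ^ i)" k] by (simp add: mult.commute flip: power_mult)
  qed
  have x0: "x \<noteq> 0" using x f by (auto simp: RF_def poly_0_coeff_0)
  \<comment> \<open>The Frobenius orbit of x stays among the finitely many roots of f, so two
    iterates coincide and x lies in some \<open>Fq n\<close>.\<close>
  have "order x f \<ge> 1" using x f0 order_root[of f x] by simp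
  then have "(\<lambda>i. x ^ (p ^ i)) ` UNIV \<subseteq> {y. poly f y = 0}"
    using roots[of 1] by (auto simp: poly_eq_0_iff_dvd)
  then have "finite (range (\<lambda>i. x ^ (p ^ i)))" using poly_roots_finite[OF f0] finite_subset by blast
  then have "\<not> inj (\<lambda>i::nat. x ^ (p ^ i))" using finite_imageD by blast
  then obtain i j :: nat where "i < j" "x ^ (p ^ i) = x ^ (p ^ j)"
    unfolding inj_def by (metis linorder_neqE_nat)
  then have ex: "\<exists>n. n > 0 \<and> x \<in> Fq n" using frob_shift_cancel[of i j x] by (intro exI[of _ "j - i"]) auto
  define d where "d = (LEAST n. n > 0 \<and> x \<in> Fq n)"
  have d: "d > 0" "x \<in> Fq d" using LeastI_ex[OF ex] by (auto simp: d_def)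
  have d_le: "d \<le> n" if "n > 0" "x \<in> Fq n" for n unfolding d_def using that by (intro Least_le) auto
  have dvd_iff: "x \<in> Fq n \<longleftrightarrow> d dvd n" for n
  proof
    assume n: "x \<in> Fq n"
    have "x ^ (p ^ n) = x ^ (p ^ (n mod d))"
      using Fq_mult_period[OF d(2), of "n mod d" "n div d"] by simp
    then have "x \<in> Fq (n mod d)" using n by (simp add: Fq_def)
    then have "n mod d = 0" using d_le[of "n mod d"] d(1) by (meson leD mod_less_divisor neq0_conv)
    then show "d dvd n" by auto
  next
    assume "d dvd n"
    then obtain k where "n = 0 + k * d" by (auto simp: dvd_def mult.commute)
    then show "x \<in> Fq n" using Fq_mult_period[OF d(2), of 0 k] by (simp add: Fq_def)
  qed
  have phi_pow: "phi x (k * d) = phi x d ^ k" for k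
  proof (induction k)
    case (Suc k)
    have "phi x (k * d + m) = phi x (k * d) * phi x m" for m
    proof (induction m)
      case (Suc m)
      then show ?case using Fq_mult_period[OF d(2), of m k]
        by (simp add: phi_def add.commute mult_ac del: mult_pCons_left mult_pCons_right)
    qed (simp add: phi_def)
    then show ?case using Suc by (simp add: mult.commute add.commute)
  qed (simp add: phi_def)
  have inj: "inj_on (\<lambda>i. x ^ (p ^ i)) {..<d}"
  proof (rule linorder_inj_onI)
    fix i j assume "i < j" "i \<in> {..<d}" "j \<in> {..<d}"
    then show "x ^ (p ^ i) \<noteq> x ^ (p ^ j)"
      using frob_shift_cancel[of i j x] d_le[of "j - i"] by auto
  qed auto
  have key: "phi x d ^ k dvd f \<longleftrightarrow> k \<le> order x f" for k
  proof
    assume "phi x d ^ k dvd f"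
    moreover have "[:-x, 1:] dvd phi x d" unfolding phi_def using d
      by (intro dvd_trans[OF _ dvd_prodI[of _ 0]]) auto
    ultimately have "[:-x, 1:] ^ k dvd f" by (meson dvd_power_same dvd_trans)
    then show "k \<le> order x f" using order_divides f0 by blast
  next
    assume "k \<le> order x f"
    then show "phi x d ^ k dvd f" unfolding phi_def
      using inj roots f0 by (intro prod_linear_powers_dvd) auto
  qed
  have "{n \<in> {1..N}. x \<in> Fq n \<and> phi x n dvd f} = (\<lambda>k. k * d) ` {1..order x f}"
  proof safe
    fix n assume n: "n \<in> {1..N}" "x \<in> Fq n" "phi x n dvd f"
    then obtain k where k: "n = k * d" using dvd_iff by (auto simp: dvd_def mult.commute)
    then have "k \<le> order x f" "k \<ge> 1" using n key phi_pow by (auto simp: Suc_le_eq)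
    then show "n \<in> (\<lambda>k. k * d) ` {1..order x f}" using k by auto
  next
    fix k assume k: "k \<in> {1..order x f}"
    then show "x \<in> Fq (k * d)" "phi x (k * d) dvd f" using dvd_iff key phi_pow by auto
    then have "degree (phi x (k * d)) \<le> degree f" using f0 dvd_imp_degree_le by blast
    then show "k * d \<in> {1..N}" using f k d by (auto simp: degree_phi RF_def Suc_le_eq)
  qed
  moreover have "inj_on (\<lambda>k. k * d) {1..order x f}" using d by (auto simp: inj_on_def)
  ultimately show ?thesis by (simp add: card_image)
qed

text \<open>The polynomial analogue of the fact that the von Mangoldt function, summed over the
  divisors of a number, gives its logarithm. Exchanging the sums over n and over the roots of f
  leaves the sum of the multiplicities, which is the degree.\<close>

lemma sum_card_phi_dvd:
  assumes f: "f \<in> RF N"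
  shows "(\<Sum>n=1..N. card {x \<in> Fq n - {0}. phi x n dvd f}) = N"
proof -
  let ?Z = "{x. poly f x = 0}"
  have finZ: "finite ?Z" using poly_roots_finite RF_nonzero[OF f] by blast
  have "(\<Sum>n=1..N. card {x \<in> Fq n - {0}. phi x n dvd f})
      = (\<Sum>n=1..N. \<Sum>x\<in>?Z. if x \<in> Fq n \<and> phi x n dvd f then 1 else 0)"
  proof (intro sum.cong refl)
    fix n assume n: "n \<in> {1..N}"
    have "{x \<in> Fq n - {0}. phi x n dvd f} = {x \<in> ?Z. x \<in> Fq n \<and> phi x n dvd f}"
    proof safe
      fix x assume x: "phi x n dvd f"
      have "[:-x, 1:] dvd phi x n" unfolding phi_def using n
        by (intro dvd_trans[OF _ dvd_prodI[of _ 0]]) auto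
      then show "poly f x = 0" using x by (meson dvd_trans poly_eq_0_iff_dvd)
    next
      assume "poly f 0 = 0" then show False using f by (auto simp: RF_def poly_0_coeff_0)
    qed
    then show "card {x \<in> Fq n - {0}. phi x n dvd f} = (\<Sum>x\<in>?Z. if x \<in> Fq n \<and> phi x n dvd f then 1 else 0)"
      using finZ by (simp add: sum.If_cases Int_def)
  qed
  also have "\<dots> = (\<Sum>x\<in>?Z. \<Sum>n=1..N. if x \<in> Fq n \<and> phi x n dvd f then 1 else 0)"
    by (rule sum.swap)
  also have "\<dots> = (\<Sum>x\<in>?Z. order x f)"
  proof (intro sum.cong refl)
    fix x assume "x \<in> ?Z"
    then have "order x f = card {n \<in> {1..N}. x \<in> Fq n \<and> phi x n dvd f}"
      using card_phi_dvd[OF f] by simp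
    also have "\<dots> = (\<Sum>n=1..N. if x \<in> Fq n \<and> phi x n dvd f then 1 else 0)"
      by (simp add: sum.If_cases Int_def)
    finally show "(\<Sum>n=1..N. if x \<in> Fq n \<and> phi x n dvd f then 1 else 0) = order x f" by simp
  qed
  also have "\<dots> = N" using sum_order_eq_degree RF_nonzero[OF f] f by (auto simp: RF_def)
  finally show ?thesis .
qed

end

section \<open>The L-function of a Kloosterman sum\<close>

text \<open>The value of f'/f at 0. If f is a product of factors X - x_i, it is minus the sum of the
  1 / x_i, and for the reflected polynomial minus the sum of the x_i.\<close>

definition log_deriv0 :: "'a::field poly \<Rightarrow> 'a" where
  "log_deriv0 f = coeff f 1 / coeff f 0"

lemma log_deriv0_mult:
  assumes "coeff f 0 \<noteq> 0" "coeff g 0 \<noteq> 0"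
  shows "log_deriv0 (f * g) = log_deriv0 f + log_deriv0 g"
  using assms by (simp add: log_deriv0_def coeff_mult field_simps)

text \<open>The hypotheses are Newton's identities for 1 + A1 T + A2 T^2 = (1 - \<alpha> T) (1 -
  \<beta> T); the numbers \<alpha>, \<beta> come from the quadratic formula.\<close>

lemma recurrence_power_sums:
  fixes S :: "nat \<Rightarrow> complex"
  assumes "A1 = S 1" "2 * A2 = S 1 * A1 + S 2" "\<And>n. S (n + 3) + S (n + 2) * A1 + S (n + 1) * A2 = 0"
  shows "\<exists>\<alpha> \<beta>. \<alpha> + \<beta> = - A1 \<and> \<alpha> * \<beta> = A2 \<and> (\<forall>n\<ge>1. S n = - (\<alpha> ^ n + \<beta> ^ n))"
proof -
  define s where "s = csqrt (A1\<^sup>2 - 4 * A2)"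
  define \<alpha> where "\<alpha> = (- A1 + s) / 2"
  define \<beta> where "\<beta> = (- A1 - s) / 2"
  have sum: "\<alpha> + \<beta> = - A1" by (simp add: \<alpha>_def \<beta>_def field_simps)
  have s2: "s * s = A1 * A1 - 4 * A2" using power2_csqrt[of "A1\<^sup>2 - 4 * A2"]
    by (simp add: s_def power2_eq_square)
  have prod: "\<alpha> * \<beta> = A2" by (simp add: \<alpha>_def \<beta>_def algebra_simps s2)
  have eq: "A1 = - (\<alpha> + \<beta>)" "A2 = \<alpha> * \<beta>" using sum prod by auto
  have "S (n + 1) = - (\<alpha> ^ (n + 1) + \<beta> ^ (n + 1)) \<and> S (n + 2) = - (\<alpha> ^ (n + 2) + \<beta> ^ (n + 2))" for n
  proof (induction n)
    case 0
    have "S 2 = 2 * A2 - A1 * A1" using assms(1,2) by (simp add: algebra_simps)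
    then have "S 2 = - (\<alpha> ^ 2 + \<beta> ^ 2)" unfolding eq by (simp add: algebra_simps power2_eq_square)
    moreover have "S 1 = - (\<alpha> ^ 1 + \<beta> ^ 1)" using assms(1) eq by simp
    ultimately show ?case by (simp only: add_0_left)
  next
    case (Suc n)
    have "S (n + 3) = - (S (n + 2) * A1 + S (n + 1) * A2)"
      using assms(3)[of n] by (metis (no_types) add.assoc eq_neg_iff_add_eq_0)
    also have "\<dots> = - (\<alpha> ^ (n + 3) + \<beta> ^ (n + 3))"
      unfolding Suc[THEN conjunct1] Suc[THEN conjunct2] unfolding eq by (simp add: algebra_simps numeral_eq_Suc)
    finally show ?case using Suc by (simp add: numeral_eq_Suc)
  qed
  then have "\<forall>n\<ge>1. S n = - (\<alpha> ^ n + \<beta> ^ n)"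
    by (metis le_add_diff_inverse2)
  then show ?thesis using sum prod by blast
qed

text \<open>If |\<alpha>| exceeded the square root of \<open>P\<close>, the bound on the product
  would keep |\<beta>| below it, so \<beta>^(2 m) could not cancel \<alpha>^(2 m), which outgrows
  every constant multiple of P^m.\<close>

lemma power_sum_bound_imp:
  fixes \<alpha> \<beta> :: complex and P C :: real
  assumes "P > 0" "norm (\<alpha> * \<beta>) \<le> P" "\<And>m. m \<ge> 1 \<Longrightarrow> norm (\<alpha> ^ (2 * m) + \<beta> ^ (2 * m)) \<le> C * P ^ m"
  shows "norm \<alpha> \<le> sqrt P"
proof (rule ccontr)
  assume "\<not> norm \<alpha> \<le> sqrt P"
  then have a: "norm \<alpha> > sqrt P" by simp
  have sP: "sqrt P > 0" using assms by simp
  have b: "norm \<beta> \<le> sqrt P"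
  proof (rule ccontr)
    assume "\<not> norm \<beta> \<le> sqrt P"
    then have "norm \<alpha> * norm \<beta> > sqrt P * sqrt P" using a sP by (intro mult_strict_mono) auto
    then show False using assms by (simp add: norm_mult)
  qed
  define \<rho> where "\<rho> = (norm \<alpha>)\<^sup>2 / P"
  have "(sqrt P)\<^sup>2 < (norm \<alpha>)\<^sup>2" using a sP by (intro power_strict_mono) auto
  then have \<rho>: "\<rho> > 1" using assms by (simp add: \<rho>_def)
  have "\<rho> ^ m \<le> C + 1" if "m \<ge> 1" for m
  proof -
    have "norm (\<alpha> ^ (2 * m)) \<le> norm (\<alpha> ^ (2 * m) + \<beta> ^ (2 * m)) + norm (\<beta> ^ (2 * m))"
      using norm_triangle_ineq4[of "\<alpha> ^ (2 * m) + \<beta> ^ (2 * m)" "\<beta> ^ (2 * m)"] by simp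
    also have "norm (\<beta> ^ (2 * m)) \<le> (sqrt P) ^ (2 * m)" using b by (simp add: norm_power power_mono)
    also have "(sqrt P) ^ (2 * m) = P ^ m" using assms by (simp add: power_mult)
    finally have "norm (\<alpha> ^ (2 * m)) \<le> C * P ^ m + P ^ m" using assms(3)[OF that] by simp
    then have "((norm \<alpha>)\<^sup>2) ^ m \<le> (C + 1) * P ^ m" unfolding norm_power power_mult by (simp add: algebra_simps)
    then show ?thesis using assms by (simp add: \<rho>_def power_divide divide_simps)
  qed
  moreover obtain n where "\<rho> ^ n > C + 1" using real_arch_pow[OF \<rho>] by blast
  moreover have "\<rho> ^ n \<le> \<rho> ^ Suc n" using \<rho> by simp
  ultimately show False using \<open>\<And>m. m \<ge> 1 \<Longrightarrow> \<rho> ^ m \<le> C + 1\<close>[of "Suc n"] by linarith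
qed

declare One_nat_def [simp del]

locale kloosterman_character = char_p_closure p K for p and K :: "'k::alg_closed_field itself" +
  fixes \<psi> :: "'k \<Rightarrow> complex" and a b :: 'k
  assumes a: "a \<in> Fq 1" "a \<noteq> 0" and b: "b \<in> Fq 1" "b \<noteq> 0"
    and psi_add: "\<And>x y. x \<in> Fq 1 \<Longrightarrow> y \<in> Fq 1 \<Longrightarrow> \<psi> (x + y) = \<psi> x * \<psi> y"
    and psi_norm: "\<And>x. x \<in> Fq 1 \<Longrightarrow> norm (\<psi> x) = 1"
    and psi_nontrivial: "\<exists>x\<in>Fq 1. \<psi> x \<noteq> 1"
begin

lemma psi_0 [simp]: "\<psi> 0 = 1"
  using psi_add[of 0 0] psi_norm[of 0] by auto

lemma sum_psi: "(\<Sum>x\<in>Fq 1. \<psi> x) = 0"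
proof -
  obtain t where t: "t \<in> Fq 1" "\<psi> t \<noteq> 1" using psi_nontrivial by blast
  have "(\<Sum>x\<in>Fq 1. \<psi> x) = (\<Sum>x\<in>Fq 1. \<psi> (t + x))"
    by (rule sum.reindex_bij_witness[of _ "\<lambda>x. t + x" "\<lambda>x. x + - t"])
       (use t in \<open>auto intro!: Fq_add Fq_minus simp del: add_uminus_conv_diff\<close>)
  also have "\<dots> = \<psi> t * (\<Sum>x\<in>Fq 1. \<psi> x)"
    by (simp add: sum_distrib_left psi_add t cong: sum.cong)
  finally show ?thesis using t by simp
qed

lemma sum_psi_mult:
  assumes "c \<in> Fq 1" "c \<noteq> 0"
  shows "(\<Sum>x\<in>Fq 1. \<psi> (x * c)) = 0"
proof -
  have "(\<Sum>x\<in>Fq 1. \<psi> (x * c)) = (\<Sum>x\<in>Fq 1. \<psi> x)"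
    by (rule sum.reindex_bij_witness[of _ "\<lambda>x. x / c" "\<lambda>x. x * c"])
       (use assms in \<open>auto intro!: Fq_mult Fq_divide\<close>)
  then show ?thesis using sum_psi by simp
qed

text \<open>Over the roots x of f, with multiplicity, this is the sum of a x + b / x. Written in
  coefficients it visibly takes values in the prime field, and it involves only the two lowest and
  the two highest of them.\<close>

definition lam :: "'k poly \<Rightarrow> 'k" where
  "lam f = - (a * log_deriv0 (reflect_poly f) + b * log_deriv0 f)"

lemma lam_1 [simp]: "lam 1 = 0" by (simp add: lam_def log_deriv0_def)

lemma lam_mult: "coeff f 0 \<noteq> 0 \<Longrightarrow> coeff g 0 \<noteq> 0 \<Longrightarrow> lam (f * g) = lam f + lam g"
proof -
  assume *: "coeff f 0 \<noteq> 0" "coeff g 0 \<noteq> 0"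
  then have "coeff (reflect_poly f) 0 \<noteq> 0" "coeff (reflect_poly g) 0 \<noteq> 0" by auto
  with * show ?thesis by (simp add: lam_def reflect_poly_mult log_deriv0_mult algebra_simps)
qed

lemma lam_linear: "x \<noteq> 0 \<Longrightarrow> lam [:-x, 1:] = a * x + b / x"
  by (simp add: lam_def log_deriv0_def reflect_poly_pCons One_nat_def)

lemma lam_phi: "x \<noteq> 0 \<Longrightarrow> lam (phi x n) = (\<Sum>i<n. a * x ^ (p ^ i) + b / x ^ (p ^ i))"
proof (induction n)
  case 0
  then show ?case by (simp add: phi_def)
next
  case (Suc n)
  have "coeff (phi x n) 0 \<noteq> 0" using Suc by (simp add: phi_def poly_prod flip: poly_0_coeff_0)
  then have "lam (phi x n * [:-(x ^ (p ^ n)), 1:]) = lam (phi x n) + lam [:-(x ^ (p ^ n)), 1:]"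
    using Suc.prems by (intro lam_mult) auto
  moreover have "phi x (Suc n) = phi x n * [:-(x ^ (p ^ n)), 1:]" by (simp add: phi_def)
  ultimately show ?case using Suc lam_linear[of "x ^ (p ^ n)"] by simp
qed

lemma lam_RF: "f \<in> RF N \<Longrightarrow> lam f \<in> Fq 1"
  unfolding lam_def log_deriv0_def
  by (intro Fq_closed a b) (auto simp: coeff_reflect_poly RF_coeff)

text \<open>
  \<open>AA N\<close> is the coefficient of \<open>T\<^sup>N\<close> in the L-function, \<open>SS n\<close> the Kloosterman sum over the field with
  \<open>p\<^sup>n\<close> elements; the argument of \<open>\<psi>\<close> in \<open>SS n\<close> is the trace of \<open>a x + b / x\<close>.
\<close>

definition AA :: "nat \<Rightarrow> complex" where "AA N = (\<Sum>f\<in>RF N. \<psi> (lam f))"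

definition SS :: "nat \<Rightarrow> complex" where
  "SS n = (\<Sum>x\<in>Fq n - {0}. \<psi> (\<Sum>i<n. a * x ^ (p ^ i) + b / x ^ (p ^ i)))"

text \<open>Multiplication by \<open>phi x n\<close> maps \<open>RF (N - n)\<close> bijectively onto
  the multiples of \<open>phi x n\<close> in \<open>RF N\<close>, and \<psi> composed with
  \<open>lam\<close> is multiplicative. The product thus counts each f once for every x whose
  \<open>phi x n\<close> divides it.\<close>

lemma SS_AA:
  assumes "1 \<le> n" "n \<le> N"
  shows "SS n * AA (N - n) = (\<Sum>f\<in>RF N. \<psi> (lam f) * of_nat (card {x \<in> Fq n - {0}. phi x n dvd f}))"
proof -
  have fin: "finite (Fq n - {0})" using card_Fq(1)[of n] assms by auto
  have "SS n * AA (N - n) = (\<Sum>x\<in>Fq n - {0}. \<Sum>g\<in>RF (N - n). \<psi> (lam (phi x n)) * \<psi> (lam g))"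
    unfolding SS_def AA_def sum_product by (intro sum.cong refl) (auto simp: lam_phi)
  also have "\<dots> = (\<Sum>x\<in>Fq n - {0}. \<Sum>f\<in>RF N. if phi x n dvd f then \<psi> (lam f) else 0)"
  proof (rule sum.cong[OF refl])
    fix x assume x: "x \<in> Fq n - {0}"
    then have phi: "phi x n \<in> RF n" using phi_RF by auto
    have "(\<Sum>g\<in>RF (N - n). \<psi> (lam (phi x n)) * \<psi> (lam g)) = (\<Sum>g\<in>RF (N - n). \<psi> (lam (phi x n * g)))"
    proof (intro sum.cong refl)
      fix g assume g: "g \<in> RF (N - n)"
      then show "\<psi> (lam (phi x n)) * \<psi> (lam g) = \<psi> (lam (phi x n * g))"
        using phi lam_RF by (subst lam_mult) (auto simp: RF_def psi_add)
    qed
    also have "\<dots> = (\<Sum>f\<in>(\<lambda>g. phi x n * g) ` RF (N - n). \<psi> (lam f))"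
      using phi_nonzero[of x n] by (subst sum.reindex) (auto simp: inj_on_def)
    also have "(\<lambda>g. phi x n * g) ` RF (N - n) = {f \<in> RF N. phi x n dvd f}"
    proof safe
      fix g assume "g \<in> RF (N - n)"
      then show "phi x n * g \<in> RF N" using RF_mult[OF phi] assms by fastforce
    next
      fix f assume f: "f \<in> RF N" "phi x n dvd f"
      from f(2) obtain g where g: "f = phi x n * g" by (rule dvdE)
      then have "g \<in> RF (N - n)" using f RF_cancel[OF phi] assms by auto
      then show "f \<in> (\<lambda>g. phi x n * g) ` RF (N - n)" using g by auto
    qed auto
    also have "(\<Sum>f | f \<in> RF N \<and> phi x n dvd f. \<psi> (lam f)) = (\<Sum>f\<in>RF N. if phi x n dvd f then \<psi> (lam f) else 0)"
      using finite_RF by (simp add: sum.inter_filter)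
    finally show "(\<Sum>g\<in>RF (N - n). \<psi> (lam (phi x n)) * \<psi> (lam g)) = (\<Sum>f\<in>RF N. if phi x n dvd f then \<psi> (lam f) else 0)" .
  qed
  also have "\<dots> = (\<Sum>f\<in>RF N. \<Sum>x\<in>Fq n - {0}. if phi x n dvd f then \<psi> (lam f) else 0)"
    by (rule sum.swap)
  also have "\<dots> = (\<Sum>f\<in>RF N. \<psi> (lam f) * of_nat (card {x \<in> Fq n - {0}. phi x n dvd f}))"
  proof (intro sum.cong refl)
    fix f
    show "(\<Sum>x\<in>Fq n - {0}. if phi x n dvd f then \<psi> (lam f) else 0) = \<psi> (lam f) * of_nat (card {x \<in> Fq n - {0}. phi x n dvd f})"
      using sum.inter_filter[OF fin, of "\<lambda>_. \<psi> (lam f)" "\<lambda>x. phi x n dvd f"] by (simp add: mult.commute)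
  qed
  finally show ?thesis .
qed

text \<open>Newton's identities for \<open>T * L'(T) / L(T)\<close>, where \<open>L(T)\<close> is the generating function of \<open>AA\<close>.\<close>

lemma newton_identity: "of_nat N * AA N = (\<Sum>n=1..N. SS n * AA (N - n))"
proof -
  have "(\<Sum>n=1..N. SS n * AA (N - n)) = (\<Sum>n=1..N. \<Sum>f\<in>RF N. \<psi> (lam f) * of_nat (card {x \<in> Fq n - {0}. phi x n dvd f}))"
    by (intro sum.cong refl SS_AA) auto
  also have "\<dots> = (\<Sum>f\<in>RF N. \<Sum>n=1..N. \<psi> (lam f) * of_nat (card {x \<in> Fq n - {0}. phi x n dvd f}))"
    by (rule sum.swap)
  also have "\<dots> = (\<Sum>f\<in>RF N. \<psi> (lam f) * of_nat N)"
  proof (intro sum.cong refl)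
    fix f assume "f \<in> RF N"
    have "(\<Sum>n=1..N. \<psi> (lam f) * of_nat (card {x \<in> Fq n - {0}. phi x n dvd f}))
        = \<psi> (lam f) * of_nat (\<Sum>n=1..N. card {x \<in> Fq n - {0}. phi x n dvd f})"
      by (simp only: of_nat_sum sum_distrib_left)
    then show "(\<Sum>n=1..N. \<psi> (lam f) * of_nat (card {x \<in> Fq n - {0}. phi x n dvd f})) = \<psi> (lam f) * of_nat N"
      by (simp only: sum_card_phi_dvd[OF \<open>f \<in> RF N\<close>])
  qed
  finally show ?thesis by (simp add: AA_def sum_distrib_left mult.commute)
qed

lemma AA_0: "AA 0 = 1" by (simp add: AA_def RF_0)

text \<open>For N >= 3 the coefficient of X^(N-1) is not among the two lowest ones, so adding u
  X^(N-1) permutes \<open>RF N\<close> and changes \<open>lam\<close> by the constant - a u only.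
  With u = - t / a the sum gets multiplied by \<psi> t, which is not 1.\<close>

lemma AA_ge3:
  assumes "N \<ge> 3"
  shows "AA N = 0"
proof -
  obtain t where t: "t \<in> Fq 1" "\<psi> t \<noteq> 1" using psi_nontrivial by blast
  define u where "u = - t / a"
  have u: "u \<in> Fq 1" using t a by (auto simp: u_def intro!: Fq_closed)
  have shift: "f + monom v (N - 1) \<in> RF N \<and> lam (f + monom v (N - 1)) = lam f - a * v"
    if "f \<in> RF N" "v \<in> Fq 1" for f v
  proof -
    define g where "g = f + monom v (N - 1)"
    have c: "coeff g i = coeff f i + (if i = N - 1 then v else 0)" for i by (auto simp: g_def)
    have "degree g \<le> N" unfolding g_def using that
      by (intro degree_add_le) (auto simp: RF_def intro!: order_trans[OF degree_monom_le])
    moreover have gN: "coeff g N = 1" using that assms by (auto simp: c RF_def)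
    ultimately have deg: "degree g = N" by (metis le_antisym le_degree zero_neq_one)
    have "frob_poly g = g"
    proof (rule poly_eqI)
      fix i
      have "coeff g i \<in> Fq 1" unfolding c using that RF_coeff by (auto intro!: Fq_add)
      then show "coeff (frob_poly g) i = coeff g i" by (simp add: Fq1_iff)
    qed
    then have "g \<in> RF N" using deg gN that assms by (auto simp: RF_def c)
    moreover have "lam g = lam f - a * v"
      using assms that deg by (auto simp: lam_def log_deriv0_def coeff_reflect_poly c RF_def algebra_simps)
    ultimately show ?thesis unfolding g_def by blast
  qed
  have "AA N = (\<Sum>f\<in>RF N. \<psi> (lam (f + monom u (N - 1))))"
    unfolding AA_def
  proof (rule sum.reindex_bij_witness[of _ "\<lambda>f. f + monom u (N - 1)" "\<lambda>f. f + monom (- u) (N - 1)"])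
    fix f assume f: "f \<in> RF N"
    show "f + monom (- u) (N - 1) + monom u (N - 1) = f" "f + monom u (N - 1) + monom (- u) (N - 1) = f"
      by (simp_all add: add.assoc add_monom)
    show "f + monom (- u) (N - 1) \<in> RF N" "f + monom u (N - 1) \<in> RF N"
      using shift[OF f] u Fq_minus by auto
    show "\<psi> (lam (f + monom (- u) (N - 1) + monom u (N - 1))) = \<psi> (lam f)"
      by (simp add: add.assoc add_monom)
  qed
  also have "\<dots> = (\<Sum>f\<in>RF N. \<psi> (lam f) * \<psi> t)"
  proof (intro sum.cong refl)
    fix f assume f: "f \<in> RF N"
    have "lam (f + monom u (N - 1)) = lam f + t" using shift[OF f u] a by (simp add: u_def)
    then show "\<psi> (lam (f + monom u (N - 1))) = \<psi> (lam f) * \<psi> t"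
      using psi_add lam_RF[OF f] t by simp
  qed
  also have "\<dots> = AA N * \<psi> t" by (simp only: AA_def sum_distrib_right)
  finally have "AA N = AA N * \<psi> t" .
  then show ?thesis using t by simp
qed

text \<open>For f = X^2 + u X + v the value of \<open>lam\<close> is - u (a + b / v). Summation over
  u annihilates every v except v = - b / a, which contributes p.\<close>

lemma norm_AA_2: "norm (AA 2) \<le> p"
proof -
  have "AA 2 = (\<Sum>(v, u)\<in>(Fq 1 - {0}) \<times> Fq 1. \<psi> (u * (- (a + b / v))))"
    unfolding AA_def
  proof (rule sum.reindex_bij_witness[of _ "\<lambda>(v, u). [:v, u, 1:]" "\<lambda>f. (coeff f 0, coeff f 1)"])
    fix f assume f: "f \<in> RF 2"
    then have f': "degree f = 2" "coeff f 2 = 1" "coeff f 0 \<noteq> 0" by (auto simp: RF_def)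
    have eq: "f = [:coeff f 0, coeff f 1, 1:]"
    proof (rule poly_eqI)
      fix i :: nat
      consider "i = 0" | "i = 1" | "i = 2" | "i > 2" by linarith
      then show "coeff f i = coeff [:coeff f 0, coeff f 1, 1:] i"
        using f' by cases (auto simp: coeff_eq_0 numeral_eq_Suc coeff_pCons split: nat.splits)
    qed
    then show "(case (coeff f 0, coeff f 1) of (v, u) \<Rightarrow> [:v, u, 1:]) = f" by simp
    show "(coeff f 0, coeff f 1) \<in> (Fq 1 - {0}) \<times> Fq 1" using f' RF_coeff[OF f] by auto
    have "lam f = coeff f 1 * (- (a + b / coeff f 0))"
      using f' by (simp add: lam_def log_deriv0_def coeff_reflect_poly algebra_simps One_nat_def)
    then show "(case (coeff f 0, coeff f 1) of (v, u) \<Rightarrow> \<psi> (u * (- (a + b / v)))) = \<psi> (lam f)" by simp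
  next
    fix x assume "x \<in> (Fq 1 - {0}) \<times> Fq 1"
    then obtain v u where x: "x = (v, u)" "v \<in> Fq 1" "v \<noteq> 0" "u \<in> Fq 1" by auto
    then show "(coeff (case x of (v, u) \<Rightarrow> [:v, u, 1:]) 0, coeff (case x of (v, u) \<Rightarrow> [:v, u, 1:]) 1) = x"
      by (simp add: One_nat_def)
    have "frob_poly [:v, u, 1:] = [:v, u, 1:]"
      using x p_pos by (intro poly_eqI) (auto simp: coeff_pCons Fq1_iff[simplified] power_0_left split: nat.splits)
    then show "(case x of (v, u) \<Rightarrow> [:v, u, 1:]) \<in> RF 2" using x by (simp add: RF_def numeral_eq_Suc)
  qed
  also have "\<dots> = (\<Sum>v\<in>Fq 1 - {0}. \<Sum>u\<in>Fq 1. \<psi> (u * (- (a + b / v))))"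
    by (simp add: sum.cartesian_product)
  also have "\<dots> = (\<Sum>v\<in>Fq 1 - {0}. if v = - b / a then of_nat p else 0)"
  proof (intro sum.cong refl)
    fix v assume v: "v \<in> Fq 1 - {0}"
    have iff: "a + b / v = 0 \<longleftrightarrow> v = - b / a"
      using v a by (auto simp: field_simps eq_neg_iff_add_eq_0)
    show "(\<Sum>u\<in>Fq 1. \<psi> (u * (- (a + b / v)))) = (if v = - b / a then of_nat p else 0)"
    proof (cases "v = - b / a")
      case True
      then show ?thesis using iff card_Fq(2)[of 1] by simp
    next
      case False
      then have "- (a + b / v) \<noteq> 0" using iff by (metis neg_equal_0_iff_equal)
      moreover have "- (a + b / v) \<in> Fq 1" using v a b by (intro Fq_closed) auto
      ultimately show ?thesis using False sum_psi_mult by simp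
    qed
  qed
  also have "norm \<dots> \<le> p"
    using card_Fq(1)[of 1] by (simp add: sum.delta)
  finally show ?thesis .
qed

text \<open>The nonzero elements of the field with Q^2 elements are sorted by their trace t.
  Stepanov's bound r Q + 4 Q for each class is close to the average, because Q^2 = p r Q.\<close>

lemma norm_SS_even: "norm (SS (2 * Suc n)) \<le> 4 * real p * real p ^ Suc n + 1"
proof -
  define Q where "Q = p ^ Suc n"
  define r where "r = p ^ n"
  define w where "w = (\<lambda>x. \<Sum>s<Suc n. a * x ^ (p ^ s) + b / x ^ (p ^ s))"
  define T where "T x = (\<Sum>i<2 * Suc n. a * x ^ (p ^ i) + b / x ^ (p ^ i))" for x
  define V where "V = Fq (2 * Suc n) - {0}"
  have "card (Fq (2 * Suc n)) = Q * Q"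
    using card_Fq(2)[of "2 * Suc n"] by (simp only: mult_2 power_add Q_def)
  then have V: "finite V" "card V = Q * Q - 1"
    using card_Fq(1)[of "2 * Suc n"] by (auto simp: V_def card_Diff_singleton)
  have ab: "a ^ (p ^ k) = a" "b ^ (p ^ k) = b" for k
    using a b frob_iter by (auto simp: Fq_def)
  \<comment> \<open>The second half of the trace is the Q-th power of the first half, as
    \<open>a\<close> and \<open>b\<close> are fixed by Frobenius.\<close>
  have T_eq: "T x = w x + w x ^ Q" for x
  proof -
    have "w x ^ Q = (\<Sum>s<Suc n. (a * x ^ (p ^ s) + b / x ^ (p ^ s)) ^ Q)"
      unfolding w_def Q_def by (rule frob_sum)
    also have "\<dots> = (\<Sum>s<Suc n. a * x ^ (p ^ (Suc n + s)) + b / x ^ (p ^ (Suc n + s)))"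
      unfolding Q_def frob_add
      by (intro sum.cong refl) (simp only: power_mult_distrib power_divide ab power_add mult.commute flip: power_mult)
    finally show ?thesis
      unfolding T_def w_def mult_2 sum_lessThan_add by simp
  qed
  have T_F: "T x \<in> Fq 1" if "x \<in> V" for x
    using that lam_RF[OF phi_RF[of x "2 * Suc n"]] lam_phi[of x "2 * Suc n"] by (auto simp: V_def T_def)
  define N where "N t = card {x \<in> V. T x = t}" for t
  define B where "B = r * Q + 4 * Q"
  have QQ: "Q * Q = p ^ (2 * Suc n)" by (simp only: Q_def mult_2 power_add)
  have N_le: "N t \<le> B" for t
  proof -
    have "x \<noteq> 0 \<and> x ^ (Q * Q) = x \<and> w x + w x ^ Q = t" if "x \<in> {x \<in> V. T x = t}" for x
      using that T_eq[of x] unfolding QQ V_def Fq_def by auto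
    then have "finite {x \<in> V. T x = t} \<and> card {x \<in> V. T x = t} \<le> r * Q + 4 * Q"
      unfolding w_def r_def Q_def using a b
      by (intro stepanov_bound[where a = a and b = b and t = t]) (auto simp: Fq1_iff)
    then show ?thesis by (simp add: N_def B_def)
  qed
  have "SS (2 * Suc n) = (\<Sum>x\<in>V. \<psi> (T x))" by (simp add: SS_def V_def T_def)
  also have "\<dots> = (\<Sum>t\<in>Fq 1. \<Sum>x\<in>{x \<in> V. T x = t}. \<psi> (T x))"
    using V T_F card_Fq(1)[of 1] by (intro sum.group[symmetric]) auto
  also have "\<dots> = (\<Sum>t\<in>Fq 1. of_nat (N t) * \<psi> t)" by (intro sum.cong refl) (simp add: N_def)
  \<comment> \<open>Subtracting the constant \<open>B\<close> costs nothing as \<psi> sums to zero.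
    All B - N t are nonnegative, so the sum of their absolute values is p B minus the number of all
    x, and the leading terms p r Q and Q^2 cancel.\<close>
  also have "\<dots> = (\<Sum>t\<in>Fq 1. of_nat (N t) * \<psi> t) - of_nat B * (\<Sum>t\<in>Fq 1. \<psi> t)" by (simp add: sum_psi)
  also have "\<dots> = - (\<Sum>t\<in>Fq 1. of_real (real B - real (N t)) * \<psi> t)"
    by (simp add: sum_distrib_left sum_subtractf algebra_simps)
  finally have "norm (SS (2 * Suc n)) = norm (\<Sum>t\<in>Fq 1. of_real (real B - real (N t)) * \<psi> t)" by simp
  also have "\<dots> \<le> (\<Sum>t\<in>Fq 1. norm (of_real (real B - real (N t)) * \<psi> t))" by (rule norm_sum)
  also have "\<dots> = (\<Sum>t\<in>Fq 1. real B - real (N t))"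
    using N_le by (intro sum.cong refl) (simp add: norm_mult psi_norm del: of_real_diff)
  also have "\<dots> = real p * real B - real (\<Sum>t\<in>Fq 1. N t)"
    using card_Fq(2)[of 1] by (simp add: sum_subtractf)
  also have "(\<Sum>t\<in>Fq 1. N t) = card V"
  proof -
    have "(\<Sum>t\<in>Fq 1. \<Sum>x\<in>{x \<in> V. T x = t}. 1) = (\<Sum>x\<in>V. 1::nat)"
      using V T_F card_Fq(1)[of 1] by (intro sum.group) auto
    then show ?thesis by (simp add: N_def)
  qed
  also have "real p * real B - real (card V) = 4 * real p * real p ^ Suc n + 1"
  proof -
    have "Q * Q \<ge> 1" using p_pos by (simp add: Q_def Suc_le_eq One_nat_def)
    moreover have "Q = p * r" by (simp add: Q_def r_def)
    ultimately show ?thesis using V by (simp add: B_def of_nat_diff Q_def r_def algebra_simps)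
  qed
  finally show ?thesis .
qed

text \<open>As \<open>AA\<close> vanishes from index 3 on, \<open>newton_identity\<close> yields
  exactly the hypotheses of \<open>recurrence_power_sums\<close>. The factor 4 p + 1 in the bound
  for even indices is harmless, since \<open>power_sum_bound_imp\<close> accepts any
  constant.\<close>

lemma norm_SS_1: "norm (SS 1) \<le> 2 * sqrt p"
proof -
  have 1: "AA 1 = SS 1" using newton_identity[of 1] AA_0 by simp
  have 2: "2 * AA 2 = SS 1 * AA 1 + SS 2"
    using newton_identity[of 2] AA_0 by (simp add: numeral_2_eq_2 One_nat_def)
  have 3: "SS (n + 3) + SS (n + 2) * AA 1 + SS (n + 1) * AA 2 = 0" for n
  proof -
    have "0 = (\<Sum>k=1..n+3. SS k * AA (n + 3 - k))" using newton_identity[of "n + 3"] AA_ge3[of "n + 3"] by simp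
    also have "\<dots> = (\<Sum>k\<in>{n+1, n+2, n+3}. SS k * AA (n + 3 - k))"
      by (intro sum.mono_neutral_right) (auto intro!: AA_ge3)
    finally show ?thesis using AA_0 by (simp add: algebra_simps numeral_eq_Suc One_nat_def)
  qed
  obtain \<alpha> \<beta> where ab: "\<alpha> + \<beta> = - AA 1" "\<alpha> * \<beta> = AA 2" "\<And>n. n \<ge> 1 \<Longrightarrow> SS n = - (\<alpha> ^ n + \<beta> ^ n)"
    using recurrence_power_sums[of "AA 1" SS "AA 2", OF 1 2 3] by blast
  have bound: "norm (\<alpha> ^ (2 * m) + \<beta> ^ (2 * m)) \<le> (4 * real p + 1) * real p ^ m" if "m \<ge> 1" for m
  proof -
    obtain n where m: "m = Suc n" using \<open>m \<ge> 1\<close> by (cases m) auto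
    have "norm (\<alpha> ^ (2 * m) + \<beta> ^ (2 * m)) = norm (SS (2 * Suc n))"
      using ab(3)[of "2 * m"] that norm_minus_cancel unfolding m by (metis One_nat_def Suc_le_eq mult_2 add_gr_0 zero_less_Suc)
    also have "\<dots> \<le> 4 * real p * real p ^ m + 1" unfolding m by (rule norm_SS_even)
    also have "\<dots> \<le> 4 * real p * real p ^ m + real p ^ m"
      using p_pos by (intro add_left_mono one_le_power) auto
    finally show ?thesis by (simp add: algebra_simps)
  qed
  have "norm \<alpha> \<le> sqrt p"
    using power_sum_bound_imp[of "real p" \<alpha> \<beta> "4 * real p + 1"] bound norm_AA_2 ab p_pos by simp
  moreover have "norm \<beta> \<le> sqrt p"
    using power_sum_bound_imp[of "real p" \<beta> \<alpha> "4 * real p + 1"] bound norm_AA_2 ab p_pos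
    by (simp add: mult.commute add.commute)
  moreover have "norm (SS 1) = norm (\<alpha> + \<beta>)" using ab 1 by (metis norm_minus_cancel)
  ultimately show ?thesis using norm_triangle_ineq[of \<alpha> \<beta>] by linarith
qed

end

section \<open>Kloosterman sums to prime moduli\<close>

declare One_nat_def [simp]

definition ec :: "nat \<Rightarrow> int \<Rightarrow> complex" where
  "ec c k = e (real_of_int k / real c)"

lemma e_add: "e (s + t) = e s * e t"
  by (simp add: e_def distrib_left exp_add)

lemma e_int [simp]: "e (real_of_int k) = 1"
  by (simp add: e_def mult.assoc exp_eq_1 exI[of _ k])

lemma norm_e [simp]: "norm (e t) = 1"
  by (simp add: e_def norm_exp_eq_Re)

lemma cnj_e: "cnj (e t) = e (- t)"
  by (simp add: e_def exp_cnj)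

lemma e_0 [simp]: "e 0 = 1" by (simp add: e_def)

lemma ec_add: "ec c (k + l) = ec c k * ec c l"
  by (simp add: ec_def add_divide_distrib e_add)

lemma norm_ec [simp]: "norm (ec c k) = 1" by (simp add: ec_def)

lemma ec_0 [simp]: "ec c 0 = 1" by (simp add: ec_def)

lemma cnj_ec: "cnj (ec c k) = ec c (- k)" by (simp add: ec_def cnj_e)

lemma ec_mult_self: "c > 0 \<Longrightarrow> ec c (int c * k) = 1"
  using e_int[of k] by (simp add: ec_def)

lemma ec_cong: "[k = l] (mod int c) \<Longrightarrow> ec c k = ec c l"
proof (cases "c = 0")
  case False
  assume "[k = l] (mod int c)"
  then obtain m where "l = k + int c * m" by (auto simp: cong_iff_lin)
  then show ?thesis using False by (simp add: ec_add ec_mult_self)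
qed (simp add: ec_def)

lemma ec_eq_1_iff: "c > 0 \<Longrightarrow> ec c k = 1 \<longleftrightarrow> int c dvd k"
proof
  assume c: "c > 0" and "ec c k = 1"
  then obtain n :: int where "2 * pi * (real_of_int k / real c) = real_of_int (2 * n) * pi"
    by (auto simp: ec_def e_def exp_eq_1)
  then have "(2 * pi) * (real_of_int k / real c) = (2 * pi) * real_of_int n" by (simp add: mult_ac)
  then have "real_of_int k / real c = real_of_int n" unfolding mult_cancel_left by simp
  then have "real_of_int k = real_of_int (int c * n)" using c by (simp add: field_simps)
  then have "k = int c * n" by linarith
  then show "int c dvd k" by simp
next
  assume "c > 0" "int c dvd k"
  then show "ec c k = 1" by (auto simp: ec_mult_self)
qed

definition units_mod :: "nat \<Rightarrow> int set" where
  "units_mod c = {x \<in> {0..<int c}. coprime x (int c)}"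

lemma finite_units_mod [simp]: "finite (units_mod c)"
  unfolding units_mod_def by (rule finite_subset[of _ "{0..<int c}"]) auto

definition kloosterman :: "nat \<Rightarrow> int \<Rightarrow> int \<Rightarrow> complex" where
  "kloosterman c b h = (\<Sum>x\<in>units_mod c. ec c (b * modular_inverse (int c) x + h * x))"

definition weil_prime :: "nat \<Rightarrow> bool" where
  "weil_prime p \<longleftrightarrow> (\<forall>b h. \<not> int p dvd b \<longrightarrow> \<not> int p dvd h \<longrightarrow> norm (kloosterman p b h) \<le> 2 * sqrt p)"

text \<open>
  The algebraic closure of a prime field is a type, so its characteristic has to be a constant.
  It is chosen to be a prime at which the Weil bound fails, if there is one.
\<close>

definition weil_witness :: nat where
  "weil_witness = (SOME p. prime p \<and> p > 2 \<and> ((\<exists>p. prime p \<and> p > 2 \<and> \<not> weil_prime p) \<longrightarrow> \<not> weil_prime p))"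

lemma weil_witness: "prime weil_witness" "weil_witness > 2"
    "\<exists>p. prime p \<and> p > 2 \<and> \<not> weil_prime p \<Longrightarrow> \<not> weil_prime weil_witness"
proof -
  have "\<exists>p::nat. prime p \<and> p > 2 \<and> ((\<exists>p. prime p \<and> p > 2 \<and> \<not> weil_prime p) \<longrightarrow> \<not> weil_prime p)"
  proof (cases "\<exists>p. prime p \<and> p > 2 \<and> \<not> weil_prime p")
    case False
    have "prime (3::nat)" by simp
    then show ?thesis using False by (intro exI[of _ 3]) auto
  qed auto
  from someI_ex[OF this] show "prime weil_witness" "weil_witness > 2"
    "\<exists>p. prime p \<and> p > 2 \<and> \<not> weil_prime p \<Longrightarrow> \<not> weil_prime weil_witness"
    unfolding weil_witness_def by blast+
qed

typedef witness_index = "{0..<weil_witness}"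
  using weil_witness(2) by auto

lemma CARD_witness_index: "CARD(witness_index) = weil_witness"
proof -
  interpret type_definition Rep_witness_index Abs_witness_index "{0..<weil_witness}"
    by (rule type_definition_witness_index)
  show ?thesis using card by simp
qed

instance witness_index :: prime_card
  by standard (simp add: CARD_witness_index weil_witness)

lemma CHAR_witness: "CHAR(witness_index mod_ring alg_closure) = weil_witness"
  by (simp add: CARD_witness_index)

text \<open>\<open>of_int\<close> identifies the residues modulo \<open>p\<close> with
  \<open>Fq 1\<close>, which turns \<open>SS 1\<close> into the Kloosterman sum; \<open>h\<close>
  becomes the coefficient of x and \<open>b\<close> that of 1 / x.\<close>

lemma weil_prime_of_closure:
  assumes p: "prime p" "p > 2" and CHAR: "CHAR('k::alg_closed_field) = p"
  shows "weil_prime p"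
  unfolding weil_prime_def
proof (intro allI impI)
  fix b h :: int
  assume b: "\<not> int p dvd b" and h: "\<not> int p dvd h"
  interpret char_p_closure p "TYPE('k)" using assms by unfold_locales
  have of_int_eq: "of_int i = (of_int j :: 'k) \<longleftrightarrow> [i = j] (mod int p)" for i j
    by (simp add: of_int_eq_iff_cong_CHAR CHAR)
  have of_int_Fq: "of_int i \<in> Fq 1" for i
  proof (induction i rule: int_induct[where k = 0])
    case (step2 i)
    then show ?case using Fq_add[OF step2(2) Fq_minus[OF Fq_1]] by simp
  qed (auto intro: Fq_add)
  have inj: "inj_on (of_int :: int \<Rightarrow> 'k) {0..<int p}"
    by (auto simp: inj_on_def of_int_eq cong_def)
  have img: "(of_int :: int \<Rightarrow> 'k) ` {0..<int p} = Fq 1"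
    using card_Fq[of 1] of_int_Fq inj by (intro card_subset_eq) (auto simp: card_image)
  \<comment> \<open>Representatives in the interval from 0 to p - 1. Off \<open>Fq 1\<close> their
    value is arbitrary; the character is evaluated on the prime field only.\<close>
  define r where "r = inv_into {0..<int p} (of_int :: int \<Rightarrow> 'k)"
  have r: "of_int (r x) = x" if "x \<in> Fq 1" for x
    unfolding r_def using f_inv_into_f[of x of_int "{0..<int p}"] img that by auto
  define \<psi> where "\<psi> x = ec p (r x)" for x
  have psi_of_int: "\<psi> (of_int i) = ec p i" for i
    unfolding \<psi>_def using r[OF of_int_Fq] by (intro ec_cong) (simp add: of_int_eq[symmetric])
  have nz: "of_int i \<noteq> (0::'k)" if "\<not> int p dvd i" for i
    using of_int_eq[of i 0] that by (simp add: cong_0_iff)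
  interpret kloosterman_character p "TYPE('k)" \<psi> "of_int h" "of_int b"
  proof
    show "\<psi> (x + y) = \<psi> x * \<psi> y" if "x \<in> Fq 1" "y \<in> Fq 1" for x y
      using psi_of_int[of "r x + r y"] psi_of_int[of "r x"] psi_of_int[of "r y"] r[OF that(1)] r[OF that(2)]
      by (simp add: ec_add)
    show "norm (\<psi> x) = 1" for x by (simp add: \<psi>_def)
    have "\<psi> 1 \<noteq> 1" using psi_of_int[of 1] ec_eq_1_iff[of p 1] p by auto
    then show "\<exists>x\<in>Fq 1. \<psi> x \<noteq> 1" using Fq_1 by blast
  qed (use b h nz of_int_Fq in auto)
  have "SS 1 = (\<Sum>x\<in>Fq 1 - {0}. \<psi> (of_int h * x + of_int b / x))" by (simp add: SS_def)
  also have "\<dots> = (\<Sum>x\<in>units_mod p. ec p (b * modular_inverse (int p) x + h * x))"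
  proof (rule sym, rule sum.reindex_bij_witness[of _ r of_int])
    fix x assume x: "x \<in> units_mod p"
    then have x': "x \<in> {0..<int p}" "coprime x (int p)" by (auto simp: units_mod_def)
    then show rx: "r (of_int x) = x" unfolding r_def by (intro inv_into_f_f inj)
    have "\<not> int p dvd x" using x' p by (metis coprime_common_divisor dvd_refl not_prime_unit prime_nat_int_transfer)
    then have x0: "of_int x \<noteq> (0::'k)" by (rule nz)
    then show "of_int x \<in> Fq 1 - {0::'k}" using of_int_Fq by auto
    have "of_int (x * modular_inverse (int p) x) = (of_int 1 :: 'k)"
      unfolding of_int_eq using x' by (intro cong_modular_inverse1)
    then have "of_int (modular_inverse (int p) x) = 1 / (of_int x :: 'k)" using x0 by (simp add: field_simps)
    then have "of_int h * of_int x + of_int b / of_int x = (of_int (b * modular_inverse (int p) x + h * x) :: 'k)"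
      by simp
    then show "\<psi> (of_int h * of_int x + of_int b / of_int x) = ec p (b * modular_inverse (int p) x + h * x)"
      by (simp only: psi_of_int)
  next
    fix x :: 'k assume x: "x \<in> Fq 1 - {0}"
    then show "of_int (r x) = x" using r by auto
    have rx: "r x \<in> {0..<int p}" unfolding r_def using x img by (intro inv_into_into) auto
    have "\<not> int p dvd r x"
    proof
      assume "int p dvd r x"
      then have "[r x = 0] (mod int p)" by (simp add: cong_0_iff)
      then have "of_int (r x) = (of_int 0 :: 'k)" by (simp only: of_int_eq)
      then show False using r[of x] x by auto
    qed
    then have "coprime (r x) (int p)"
      using p by (metis coprime_commute prime_imp_coprime prime_nat_int_transfer)
    then show "r x \<in> units_mod p" using rx by (simp add: units_mod_def)
  qed
  finally show "norm (kloosterman p b h) \<le> 2 * sqrt p" using norm_SS_1 by (simp add: kloosterman_def)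
qed

theorem weil_bound_prime:
  assumes "prime p" "p > 2" "\<not> int p dvd b" "\<not> int p dvd h"
  shows "norm (kloosterman p b h) \<le> 2 * sqrt p"
proof -
  have "weil_prime weil_witness"
    using weil_witness(1,2) CHAR_witness by (rule weil_prime_of_closure)
  then have "weil_prime p" using weil_witness(3) assms by blast
  then show ?thesis using assms by (simp add: weil_prime_def)
qed

section \<open>Composite moduli\<close>

lemma norm_kloosterman_le: "norm (kloosterman c b h) \<le> card (units_mod c)"
  unfolding kloosterman_def by (rule order_trans[OF norm_sum]) simp

lemma card_units_mod_le: "card (units_mod c) \<le> c"
proof -
  have "units_mod c \<subseteq> {0..<int c}" by (auto simp: units_mod_def)
  from card_mono[OF _ this] show ?thesis by simp
qed

lemma kloosterman_1 [simp]: "kloosterman 1 b h = 1"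
proof -
  have "units_mod 1 = {0}" by (auto simp: units_mod_def)
  then show ?thesis by (simp add: kloosterman_def modular_inverse_def)
qed

lemma ec_diff: "ec c (k - l) = ec c k * ec c (- l)"
  by (simp flip: ec_add)

lemma ec_scale: "d > 0 \<Longrightarrow> ec (c * d) (int d * k) = ec c k"
  by (simp add: ec_def)

lemma sum_shift_mod:
  fixes f :: "int \<Rightarrow> complex"
  assumes "n > 0" "\<And>x y. [x = y] (mod int n) \<Longrightarrow> f x = f y"
  shows "(\<Sum>x\<in>{0..<int n}. f (x + s)) = (\<Sum>x\<in>{0..<int n}. f x)"
proof (rule sum.reindex_bij_witness[of _ "\<lambda>x. (x - s) mod int n" "\<lambda>x. (x + s) mod int n"])
  fix x assume "x \<in> {0..<int n}"
  then show "((x + s) mod int n - s) mod int n = x" "((x - s) mod int n + s) mod int n = x"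
    by (simp_all add: mod_simps)
  show "f ((x + s) mod int n) = f (x + s)" by (intro assms(2)) (simp add: cong_def)
qed (use assms in auto)

lemma sum_ec:
  assumes "n > 0"
  shows "(\<Sum>v\<in>{0..<int n}. ec n (k * v)) = (if int n dvd k then of_nat n else 0)"
proof (cases "int n dvd k")
  case True
  then have "ec n (k * v) = 1" for v using assms by (simp add: ec_eq_1_iff)
  then show ?thesis using True by simp
next
  case False
  have "(\<Sum>v\<in>{0..<int n}. ec n (k * v)) = (\<Sum>v\<in>{0..<int n}. ec n (k * (v + 1)))"
    by (rule sum_shift_mod[symmetric]) (use assms in \<open>auto intro!: ec_cong cong_mult\<close>)
  also have "\<dots> = (\<Sum>v\<in>{0..<int n}. ec n (k * v)) * ec n k"
    by (simp add: distrib_left ec_add sum_distrib_right)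
  finally show ?thesis using False assms ec_eq_1_iff[of n k] by simp
qed

text \<open>Any inverse y of x may stand for the canonical one; the computations below produce
  inverses by explicit formulas.\<close>

lemma ec_modular_inverse:
  assumes "[x * y = 1] (mod int c)"
  shows "ec c (b * modular_inverse (int c) x + k) = ec c (b * y + k)"
proof -
  have "coprime (x * y) (int c)" using cong_imp_coprime[OF cong_sym[OF assms]] by simp
  then have cop: "coprime x (int c)" by simp
  define i where "i = modular_inverse (int c) x"
  have 1: "[i * (x * y) = i * 1] (mod int c)"
    using assms by (intro cong_mult) auto
  have 2: "[(i * x) * y = 1 * y] (mod int c)"
    unfolding i_def using cong_modular_inverse2[OF cop] by (intro cong_mult) auto
  have "[i = y] (mod int c)"
    using cong_trans[OF cong_sym[OF 1]] 2 by (simp add: mult.assoc)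
  then show ?thesis unfolding i_def by (intro ec_cong cong_add cong_mult) auto
qed

text \<open>The second hypothesis holds when d and r are powers of the same prime and d > 1: then
  being a unit depends on the class modulo d only, and v is unrestricted.\<close>

lemma sum_units_split:
  assumes "d > 0" "\<And>x::int. coprime x (int (d * r)) \<longleftrightarrow> coprime x (int d)"
  shows "(\<Sum>x\<in>units_mod (d * r). f x) = (\<Sum>u\<in>units_mod d. \<Sum>v\<in>{0..<int r}. f (u + int d * v))"
    (is "?L = ?R")
proof -
  have cop: "coprime (u + int d * v) (int d) \<longleftrightarrow> coprime u (int d)" for u v
    unfolding coprime_iff_gcd_eq_1 using gcd_add_mult[of "int d" v u]
    by (simp add: gcd.commute mult.commute add.commute)
  have "?L = (\<Sum>(u, v)\<in>units_mod d \<times> {0..<int r}. f (u + int d * v))"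
  proof (rule sum.reindex_bij_witness[of _ "\<lambda>(u, v). u + int d * v" "\<lambda>x. (x mod int d, x div int d)"])
    fix x assume x: "x \<in> units_mod (d * r)"
    then have x': "0 \<le> x" "x < int d * int r" "coprime x (int d)" using assms(2)[of x] by (auto simp: units_mod_def)
    show "(case (x mod int d, x div int d) of (u, v) \<Rightarrow> u + int d * v) = x" by simp
    have "coprime (x mod int d) (int d)" using x' assms(1) by (simp add: coprime_mod_left_iff)
    moreover have "x div int d < int r"
    proof (rule ccontr)
      assume "\<not> x div int d < int r"
      then have "int d * int r \<le> int d * (x div int d)" by (intro mult_left_mono) auto
      also have "\<dots> \<le> x" using assms(1) mult_div_mod_eq[of "int d" x] pos_mod_sign[of "int d" x] by linarith
      finally show False using x' by simp
    qed
    ultimately show "(x mod int d, x div int d) \<in> units_mod d \<times> {0..<int r}"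
      using x' assms(1) by (auto simp: units_mod_def pos_imp_zdiv_nonneg_iff)
  next
    fix z assume "z \<in> units_mod d \<times> {0..<int r}"
    then obtain u v where z: "z = (u, v)" "0 \<le> u" "u < int d" "coprime u (int d)" "0 \<le> v" "v < int r"
      by (auto simp: units_mod_def)
    then show "((case z of (u, v) \<Rightarrow> u + int d * v) mod int d, (case z of (u, v) \<Rightarrow> u + int d * v) div int d) = z"
      by simp
    have "int d * v \<le> int d * (int r - 1)" using z by (intro mult_left_mono) auto
    then have "u + int d * v < int d * int r" using z by (simp add: algebra_simps)
    then show "(case z of (u, v) \<Rightarrow> u + int d * v) \<in> units_mod (d * r)"
      using z assms(2)[of "u + int d * v"] cop by (auto simp: units_mod_def)
  qed auto
  also have "\<dots> = ?R" by (simp add: sum.cartesian_product)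
  finally show ?thesis .
qed

text \<open>The Chinese remainder theorem in the form x = c2 x1 + c1 x2. This parametrization puts
  all twists on \<open>b\<close> and leaves \<open>h\<close> alone, so that inductions over the
  modulus keep \<open>h\<close>, and with it the gcd in the final bound, fixed.\<close>

lemma kloosterman_mult:
  assumes "c1 > 0" "c2 > 0" "coprime c1 c2"
  defines "i1 \<equiv> modular_inverse (int c2) (int c1)" and "i2 \<equiv> modular_inverse (int c1) (int c2)"
  shows "kloosterman (c1 * c2) b h = kloosterman c1 (b * i2\<^sup>2) h * kloosterman c2 (b * i1\<^sup>2) h"
proof -
  let ?m1 = "modular_inverse (int c1)" and ?m2 = "modular_inverse (int c2)"
  have cop: "coprime (int c1) (int c2)" "coprime (int c2) (int c1)"
    using assms(3) by (simp_all add: coprime_commute)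
  have i1: "[int c1 * i1 = 1] (mod int c2)" unfolding i1_def by (rule cong_modular_inverse1[OF cop(1)])
  have i2: "[int c2 * i2 = 1] (mod int c1)" unfolding i2_def by (rule cong_modular_inverse1[OF cop(2)])
  have ec_split: "ec (c1 * c2) (int c2 * k + int c1 * l) = ec c1 k * ec c2 l" for k l
    using ec_scale[of c2 c1 k] ec_scale[of c1 c2 l] assms(1,2) unfolding ec_add mult.commute[of c2 c1] by simp
  have z1: "[int c1 * k = 0] (mod int c1)" and z2: "[int c2 * k = 0] (mod int c2)" for k
    by (simp_all add: cong_0_iff)
  have "kloosterman c1 (b * i2\<^sup>2) h * kloosterman c2 (b * i1\<^sup>2) h =
    (\<Sum>(x1, x2)\<in>units_mod c1 \<times> units_mod c2.
      ec c1 (b * i2\<^sup>2 * ?m1 x1 + h * x1) * ec c2 (b * i1\<^sup>2 * ?m2 x2 + h * x2))"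
    by (simp add: kloosterman_def sum_product sum.cartesian_product)
  also have "\<dots> = (\<Sum>x\<in>units_mod (c1 * c2). ec (c1 * c2) (b * modular_inverse (int (c1 * c2)) x + h * x))"
  proof (rule sum.reindex_bij_witness[of _ "\<lambda>x. (x * i2 mod int c1, x * i1 mod int c2)"
            "\<lambda>(x1, x2). (int c2 * x1 + int c1 * x2) mod (int c1 * int c2)"])
    fix z assume "z \<in> units_mod c1 \<times> units_mod c2"
    then obtain x1 x2 where z: "z = (x1, x2)" and x1: "0 \<le> x1" "x1 < int c1" "coprime x1 (int c1)"
      and x2: "0 \<le> x2" "x2 < int c2" "coprime x2 (int c2)" by (auto simp: units_mod_def)
    define s where "s = int c2 * x1 + int c1 * x2"
    define x where "x = s mod (int c1 * int c2)"
    have xs: "[x = s] (mod (int c1 * int c2))" by (simp add: x_def cong_def)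
    then have xs1: "[x = s] (mod int c1)" and xs2: "[x = s] (mod int c2)"
      by (auto intro: cong_dvd_modulus)
    have s1: "[s = int c2 * x1] (mod int c1)" and s2: "[s = int c1 * x2] (mod int c2)"
      using cong_add[OF cong_refl[of "int c2 * x1"] z1[of x2]] cong_add[OF z2[of x1] cong_refl[of "int c1 * x2"]]
      by (simp_all add: s_def)
    have xx1: "[x = int c2 * x1] (mod int c1)" using xs1 s1 by (rule cong_trans)
    have xx2: "[x = int c1 * x2] (mod int c2)" using xs2 s2 by (rule cong_trans)
    have "[x * i2 = (int c2 * x1) * i2] (mod int c1)" using xx1 by (intro cong_mult) auto
    also have "[(int c2 * x1) * i2 = 1 * x1] (mod int c1)"
      using cong_mult[OF i2 cong_refl[of x1]] by (simp add: mult_ac)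
    finally have "x * i2 mod int c1 = x1" using x1 by (simp add: cong_def)
    moreover have "[x * i1 = (int c1 * x2) * i1] (mod int c2)" using xx2 by (intro cong_mult) auto
    then have "[x * i1 = 1 * x2] (mod int c2)"
      using cong_mult[OF i1 cong_refl[of x2]] by (auto simp: mult_ac intro: cong_trans)
    then have "x * i1 mod int c2 = x2" using x2 by (simp add: cong_def)
    ultimately show "(\<lambda>x. (x * i2 mod int c1, x * i1 mod int c2))
        (case z of (x1, x2) \<Rightarrow> (int c2 * x1 + int c1 * x2) mod (int c1 * int c2)) = z"
      by (simp add: z x_def s_def)
    have "coprime x (int c1)" using cong_imp_coprime[OF cong_sym[OF xx1]] x1 cop by simp
    moreover have "coprime x (int c2)" using cong_imp_coprime[OF cong_sym[OF xx2]] x2 cop by simp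
    ultimately have "x \<in> units_mod (c1 * c2)" using assms by (simp add: units_mod_def x_def)
    then show "(case z of (x1, x2) \<Rightarrow> (int c2 * x1 + int c1 * x2) mod (int c1 * int c2)) \<in> units_mod (c1 * c2)"
      by (simp add: z x_def s_def)
    \<comment> \<open>The inverse of x modulo c1 c2: modulo c1 only the first term survives, and
      there x is c2 x1 while i2 inverts c2; symmetrically modulo c2.\<close>
    define y where "y = int c2 * (i2\<^sup>2 * ?m1 x1) + int c1 * (i1\<^sup>2 * ?m2 x2)"
    have "[x * y = 1] (mod int c1)"
    proof -
      have "[y = int c2 * (i2\<^sup>2 * ?m1 x1)] (mod int c1)"
        using cong_add[OF cong_refl[of "int c2 * (i2\<^sup>2 * ?m1 x1)"] z1[of "i1\<^sup>2 * ?m2 x2"]] by (simp add: y_def)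
      then have "[x * y = (int c2 * x1) * (int c2 * (i2\<^sup>2 * ?m1 x1))] (mod int c1)"
        using xx1 by (intro cong_mult)
      also have "(int c2 * x1) * (int c2 * (i2\<^sup>2 * ?m1 x1)) = (int c2 * i2) * (int c2 * i2) * (x1 * ?m1 x1)"
        by (simp add: power2_eq_square mult_ac)
      also have "[\<dots> = 1 * 1 * 1] (mod int c1)" using i2 cong_modular_inverse1[OF x1(3)] by (intro cong_mult)
      finally show ?thesis by simp
    qed
    moreover have "[x * y = 1] (mod int c2)"
    proof -
      have "[y = int c1 * (i1\<^sup>2 * ?m2 x2)] (mod int c2)"
        using cong_add[OF z2[of "i2\<^sup>2 * ?m1 x1"] cong_refl[of "int c1 * (i1\<^sup>2 * ?m2 x2)"]] by (simp add: y_def)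
      then have "[x * y = (int c1 * x2) * (int c1 * (i1\<^sup>2 * ?m2 x2))] (mod int c2)"
        using xx2 by (intro cong_mult)
      also have "(int c1 * x2) * (int c1 * (i1\<^sup>2 * ?m2 x2)) = (int c1 * i1) * (int c1 * i1) * (x2 * ?m2 x2)"
        by (simp add: power2_eq_square mult_ac)
      also have "[\<dots> = 1 * 1 * 1] (mod int c2)" using i1 cong_modular_inverse1[OF x2(3)] by (intro cong_mult)
      finally show ?thesis by simp
    qed
    ultimately have "[x * y = 1] (mod int (c1 * c2))"
      using cop by (simp add: coprime_cong_mult)
    then have "ec (c1 * c2) (b * modular_inverse (int (c1 * c2)) x + h * x) = ec (c1 * c2) (b * y + h * x)"
      by (rule ec_modular_inverse)
    also have "\<dots> = ec (c1 * c2) (b * y + h * s)"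
      using xs by (intro ec_cong cong_add cong_mult) auto
    also have "b * y + h * s = int c2 * (b * i2\<^sup>2 * ?m1 x1 + h * x1) + int c1 * (b * i1\<^sup>2 * ?m2 x2 + h * x2)"
      by (simp add: y_def s_def algebra_simps)
    also have "ec (c1 * c2) \<dots> = ec c1 (b * i2\<^sup>2 * ?m1 x1 + h * x1) * ec c2 (b * i1\<^sup>2 * ?m2 x2 + h * x2)"
      using ec_split by blast
    finally show "ec (c1 * c2) (b * modular_inverse (int (c1 * c2))
        (case z of (x1, x2) \<Rightarrow> (int c2 * x1 + int c1 * x2) mod (int c1 * int c2)) +
        h * (case z of (x1, x2) \<Rightarrow> (int c2 * x1 + int c1 * x2) mod (int c1 * int c2)))
      = (case z of (x1, x2) \<Rightarrow> ec c1 (b * i2\<^sup>2 * ?m1 x1 + h * x1) * ec c2 (b * i1\<^sup>2 * ?m2 x2 + h * x2))"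
      by (simp add: z x_def s_def)
  next
    fix x assume x: "x \<in> units_mod (c1 * c2)"
    then have x': "0 \<le> x" "x < int c1 * int c2" "coprime x (int c1)" "coprime x (int c2)"
      by (auto simp: units_mod_def)
    have "coprime i2 (int c1)" "coprime i1 (int c2)" unfolding i1_def i2_def using cop by auto
    then show "(x * i2 mod int c1, x * i1 mod int c2) \<in> units_mod c1 \<times> units_mod c2"
      using x' assms(1,2) by (simp add: units_mod_def)
    define s where "s = int c2 * (x * i2 mod int c1) + int c1 * (x * i1 mod int c2)"
    have "[s = x] (mod int c1)"
    proof -
      have "[s = int c2 * (x * i2 mod int c1)] (mod int c1)"
        using cong_add[OF cong_refl z1] by (simp add: s_def)
      also have "[int c2 * (x * i2 mod int c1) = int c2 * (x * i2)] (mod int c1)" by (intro cong_mult) auto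
      also have "int c2 * (x * i2) = (int c2 * i2) * x" by (simp add: mult_ac)
      also have "[\<dots> = 1 * x] (mod int c1)" using i2 by (intro cong_mult) auto
      finally show ?thesis by simp
    qed
    moreover have "[s = x] (mod int c2)"
    proof -
      have "[s = int c1 * (x * i1 mod int c2)] (mod int c2)"
        using cong_add[OF z2 cong_refl] by (simp add: s_def)
      also have "[int c1 * (x * i1 mod int c2) = int c1 * (x * i1)] (mod int c2)" by (intro cong_mult) auto
      also have "int c1 * (x * i1) = (int c1 * i1) * x" by (simp add: mult_ac)
      also have "[\<dots> = 1 * x] (mod int c2)" using i1 by (intro cong_mult) auto
      finally show ?thesis by simp
    qed
    ultimately have "[s = x] (mod int c1 * int c2)" using cop by (simp add: coprime_cong_mult)
    then show "(case (x * i2 mod int c1, x * i1 mod int c2) of (x1, x2) \<Rightarrow>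
        (int c2 * x1 + int c1 * x2) mod (int c1 * int c2)) = x"
      using x' by (simp add: s_def cong_def)
  qed
  finally show ?thesis by (simp add: kloosterman_def)
qed

text \<open>In the squared modulus, with w = s + w', the sum over w' is linear with coefficient 2 A
  s, so only s = 0 survives when p is odd. For p = 2 the trivial bound 2 suffices.\<close>

lemma gauss_sum_bound:
  assumes p: "prime p" and A: "\<not> int p dvd A"
  shows "norm (\<Sum>w\<in>{0..<int p}. ec p (A * w\<^sup>2 + t * w)) \<le> 2 * sqrt p"
proof (cases "p = 2")
  case True
  have "norm (\<Sum>w\<in>{0..<int p}. ec p (A * w\<^sup>2 + t * w)) \<le> (\<Sum>w\<in>{0..<int p}. norm (ec p (A * w\<^sup>2 + t * w)))"
    by (rule norm_sum)
  also have "\<dots> = 2" using True by simp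
  also have "\<dots> \<le> 2 * sqrt p" using True by simp
  finally show ?thesis .
next
  case False
  have p0: "p > 0" using p prime_gt_0_nat by blast
  define G where "G = (\<Sum>w\<in>{0..<int p}. ec p (A * w\<^sup>2 + t * w))"
  have "G * cnj G = (\<Sum>w\<in>{0..<int p}. \<Sum>w'\<in>{0..<int p}. ec p (A * w\<^sup>2 + t * w) * ec p (- (A * w'\<^sup>2 + t * w')))"
    by (simp add: G_def cnj_sum sum_product cnj_ec)
  also have "\<dots> = (\<Sum>w'\<in>{0..<int p}. \<Sum>w\<in>{0..<int p}. ec p (A * w\<^sup>2 + t * w - (A * w'\<^sup>2 + t * w')))"
    by (subst sum.swap) (simp only: ec_diff)
  also have "\<dots> = (\<Sum>w'\<in>{0..<int p}. \<Sum>s\<in>{0..<int p}. ec p (A * (s + w')\<^sup>2 + t * (s + w') - (A * w'\<^sup>2 + t * w')))"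
    by (intro sum.cong refl sum_shift_mod[symmetric, of p "\<lambda>w. ec p (A * w\<^sup>2 + t * w - (A * w'\<^sup>2 + t * w'))" for w'])
       (use p0 in \<open>auto intro!: ec_cong cong_diff cong_add cong_mult cong_pow\<close>)
  also have "\<dots> = (\<Sum>s\<in>{0..<int p}. \<Sum>w'\<in>{0..<int p}. ec p (A * s\<^sup>2 + t * s) * ec p ((2 * A * s) * w'))"
    by (subst sum.swap) (simp add: power2_eq_square algebra_simps flip: ec_add)
  also have "\<dots> = (\<Sum>s\<in>{0..<int p}. ec p (A * s\<^sup>2 + t * s) * (if int p dvd 2 * A * s then of_nat p else 0))"
    using p0 by (simp add: sum_ec flip: sum_distrib_left)
  also have "\<dots> = (\<Sum>s\<in>{0}. ec p (A * s\<^sup>2 + t * s) * (if int p dvd 2 * A * s then of_nat p else 0))"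
  proof (intro sum.mono_neutral_right ballI)
    fix s assume s: "s \<in> {0..<int p} - {0}"
    have "\<not> int p dvd 2" using False p p0 by (metis int_dvd_int_iff of_nat_numeral primes_dvd_imp_eq two_is_prime_nat)
    moreover have "\<not> int p dvd s" using s by (auto dest: zdvd_imp_le)
    ultimately have "\<not> int p dvd 2 * A * s" using A p by (simp add: prime_dvd_mult_iff)
    then show "ec p (A * s\<^sup>2 + t * s) * (if int p dvd 2 * A * s then of_nat p else 0) = 0" by simp
  qed (use p0 in auto)
  finally have "G * cnj G = of_nat p" by simp
  then have "of_real ((norm G)\<^sup>2) = (of_real (real p) :: complex)"
    unfolding complex_norm_square by simp
  then have "(norm G)\<^sup>2 = real p" by (simp only: of_real_eq_iff)
  then have "norm G = sqrt p" by (metis norm_ge_zero real_sqrt_unique)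
  then show ?thesis by (simp add: G_def)
qed

section \<open>Kloosterman sums to prime power moduli\<close>

lemma coprime_prime_power_iff:
  assumes "prime p" "k \<ge> 1"
  shows "coprime (x::int) (int (p ^ k)) \<longleftrightarrow> \<not> int p dvd x"
proof -
  have "prime (int p)" using assms by simp
  then have "coprime x (int p) \<longleftrightarrow> \<not> int p dvd x"
    by (metis coprime_commute coprime_absorb_left not_prime_unit prime_imp_coprime)
  then show ?thesis using assms by (simp add: coprime_power_right_iff)
qed

text \<open>A common factor p lowers the modulus of the phase to p^(k+1), and each unit modulo
  p^(k+1) has p lifts.\<close>

lemma kloosterman_prime_power_reduce:
  assumes p: "prime p"
  shows "kloosterman (p ^ (k + 2)) (int p * b) (int p * h) = of_nat p * kloosterman (p ^ (k + 1)) b h"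
proof -
  have p0: "p > 0" using p prime_gt_0_nat by blast
  have split: "p ^ (k + 2) = p ^ (k + 1) * p" by simp
  have cop: "coprime x (int (p ^ (k + 1) * p)) \<longleftrightarrow> coprime x (int (p ^ (k + 1)))" for x
  proof -
    have *: "1 \<le> k + 2" "1 \<le> k + 1" by auto
    show ?thesis
      unfolding split[symmetric] coprime_prime_power_iff[OF p *(1)] coprime_prime_power_iff[OF p *(2)] ..
  qed
  define J where "J = modular_inverse (int (p ^ (k + 2)))"
  define J' where "J' = modular_inverse (int (p ^ (k + 1)))"
  have "kloosterman (p ^ (k + 2)) (int p * b) (int p * h)
      = (\<Sum>x\<in>units_mod (p ^ (k + 1) * p). ec (p ^ (k + 1) * p) (int p * (b * J x + h * x)))"
    unfolding kloosterman_def J_def split by (simp add: algebra_simps)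
  also have "\<dots> = (\<Sum>x\<in>units_mod (p ^ (k + 1) * p). ec (p ^ (k + 1)) (b * J x + h * x))"
    by (intro sum.cong refl ec_scale p0)
  also have "\<dots> = (\<Sum>u\<in>units_mod (p ^ (k + 1)). \<Sum>v\<in>{0..<int p}. ec (p ^ (k + 1))
      (b * J (u + int (p ^ (k + 1)) * v) + h * (u + int (p ^ (k + 1)) * v)))"
    by (rule sum_units_split) (use p0 cop in auto)
  also have "\<dots> = (\<Sum>u\<in>units_mod (p ^ (k + 1)). \<Sum>v\<in>{0..<int p}. ec (p ^ (k + 1)) (b * J' u + h * u))"
  proof (intro sum.cong refl)
    fix u v assume u: "u \<in> units_mod (p ^ (k + 1))"
    define x where "x = u + int (p ^ (k + 1)) * v"
    have xu: "[x = u] (mod int (p ^ (k + 1)))" by (simp add: x_def cong_def)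
    have "coprime u (int (p ^ (k + 1)))" using u by (simp add: units_mod_def)
    then have "coprime x (int (p ^ (k + 1)))" using cong_imp_coprime[OF cong_sym[OF xu]] by blast
    then have "coprime x (int (p ^ (k + 2)))" unfolding split cop .
    then have "[x * J x = 1] (mod int (p ^ (k + 2)))" unfolding J_def by (rule cong_modular_inverse1)
    then have "[x * J x = 1] (mod int (p ^ (k + 1)))" by (rule cong_dvd_modulus) simp
    moreover have "[x * J x = u * J x] (mod int (p ^ (k + 1)))" using xu by (intro cong_mult) auto
    ultimately have "[u * J x = 1] (mod int (p ^ (k + 1)))" using cong_trans cong_sym by blast
    then have "ec (p ^ (k + 1)) (b * J' u + h * u) = ec (p ^ (k + 1)) (b * J x + h * u)"
      unfolding J'_def by (rule ec_modular_inverse)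
    also have "\<dots> = ec (p ^ (k + 1)) (b * J x + h * x)"
      using xu by (intro ec_cong cong_add cong_mult) (auto simp: cong_sym)
    finally show "ec (p ^ (k + 1)) (b * J (u + int (p ^ (k + 1)) * v) + h * (u + int (p ^ (k + 1)) * v))
        = ec (p ^ (k + 1)) (b * J' u + h * u)" by (simp add: x_def)
  qed
  finally show ?thesis by (simp add: kloosterman_def J'_def sum_distrib_left)
qed

text \<open>With x = u + p^\<beta> v the phase is linear in v, and the sum over v vanishes unless
  the derivative h - b / u^2 is 0 modulo p^\<alpha>.\<close>

lemma kloosterman_stationary_phase:
  assumes p: "prime p" and \<alpha>: "\<alpha> \<ge> 1" "\<alpha> \<le> \<beta>"
  defines "J \<equiv> modular_inverse (int (p ^ (\<alpha> + \<beta>)))"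
  shows "kloosterman (p ^ (\<alpha> + \<beta>)) b h = of_nat (p ^ \<alpha>) *
    (\<Sum>u\<in>{u \<in> units_mod (p ^ \<beta>). int (p ^ \<alpha>) dvd h - b * (J u)\<^sup>2}. ec (p ^ (\<alpha> + \<beta>)) (b * J u + h * u))"
proof -
  have p0: "p > 0" using p prime_gt_0_nat by blast
  have split: "p ^ (\<alpha> + \<beta>) = p ^ \<beta> * p ^ \<alpha>" by (simp add: power_add mult.commute)
  have cop: "coprime x (int (p ^ \<beta> * p ^ \<alpha>)) \<longleftrightarrow> coprime x (int (p ^ \<beta>))" for x
  proof -
    have *: "1 \<le> \<alpha> + \<beta>" "1 \<le> \<beta>" using \<alpha> by auto
    show ?thesis
      unfolding split[symmetric] coprime_prime_power_iff[OF p *(1)] coprime_prime_power_iff[OF p *(2)] ..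
  qed
  have "kloosterman (p ^ (\<alpha> + \<beta>)) b h
      = (\<Sum>x\<in>units_mod (p ^ \<beta> * p ^ \<alpha>). ec (p ^ (\<alpha> + \<beta>)) (b * J x + h * x))"
    unfolding kloosterman_def J_def split ..
  also have "\<dots> = (\<Sum>u\<in>units_mod (p ^ \<beta>). \<Sum>v\<in>{0..<int (p ^ \<alpha>)}. ec (p ^ (\<alpha> + \<beta>))
      (b * J (u + int (p ^ \<beta>) * v) + h * (u + int (p ^ \<beta>) * v)))"
    by (rule sum_units_split) (use p0 cop in auto)
  also have "\<dots> = (\<Sum>u\<in>units_mod (p ^ \<beta>). \<Sum>v\<in>{0..<int (p ^ \<alpha>)}.
      ec (p ^ (\<alpha> + \<beta>)) (b * J u + h * u) * ec (p ^ \<alpha>) ((h - b * (J u)\<^sup>2) * v))"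
  proof (intro sum.cong refl)
    fix u v assume u: "u \<in> units_mod (p ^ \<beta>)"
    then have "coprime u (int (p ^ (\<alpha> + \<beta>)))" using cop[of u] unfolding split units_mod_def by blast
    then have "[u * J u = 1] (mod int (p ^ (\<alpha> + \<beta>)))" unfolding J_def by (rule cong_modular_inverse1)
    then obtain s where s: "u * J u = 1 + int (p ^ (\<alpha> + \<beta>)) * s"
      using cong_iff_lin cong_sym by (metis)
    define P where "P = int (p ^ \<beta>)"
    define R where "R = int (p ^ (\<alpha> + \<beta>))"
    obtain \<gamma> where \<gamma>: "\<beta> = \<alpha> + \<gamma>" using \<alpha> le_Suc_ex by blast
    have PP: "P * P = R * int (p ^ \<gamma>)" unfolding P_def R_def \<gamma> by (simp add: power_add mult_ac)
    define x where "x = u + P * v"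
    \<comment> \<open>The inverse of u + P v to first order. The error consists of multiples of u
      J(u) - 1 and of P^2, and both vanish modulo p^(\<alpha> + \<beta>), the latter because
      \<alpha> <= \<beta>.\<close>
    define y where "y = J u - P * v * (J u)\<^sup>2"
    have "x * y = u * J u - P * v * (J u) * (u * J u - 1) - P * P * (v\<^sup>2 * (J u)\<^sup>2)"
      by (simp add: x_def y_def power2_eq_square algebra_simps)
    also have "\<dots> = 1 + R * (s - P * v * J u * s - int (p ^ \<gamma>) * (v\<^sup>2 * (J u)\<^sup>2))"
      unfolding PP s R_def[symmetric] by (simp add: algebra_simps)
    finally have "[x * y = 1] (mod R)" by (simp add: cong_def)
    then have "ec (p ^ (\<alpha> + \<beta>)) (b * J x + h * x) = ec (p ^ (\<alpha> + \<beta>)) (b * y + h * x)"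
      unfolding J_def R_def by (rule ec_modular_inverse)
    also have "b * y + h * x = (b * J u + h * u) + P * ((h - b * (J u)\<^sup>2) * v)"
      by (simp add: x_def y_def algebra_simps)
    also have "ec (p ^ (\<alpha> + \<beta>)) \<dots> = ec (p ^ (\<alpha> + \<beta>)) (b * J u + h * u) * ec (p ^ \<alpha>) ((h - b * (J u)\<^sup>2) * v)"
      unfolding ec_add[of _ "b * J u + h * u"] P_def
      using ec_scale[of "p ^ \<beta>" "p ^ \<alpha>" "(h - b * (J u)\<^sup>2) * v"] p0 by (simp add: power_add)
    finally show "ec (p ^ (\<alpha> + \<beta>)) (b * J (u + int (p ^ \<beta>) * v) + h * (u + int (p ^ \<beta>) * v))
        = ec (p ^ (\<alpha> + \<beta>)) (b * J u + h * u) * ec (p ^ \<alpha>) ((h - b * (J u)\<^sup>2) * v)"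
      by (simp add: x_def P_def)
  qed
  also have "\<dots> = (\<Sum>u\<in>units_mod (p ^ \<beta>). if int (p ^ \<alpha>) dvd h - b * (J u)\<^sup>2
      then of_nat (p ^ \<alpha>) * ec (p ^ (\<alpha> + \<beta>)) (b * J u + h * u) else 0)"
  proof (intro sum.cong refl)
    fix u
    have "(\<Sum>v\<in>{0..<int (p ^ \<alpha>)}. ec (p ^ (\<alpha> + \<beta>)) (b * J u + h * u) * ec (p ^ \<alpha>) ((h - b * (J u)\<^sup>2) * v))
      = ec (p ^ (\<alpha> + \<beta>)) (b * J u + h * u) * (\<Sum>v\<in>{0..<int (p ^ \<alpha>)}. ec (p ^ \<alpha>) ((h - b * (J u)\<^sup>2) * v))"
      by (rule sum_distrib_left[symmetric])
    also have "(\<Sum>v\<in>{0..<int (p ^ \<alpha>)}. ec (p ^ \<alpha>) ((h - b * (J u)\<^sup>2) * v))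
      = (if int (p ^ \<alpha>) dvd h - b * (J u)\<^sup>2 then of_nat (p ^ \<alpha>) else 0)"
      using p0 by (intro sum_ec) simp
    finally show "(\<Sum>v\<in>{0..<int (p ^ \<alpha>)}. ec (p ^ (\<alpha> + \<beta>)) (b * J u + h * u) * ec (p ^ \<alpha>) ((h - b * (J u)\<^sup>2) * v))
      = (if int (p ^ \<alpha>) dvd h - b * (J u)\<^sup>2 then of_nat (p ^ \<alpha>) * ec (p ^ (\<alpha> + \<beta>)) (b * J u + h * u) else 0)"
      by (simp add: mult.commute)
  qed
  also have "\<dots> = (\<Sum>u\<in>{u \<in> units_mod (p ^ \<beta>). int (p ^ \<alpha>) dvd h - b * (J u)\<^sup>2}.
      of_nat (p ^ \<alpha>) * ec (p ^ (\<alpha> + \<beta>)) (b * J u + h * u))"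
    by (rule sum.inter_filter[symmetric]) simp
  finally show ?thesis by (simp only: sum_distrib_left)
qed

text \<open>Doubling modulo \<open>P\<close> is at most two-to-one; the second solution occurs for
  even \<open>P\<close>, here for powers of 2.\<close>

lemma card_double_residue_le:
  fixes P s :: int
  assumes "P > 0"
  shows "card {u \<in> {0..<P}. P dvd 2 * (u - s)} \<le> 2"
proof -
  define r where "r = (2 * s) mod P"
  have "{u \<in> {0..<P}. P dvd 2 * (u - s)} \<subseteq> {r div 2, (r + P) div 2}"
  proof
    fix u assume "u \<in> {u \<in> {0..<P}. P dvd 2 * (u - s)}"
    then have u: "0 \<le> u" "u < P" "(2 * u) mod P = r"
      by (auto simp: r_def mod_eq_dvd_iff right_diff_distrib)
    have "2 * u = r \<or> 2 * u = r + P"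
    proof (cases "2 * u < P")
      case True
      then show ?thesis using u by simp
    next
      case False
      then have "(2 * u - P) mod P = 2 * u - P" using u by (intro mod_pos_pos_trivial) auto
      then show ?thesis using u by (simp add: minus_mod_self2)
    qed
    then show "u \<in> {r div 2, (r + P) div 2}" by auto
  qed
  then have "card {u \<in> {0..<P}. P dvd 2 * (u - s)} \<le> card {r div 2, (r + P) div 2}"
    by (intro card_mono) auto
  also have "\<dots> \<le> 2" by (simp add: card_insert_if)
  finally show ?thesis .
qed

text \<open>For odd p the two factors cannot both be divisible by p, since they differ by 2 y. For p
  = 2 and odd x their halves q and q + y differ by the odd number y, so one half is odd; this is
  what the factor 2 pays for.\<close>

lemma prime_power_dvd_diff_squares:
  fixes x y :: int
  assumes p: "prime p" and y: "\<not> int p dvd y" and dvd: "int (p ^ \<alpha>) dvd (x - y) * (x + y)"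
  shows "int (p ^ \<alpha>) dvd 2 * (x - y) \<or> int (p ^ \<alpha>) dvd 2 * (x + y)"
proof -
  have pp: "prime (int p)" using p by simp
  have cop: "coprime (int (p ^ \<alpha>)) z" if "\<not> int p dvd z" for z
    using prime_imp_coprime[OF pp that] by (simp add: coprime_power_left_iff)
  show ?thesis
  proof (cases "p = 2")
    case False
    then have "\<not> int p dvd 2" using p by (metis int_dvd_int_iff of_nat_numeral primes_dvd_imp_eq two_is_prime_nat)
    then have "\<not> int p dvd 2 * y" using y pp by (simp add: prime_dvd_mult_iff)
    then have "\<not> int p dvd (x + y) - (x - y)" by simp
    then have "\<not> int p dvd (x - y) \<or> \<not> int p dvd (x + y)" by (meson dvd_diff)
    then show ?thesis
    proof
      assume "\<not> int p dvd (x - y)"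
      then have "int (p ^ \<alpha>) dvd x + y" using dvd coprime_dvd_mult_right_iff[OF cop] by blast
      then show ?thesis using dvd_mult by blast
    next
      assume "\<not> int p dvd (x + y)"
      then have "int (p ^ \<alpha>) dvd x - y" using dvd coprime_dvd_mult_left_iff[OF cop] by blast
      then show ?thesis using dvd_mult by blast
    qed
  next
    case True
    have y2: "odd y" using y True by simp
    have dvd2: "2 ^ \<alpha> dvd (x - y) * (x + y)" using dvd True by simp
    have c2: "coprime ((2::int) ^ \<alpha>) z" if "odd z" for z using cop[of z] True that by simp
    show ?thesis
    proof (cases "odd x")
      case False
      then have "coprime ((2::int) ^ \<alpha>) (x - y)" using y2 by (intro c2) simp
      then have "2 ^ \<alpha> dvd x + y" using dvd2 coprime_dvd_mult_right_iff by blast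
      then have "2 ^ \<alpha> dvd 2 * (x + y)" by (rule dvd_mult)
      then show ?thesis using True by simp
    next
      case odd: True
      then obtain q where q: "x - y = 2 * q" using y2 by (metis dvdE even_diff_iff odd_even_add even_add)
      have XY: "x + y = 2 * (q + y)" using q by simp
      show ?thesis
      proof (cases "odd q")
        case True
        have "2 ^ \<alpha> dvd q * (2 * (x + y))" using dvd2 q by (simp add: mult_ac)
        then have "2 ^ \<alpha> dvd 2 * (x + y)" using c2[OF True] by (simp add: coprime_dvd_mult_right_iff)
        then show ?thesis using \<open>p = 2\<close> by simp
      next
        case False
        then have "odd (q + y)" using y2 by simp
        have "2 ^ \<alpha> dvd (q + y) * (2 * (x - y))" using dvd2 XY by (simp add: mult_ac)
        then have "2 ^ \<alpha> dvd 2 * (x - y)" using c2[OF \<open>odd (q + y)\<close>] by (simp add: coprime_dvd_mult_right_iff)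
        then show ?thesis using \<open>p = 2\<close> by simp
      qed
    qed
  qed
qed

text \<open>Relative to one solution y every other one is y or - y, up to the ambiguity of doubling:
  two signs times two residues.\<close>

lemma card_stationary_points_le:
  assumes p: "prime p" and \<alpha>: "\<alpha> \<ge> 1" and h: "\<not> int p dvd h"
  shows "card {u \<in> units_mod (p ^ \<alpha>). int (p ^ \<alpha>) dvd h * u\<^sup>2 - b} \<le> 4"
proof -
  let ?Z = "{u \<in> units_mod (p ^ \<alpha>). int (p ^ \<alpha>) dvd h * u\<^sup>2 - b}"
  let ?P = "int (p ^ \<alpha>)"
  have P0: "?P > 0" using p prime_gt_0_nat by simp
  show ?thesis
  proof (cases "?Z = {}")
    case True
    then show ?thesis by (metis card.empty zero_le)
  next
    case False
    then obtain y where y: "y \<in> units_mod (p ^ \<alpha>)" "?P dvd h * y\<^sup>2 - b" by blast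
    have py: "\<not> int p dvd y" using y coprime_prime_power_iff[OF p \<alpha>, of y] by (simp add: units_mod_def)
    have "?Z \<subseteq> {u \<in> {0..<?P}. ?P dvd 2 * (u - y)} \<union> {u \<in> {0..<?P}. ?P dvd 2 * (u - (- y))}"
    proof
      fix u assume u: "u \<in> ?Z"
      then have "?P dvd (h * u\<^sup>2 - b) - (h * y\<^sup>2 - b)" using dvd_diff[OF _ y(2)] by blast
      then have "?P dvd h * ((u - y) * (u + y))" by (simp add: power2_eq_square algebra_simps)
      moreover have "coprime ?P h" using coprime_prime_power_iff[OF p \<alpha>, of h] h by (simp add: coprime_commute)
      ultimately have "?P dvd (u - y) * (u + y)" by (simp add: coprime_dvd_mult_right_iff)
      from prime_power_dvd_diff_squares[OF p py this] u
      show "u \<in> {u \<in> {0..<?P}. ?P dvd 2 * (u - y)} \<union> {u \<in> {0..<?P}. ?P dvd 2 * (u - (- y))}"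
        by (auto simp: units_mod_def)
    qed
    then have "card ?Z \<le> card ({u \<in> {0..<?P}. ?P dvd 2 * (u - y)} \<union> {u \<in> {0..<?P}. ?P dvd 2 * (u - (- y))})"
      by (intro card_mono) (auto intro: finite_subset[of _ "{0..<?P}"])
    also have "\<dots> \<le> card {u \<in> {0..<?P}. ?P dvd 2 * (u - y)} + card {u \<in> {0..<?P}. ?P dvd 2 * (u - (- y))}"
      by (rule card_Un_le)
    also have "\<dots> \<le> 2 + 2" by (intro add_mono card_double_residue_le P0)
    finally show ?thesis by simp
  qed
qed

text \<open>For k = 2 \<alpha> each of at most 4 stationary points contributes p^\<alpha>. For k = 2
  \<alpha> + 1 the stationary points modulo p^(\<alpha>+1) are grouped modulo p^\<alpha>, and each
  of the at most 4 groups is a quadratic Gauss sum of size at most 2 sqrt p; hence the 8.\<close>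

lemma kloosterman_prime_power_nondvd:
  assumes p: "prime p" and k: "k \<ge> 2" and h: "\<not> int p dvd h"
  shows "norm (kloosterman (p ^ k) b h) \<le> 8 * sqrt (p ^ k)"
proof -
  have p0: "p > 0" using p prime_gt_0_nat by blast
  have pp: "prime (int p)" using p by simp
  define \<alpha> where "\<alpha> = k div 2"
  have \<alpha>1: "\<alpha> \<ge> 1" using k by (simp add: \<alpha>_def)
  define J where "J = modular_inverse (int (p ^ k))"
  define Z where "Z \<gamma> = {u \<in> units_mod (p ^ \<gamma>). int (p ^ \<alpha>) dvd h - b * (J u)\<^sup>2}" for \<gamma>
  have J: "[u * J u = 1] (mod int (p ^ k))" if "\<not> int p dvd u" for u
    unfolding J_def using that k coprime_prime_power_iff[OF p, of k u] by (intro cong_modular_inverse1) auto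
  have \<alpha>k: "\<alpha> \<le> k" by (simp add: \<alpha>_def)
  have J\<alpha>: "[u * J u = 1] (mod int (p ^ \<alpha>))" if "\<not> int p dvd u" for u
    using J[OF that] by (rule cong_dvd_modulus) (use \<alpha>k in \<open>simp add: le_imp_power_dvd\<close>)
  have pow_dvd: "int p dvd int (p ^ \<alpha>)" using \<alpha>1 by simp
  have unit: "\<not> int p dvd u" if "u \<in> units_mod (p ^ \<gamma>)" "\<gamma> \<ge> 1" for u \<gamma>
    using that coprime_prime_power_iff[OF p, of \<gamma> u] by (simp add: units_mod_def)
  have "Z \<alpha> \<subseteq> {u \<in> units_mod (p ^ \<alpha>). int (p ^ \<alpha>) dvd h * u\<^sup>2 - b}"
  proof
    fix u assume u: "u \<in> Z \<alpha>"
    then have "\<not> int p dvd u" using unit \<alpha>1 by (auto simp: Z_def)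
    then have "int (p ^ \<alpha>) dvd u * J u - 1" using J\<alpha> by (simp add: cong_iff_dvd_diff)
    then have "int (p ^ \<alpha>) dvd u\<^sup>2 * (h - b * (J u)\<^sup>2) + (u * J u - 1) * (b * (u * J u + 1))"
      using u unfolding Z_def by (intro dvd_add) auto
    also have "u\<^sup>2 * (h - b * (J u)\<^sup>2) + (u * J u - 1) * (b * (u * J u + 1)) = h * u\<^sup>2 - b"
      by (simp add: power2_eq_square algebra_simps)
    finally show "u \<in> {u \<in> units_mod (p ^ \<alpha>). int (p ^ \<alpha>) dvd h * u\<^sup>2 - b}" using u by (simp add: Z_def)
  qed
  then have "card (Z \<alpha>) \<le> card {u \<in> units_mod (p ^ \<alpha>). int (p ^ \<alpha>) dvd h * u\<^sup>2 - b}"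
    by (intro card_mono) (auto intro: finite_subset[OF _ finite_units_mod])
  then have Z4: "card (Z \<alpha>) \<le> 4" using card_stationary_points_le[OF p \<alpha>1 h, of b] by linarith
  have finZ: "finite (Z \<alpha>)" by (auto simp: Z_def)
  show ?thesis
  proof (cases "even k")
    case True
    then have k2: "k = \<alpha> + \<alpha>" by (auto simp: \<alpha>_def)
    have "kloosterman (p ^ k) b h = of_nat (p ^ \<alpha>) * (\<Sum>u\<in>Z \<alpha>. ec (p ^ k) (b * J u + h * u))"
      using kloosterman_stationary_phase[OF p \<alpha>1 order_refl] unfolding Z_def J_def k2 .
    then have "norm (kloosterman (p ^ k) b h) = p ^ \<alpha> * norm (\<Sum>u\<in>Z \<alpha>. ec (p ^ k) (b * J u + h * u))"
      by (simp add: norm_mult norm_power)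
    also have "\<dots> \<le> p ^ \<alpha> * (\<Sum>u\<in>Z \<alpha>. norm (ec (p ^ k) (b * J u + h * u)))"
      by (intro mult_left_mono norm_sum) auto
    also have "\<dots> \<le> real (p ^ \<alpha>) * 4" using Z4 by (intro mult_left_mono) auto
    also have "real (p ^ \<alpha>) = sqrt (p ^ k)" unfolding k2 by (simp add: power_add real_sqrt_mult)
    finally have "norm (kloosterman (p ^ k) b h) \<le> sqrt (p ^ k) * 4" .
    moreover have "0 \<le> sqrt (p ^ k)" by simp
    ultimately show ?thesis by linarith
  next
    case False
    then have k2: "k = \<alpha> + (\<alpha> + 1)" unfolding \<alpha>_def by presburger
    have split: "p ^ (\<alpha> + 1) = p ^ \<alpha> * p" by simp
    \<comment> \<open>At a stationary point b J(u)^2 is congruent to \<open>h\<close> modulo p and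
      hence a unit; so the quadratic coefficient of the Gauss sum is a unit as well.\<close>
    have Jb: "\<not> int p dvd b * (J u) ^ 3" if u: "u \<in> Z \<alpha>" for u
    proof -
      have "int p dvd h - b * (J u)\<^sup>2" using u pow_dvd by (auto simp: Z_def intro: dvd_trans)
      then have "\<not> int p dvd b * (J u)\<^sup>2" using h by (metis diff_add_cancel dvd_add)
      then show ?thesis using pp by (auto simp: prime_dvd_mult_iff prime_dvd_power_iff)
    qed
    define f where "f u = (if int (p ^ \<alpha>) dvd h - b * (J u)\<^sup>2 then ec (p ^ k) (b * J u + h * u) else 0)" for u
    \<comment> \<open>Now the expansion of the inverse is needed to second order. Its remainder is
      divisible by p^(3 \<alpha>), hence by p^k, because k = 2 \<alpha> + 1 <= 3 \<alpha>.\<close>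
    have J_shift: "[J (u + int (p ^ \<alpha>) * w) = J u - int (p ^ \<alpha>) * w * (J u)\<^sup>2 + int (p ^ \<alpha>) * int (p ^ \<alpha>) * w\<^sup>2 * (J u) ^ 3] (mod int (p ^ k))"
      if u: "\<not> int p dvd u" for u w
    proof -
      define P where "P = int (p ^ \<alpha>)"
      define x where "x = u + P * w"
      define j where "j = J u"
      define y where "y = j - P * w * j\<^sup>2 + P * P * w\<^sup>2 * j ^ 3"
      have "[u * j = 1] (mod int (p ^ k))" using J[OF u] by (simp add: j_def)
      then have 1: "int (p ^ k) dvd u * j - 1" by (simp add: cong_iff_dvd_diff)
      have 2: "int (p ^ k) dvd P * P * P"
      proof -
        have "k \<le> \<alpha> + \<alpha> + \<alpha>" using k2 \<alpha>1 by simp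
        then have "int p ^ k dvd int p ^ (\<alpha> + \<alpha> + \<alpha>)" by (rule le_imp_power_dvd)
        then show ?thesis by (simp add: P_def power_add)
      qed
      have "x * y - 1 = (u * j - 1) * (1 - P * w * j + P * P * w\<^sup>2 * j\<^sup>2) + P * P * P * (w ^ 3 * j ^ 3)"
        by (simp add: x_def y_def power2_eq_square power3_eq_cube algebra_simps)
      also have "int (p ^ k) dvd \<dots>" using dvd_add[OF dvd_mult2[OF 1] dvd_mult2[OF 2]] .
      finally have xy: "[x * y = 1] (mod int (p ^ k))" by (simp add: cong_iff_dvd_diff)
      have "int p dvd P * w" using pow_dvd by (simp add: P_def)
      then have "\<not> int p dvd x" using u by (auto simp: x_def dvd_add_left_iff)
      then have xJ: "[x * J x = 1] (mod int (p ^ k))" by (rule J)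
      have eq: "J x * (x * y) = (x * J x) * y" by (simp add: mult_ac)
      have 3: "[(x * J x) * y = J x] (mod int (p ^ k))"
        using cong_mult[OF cong_refl[of "J x"] xy] unfolding eq mult_1_right .
      have 4: "[(x * J x) * y = y] (mod int (p ^ k))"
        using cong_mult[OF xJ cong_refl[of y]] unfolding mult_1_left .
      have "[J x = y] (mod int (p ^ k))" by (rule cong_trans[OF cong_sym[OF 3] 4])
      then show ?thesis by (simp add: x_def y_def j_def P_def)
    qed
    have J_shift1: "[J (u + int (p ^ \<alpha>) * w) = J u] (mod int (p ^ \<alpha>))" if u: "\<not> int p dvd u" for u w
    proof -
      have "[J (u + int (p ^ \<alpha>) * w) = J u - int (p ^ \<alpha>) * w * (J u)\<^sup>2 + int (p ^ \<alpha>) * int (p ^ \<alpha>) * w\<^sup>2 * (J u) ^ 3] (mod int (p ^ \<alpha>))"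
        using J_shift[OF u] by (rule cong_dvd_modulus) (use \<alpha>k in \<open>simp add: le_imp_power_dvd\<close>)
      also have "[J u - int (p ^ \<alpha>) * w * (J u)\<^sup>2 + int (p ^ \<alpha>) * int (p ^ \<alpha>) * w\<^sup>2 * (J u) ^ 3 = J u] (mod int (p ^ \<alpha>))"
        unfolding cong_iff_dvd_diff
        by (rule dvdI[of _ _ "int (p ^ \<alpha>) * w\<^sup>2 * (J u) ^ 3 - w * (J u)\<^sup>2"]) (simp add: algebra_simps)
      finally show ?thesis .
    qed
    \<comment> \<open>Within a class u modulo p^\<alpha> the condition in \<open>f\<close> does not
      depend on w. If it holds, the phase is a quadratic polynomial in w modulo p, whose linear
      coefficient is the integer (h - b J(u)^2) / p^\<alpha>.\<close>
    have inner: "norm (\<Sum>w\<in>{0..<int p}. f (u + int (p ^ \<alpha>) * w)) \<le> (if u \<in> Z \<alpha> then 2 * sqrt p else 0)"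
      if u: "u \<in> units_mod (p ^ \<alpha>)" for u
    proof -
      have pu: "\<not> int p dvd u" using unit[OF u \<alpha>1] .
      have "[h - b * (J (u + int (p ^ \<alpha>) * w))\<^sup>2 = h - b * (J u)\<^sup>2] (mod int (p ^ \<alpha>))" for w
        using J_shift1[OF pu, of w] by (intro cong_diff cong_mult cong_pow) auto
      then have iff: "int (p ^ \<alpha>) dvd h - b * (J (u + int (p ^ \<alpha>) * w))\<^sup>2 \<longleftrightarrow> u \<in> Z \<alpha>" for w
        using u cong_dvd_iff by (auto simp: Z_def)
      show ?thesis
      proof (cases "u \<in> Z \<alpha>")
        case False
        then have "f (u + int (p ^ \<alpha>) * w) = 0" for w using iff[of w] by (simp add: f_def)
        then show ?thesis using False by simp
      next
        case True
        then obtain t where t: "h - b * (J u)\<^sup>2 = int (p ^ \<alpha>) * t" by (auto simp: Z_def dvd_def)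
        have "f (u + int (p ^ \<alpha>) * w) = ec (p ^ k) (b * J u + h * u) * ec p ((b * (J u) ^ 3) * w\<^sup>2 + t * w)" for w
        proof -
          define P where "P = int (p ^ \<alpha>)"
          have "f (u + P * w) = ec (p ^ k) (b * J (u + P * w) + h * (u + P * w))"
            using iff[of w] True by (simp add: f_def P_def)
          also have "\<dots> = ec (p ^ k) (b * (J u - P * w * (J u)\<^sup>2 + P * P * w\<^sup>2 * (J u) ^ 3) + h * (u + P * w))"
            using J_shift[OF pu, of w] unfolding P_def by (intro ec_cong cong_add cong_mult) auto
          also have "b * (J u - P * w * (J u)\<^sup>2 + P * P * w\<^sup>2 * (J u) ^ 3) + h * (u + P * w)
            = (b * J u + h * u) + (P * w * (h - b * (J u)\<^sup>2) + P * P * (b * (J u) ^ 3 * w\<^sup>2))"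
            by (simp add: algebra_simps)
          also have "P * w * (h - b * (J u)\<^sup>2) + P * P * (b * (J u) ^ 3 * w\<^sup>2) = int (p ^ (\<alpha> + \<alpha>)) * ((b * (J u) ^ 3) * w\<^sup>2 + t * w)"
            unfolding t P_def[symmetric] by (simp add: power_add P_def algebra_simps)
          also have "ec (p ^ k) (b * J u + h * u + int (p ^ (\<alpha> + \<alpha>)) * ((b * (J u) ^ 3) * w\<^sup>2 + t * w))
            = ec (p ^ k) (b * J u + h * u) * ec (p ^ k) (int (p ^ (\<alpha> + \<alpha>)) * ((b * (J u) ^ 3) * w\<^sup>2 + t * w))"
            by (rule ec_add)
          also have "p ^ k = p * p ^ (\<alpha> + \<alpha>)" using k2 by (simp add: power_add)
          also have "ec (p * p ^ (\<alpha> + \<alpha>)) (int (p ^ (\<alpha> + \<alpha>)) * ((b * (J u) ^ 3) * w\<^sup>2 + t * w)) = ec p ((b * (J u) ^ 3) * w\<^sup>2 + t * w)"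
            using p0 by (intro ec_scale) simp
          finally show ?thesis using \<open>p ^ k = p * p ^ (\<alpha> + \<alpha>)\<close> by (simp add: P_def)
        qed
        then have "(\<Sum>w\<in>{0..<int p}. f (u + int (p ^ \<alpha>) * w))
          = ec (p ^ k) (b * J u + h * u) * (\<Sum>w\<in>{0..<int p}. ec p ((b * (J u) ^ 3) * w\<^sup>2 + t * w))"
          by (simp only: sum_distrib_left)
        then have "norm (\<Sum>w\<in>{0..<int p}. f (u + int (p ^ \<alpha>) * w))
          = norm (\<Sum>w\<in>{0..<int p}. ec p ((b * (J u) ^ 3) * w\<^sup>2 + t * w))"
          by (simp add: norm_mult)
        then show ?thesis using gauss_sum_bound[OF p Jb[OF True], of t] True by simp
      qed
    qed
    have cop: "coprime x (int (p ^ \<alpha> * p)) \<longleftrightarrow> coprime x (int (p ^ \<alpha>))" for x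
    proof -
      have *: "1 \<le> \<alpha> + 1" by simp
      show ?thesis
        unfolding split[symmetric] coprime_prime_power_iff[OF p *] coprime_prime_power_iff[OF p \<alpha>1] ..
    qed
    have "kloosterman (p ^ k) b h = of_nat (p ^ \<alpha>) * (\<Sum>u\<in>Z (\<alpha> + 1). ec (p ^ k) (b * J u + h * u))"
      using kloosterman_stationary_phase[OF p \<alpha>1, of "\<alpha> + 1"] unfolding Z_def J_def k2 by simp
    also have "(\<Sum>u\<in>Z (\<alpha> + 1). ec (p ^ k) (b * J u + h * u)) = (\<Sum>u\<in>units_mod (p ^ \<alpha> * p). f u)"
      unfolding Z_def f_def split by (rule sum.inter_filter) simp
    also have "\<dots> = (\<Sum>u\<in>units_mod (p ^ \<alpha>). \<Sum>w\<in>{0..<int p}. f (u + int (p ^ \<alpha>) * w))"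
      by (rule sum_units_split) (use p0 cop in auto)
    finally have "norm (kloosterman (p ^ k) b h) = p ^ \<alpha> * norm (\<Sum>u\<in>units_mod (p ^ \<alpha>). \<Sum>w\<in>{0..<int p}. f (u + int (p ^ \<alpha>) * w))"
      by (simp add: norm_mult norm_power)
    also have "\<dots> \<le> p ^ \<alpha> * (\<Sum>u\<in>units_mod (p ^ \<alpha>). if u \<in> Z \<alpha> then 2 * sqrt p else 0)"
      by (intro mult_left_mono sum_norm_le inner) auto
    also have "(\<Sum>u\<in>units_mod (p ^ \<alpha>). if u \<in> Z \<alpha> then 2 * sqrt p else 0) = (\<Sum>u\<in>{u\<in>units_mod (p ^ \<alpha>). u \<in> Z \<alpha>}. 2 * sqrt p)"
      by (rule sum.inter_filter[symmetric]) simp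
    also have "{u\<in>units_mod (p ^ \<alpha>). u \<in> Z \<alpha>} = Z \<alpha>" by (auto simp: Z_def)
    also have "p ^ \<alpha> * (\<Sum>u\<in>Z \<alpha>. 2 * sqrt p) \<le> p ^ \<alpha> * (4 * (2 * sqrt p))"
    proof (intro mult_left_mono)
      show "(\<Sum>u\<in>Z \<alpha>. 2 * sqrt p) \<le> 4 * (2 * sqrt p)"
        using mult_right_mono[of "real (card (Z \<alpha>))" 4 "2 * sqrt p"] Z4 by simp
    qed auto
    also have "\<dots> = 8 * (p ^ \<alpha> * sqrt p)" by simp
    also have "p ^ \<alpha> * sqrt p = sqrt (p ^ k)" unfolding k2 by (simp add: power_add real_sqrt_mult)
    finally show ?thesis .
  qed
qed

text \<open>Stationary phase with \<alpha> = 1: a stationary point would make the unit b / u^2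
  congruent to h, that is to 0, modulo p.\<close>

lemma kloosterman_prime_power_vanish:
  assumes p: "prime p" and k: "k \<ge> 2" and h: "int p dvd h" and b: "\<not> int p dvd b"
  shows "kloosterman (p ^ k) b h = 0"
proof -
  have pp: "prime (int p)" using p by simp
  have k2: "k = 1 + (k - 1)" using k by simp
  have "int p dvd h - b * (modular_inverse (int (p ^ k)) u)\<^sup>2 \<Longrightarrow> u \<notin> units_mod (p ^ (k - 1))" for u
  proof
    assume *: "int p dvd h - b * (modular_inverse (int (p ^ k)) u)\<^sup>2" "u \<in> units_mod (p ^ (k - 1))"
    have "coprime u (int (p ^ k))"
      using *(2) k coprime_prime_power_iff[OF p, of k u] coprime_prime_power_iff[OF p, of "k - 1" u]
      by (simp add: units_mod_def)
    then have "coprime (modular_inverse (int (p ^ k)) u) (int (p ^ k))" by (rule coprime_modular_inverse)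
    then have "\<not> int p dvd modular_inverse (int (p ^ k)) u"
      using k coprime_prime_power_iff[OF p, of k] by auto
    then have "\<not> int p dvd b * (modular_inverse (int (p ^ k)) u)\<^sup>2"
      using b pp by (auto simp: prime_dvd_mult_iff prime_dvd_power_iff)
    then show False using *(1) h by (metis diff_diff_eq2 diff_add_cancel dvd_diff_commute dvd_diff add_diff_cancel_left')
  qed
  then have E: "{u \<in> units_mod (p ^ (k - 1)). int (p ^ 1) dvd h - b * (modular_inverse (int (p ^ (1 + (k - 1)))) u)\<^sup>2} = {}"
    using k2 by auto
  have "1 \<le> k - 1" using k by simp
  then have "kloosterman (p ^ (1 + (k - 1))) b h = 0"
    unfolding kloosterman_stationary_phase[OF p order_refl \<open>1 \<le> k - 1\<close>] E by simp
  then show ?thesis using k2 by simp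
qed

text \<open>The trivial bound covers p = 2 and p | h, where the gcd is p; for p | b the sum is -1;
  otherwise the Weil bound applies. The constant 8 is that of
  \<open>kloosterman_prime_power_nondvd\<close>.\<close>

lemma kloosterman_prime_bound:
  assumes p: "prime p"
  shows "norm (kloosterman p b h) \<le> 8 * sqrt p * gcd h (int p)"
proof -
  have p1: "p > 1" using p prime_gt_1_nat by blast
  have triv: "norm (kloosterman p b h) \<le> p"
    using norm_kloosterman_le[of p b h] card_units_mod_le[of p] by linarith
  have sq1: "sqrt p \<ge> 1" using p1 by simp
  consider "p = 2" | "int p dvd h" | "p > 2" "\<not> int p dvd h" "int p dvd b" | "p > 2" "\<not> int p dvd h" "\<not> int p dvd b"
    using p1 by linarith
  then show ?thesis
  proof cases
    case 1
    have "real_of_int (gcd h (int p)) \<ge> 1" using p1 by (simp add: int_one_le_iff_zero_less)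
    then have "8 * 1 * 1 \<le> 8 * sqrt p * real_of_int (gcd h (int p))" using sq1 by (intro mult_mono) auto
    then show ?thesis using triv 1 by simp
  next
    case 2
    then have "gcd h (int p) = int p" by (simp add: gcd_proj2_iff)
    moreover have "1 \<le> 8 * sqrt p" using sq1 by linarith
    from mult_right_mono[OF this, of "real p"] have "real p \<le> 8 * sqrt p * real p" by simp
    ultimately show ?thesis using triv by simp
  next
    case 3
    have "coprime x (int p) \<longleftrightarrow> x \<noteq> 0" if "x \<in> {0..<int p}" for x
      using coprime_prime_power_iff[OF p, of 1 x] that by (auto dest: zdvd_imp_le)
    then have U: "units_mod p = {0..<int p} - {0}" by (auto simp: units_mod_def)
    have "kloosterman p b h = (\<Sum>x\<in>{0..<int p} - {0}. ec p (h * x))"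
      unfolding kloosterman_def U
    proof (intro sum.cong refl ec_cong)
      fix x
      show "[b * modular_inverse (int p) x + h * x = h * x] (mod int p)"
        using 3 by (simp add: cong_iff_dvd_diff)
    qed
    also have "\<dots> = (\<Sum>x\<in>{0..<int p}. ec p (h * x)) - 1"
      using p1 by (subst sum_diff1) auto
    also have "\<dots> = - 1" using sum_ec[of p h] 3 p1 by simp
    finally have "norm (kloosterman p b h) = 1" by simp
    moreover have "real_of_int (gcd h (int p)) \<ge> 1" using p1 by (simp add: int_one_le_iff_zero_less)
    then have "8 * 1 * 1 \<le> 8 * sqrt p * real_of_int (gcd h (int p))" using sq1 by (intro mult_mono) auto
    ultimately show ?thesis by simp
  next
    case 4
    have "real_of_int (gcd h (int p)) \<ge> 1" using p1 by (simp add: int_one_le_iff_zero_less)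
    then have "8 * sqrt p * 1 \<le> 8 * sqrt p * real_of_int (gcd h (int p))" by (intro mult_left_mono) auto
    moreover have "norm (kloosterman p b h) \<le> 2 * sqrt p" using weil_bound_prime[OF p] 4 by blast
    ultimately show ?thesis using sq1 by linarith
  qed
qed

text \<open>A common factor p of both arguments multiplies the sum by p, and the gcd with
  \<open>h\<close> grows by the same factor. If p divides \<open>h\<close> but not \<open>b\<close>
  the sum vanishes, so the gcd may ignore \<open>b\<close>.\<close>

lemma kloosterman_prime_power_bound:
  assumes p: "prime p" and k: "k \<ge> 1"
  shows "norm (kloosterman (p ^ k) b h) \<le> 8 * sqrt (p ^ k) * gcd h (int (p ^ k))"
  using k
proof (induction k arbitrary: b h rule: dec_induct)
  case base
  then show ?case using kloosterman_prime_bound[OF p] by simp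
next
  case (step k)
  have p0: "p > 0" using p prime_gt_0_nat by blast
  have k2: "Suc k \<ge> 2" using step by simp
  show ?case
  proof (cases "int p dvd h")
    case False
    have "real_of_int (gcd h (int (p ^ Suc k))) \<ge> 1" using p0 by (simp add: int_one_le_iff_zero_less)
    then have "8 * sqrt (p ^ Suc k) * 1 \<le> 8 * sqrt (p ^ Suc k) * real_of_int (gcd h (int (p ^ Suc k)))"
      by (intro mult_left_mono) auto
    then show ?thesis using kloosterman_prime_power_nondvd[OF p k2 False, of b] by linarith
  next
    case h: True
    show ?thesis
    proof (cases "int p dvd b")
      case False
      then show ?thesis using kloosterman_prime_power_vanish[OF p k2 h False] by simp
    next
      case True
      then obtain b' h' where b': "b = int p * b'" and h': "h = int p * h'" using h by (auto simp: dvd_def)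
      obtain j where j: "k = j + 1" using step(1) by (metis add.commute le_Suc_ex plus_1_eq_Suc)
      have "kloosterman (p ^ Suc k) b h = of_nat p * kloosterman (p ^ k) b' h'"
        unfolding b' h' j using kloosterman_prime_power_reduce[OF p, of j b' h'] by (simp add: numeral_2_eq_2)
      then have "norm (kloosterman (p ^ Suc k) b h) = p * norm (kloosterman (p ^ k) b' h')" by (simp add: norm_mult)
      also have "\<dots> \<le> p * (8 * sqrt (p ^ k) * gcd h' (int (p ^ k)))"
        using step.IH by (intro mult_left_mono) auto
      also have "\<dots> = 8 * sqrt (p ^ k) * (int p * gcd h' (int (p ^ k)))" by simp
      also have "int p * gcd h' (int (p ^ k)) = gcd h (int (p ^ Suc k))"
        unfolding h' using gcd_mult_distrib_int[of "int p" h' "int (p ^ k)"] by simp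
      also have "8 * sqrt (p ^ k) * gcd h (int (p ^ Suc k)) \<le> 8 * sqrt (p ^ Suc k) * gcd h (int (p ^ Suc k))"
        using p0 by (intro mult_right_mono mult_left_mono real_sqrt_le_mono) auto
      finally show ?thesis .
    qed
  qed
qed

section \<open>From prime powers to all moduli\<close>

lemma prime_power_coprime_induct [consumes 1, case_names one prime_power]:
  assumes "n > 0" "P (1::nat)"
    and "\<And>p k m. prime p \<Longrightarrow> k \<ge> 1 \<Longrightarrow> coprime p m \<Longrightarrow> m > 0 \<Longrightarrow> P m \<Longrightarrow> P (p ^ k * m)"
  shows "P n"
  using assms(1)
proof (induction n rule: less_induct)
  case (less n)
  show ?case
  proof (cases "n = 1")
    case True
    then show ?thesis using assms(2) by simp
  next
    case False
    then obtain p where p: "prime p" "p dvd n" using prime_factor_nat by blast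
    define k where "k = multiplicity p n"
    have k: "k \<ge> 1" using p less.prems by (simp add: k_def prime_multiplicity_gt_zero_iff Suc_le_eq)
    obtain m where m: "n = p ^ k * m" "\<not> p dvd m"
      using multiplicity_decompose'[of n p] p less.prems by (metis k_def not_prime_unit neq0_conv)
    have "m > 0" using m less.prems by (cases m) auto
    moreover have "p ^ k > 1" using k p prime_gt_1_nat one_less_power by (metis Suc_le_eq One_nat_def)
    ultimately have "m < n" using m by simp
    moreover have "coprime p m" using p m by (simp add: prime_imp_coprime)
    ultimately show ?thesis using assms(3)[OF p(1) k _ \<open>m > 0\<close>] less.IH[of m] \<open>m > 0\<close> m by simp
  qed
qed

definition divisor_count :: "nat \<Rightarrow> nat" where
  "divisor_count n = card {d. d dvd n}"

lemma divisor_count_1 [simp]: "divisor_count (Suc 0) = 1"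
  by (simp add: divisor_count_def)

lemma divisor_count_pos: "n > 0 \<Longrightarrow> divisor_count n \<ge> 1"
  unfolding divisor_count_def by (metis One_nat_def Suc_le_eq card_gt_0_iff empty_iff finite_divisors_nat mem_Collect_eq one_dvd)

lemma divisor_count_prime_power_ge:
  assumes p: "prime p" and k: "k \<ge> 1" and m: "coprime p m" "m > 0"
  shows "2 * divisor_count m \<le> divisor_count (p ^ k * m)"
proof -
  let ?D = "{d. d dvd m}"
  have fin: "finite ?D" using m by simp
  have nd: "\<not> p dvd d" if "d dvd m" for d
    using that m p by (metis coprime_common_divisor dvd_refl dvd_trans not_prime_unit)
  have "?D \<inter> (\<lambda>d. p * d) ` ?D = {}" by (auto dest: nd)
  then have "card (?D \<union> (\<lambda>d. p * d) ` ?D) = card ?D + card ((\<lambda>d. p * d) ` ?D)"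
    using fin by (intro card_Un_disjoint) auto
  also have "card ((\<lambda>d. p * d) ` ?D) = card ?D"
    using p by (intro card_image) (auto simp: inj_on_def)
  finally have "2 * divisor_count m = card (?D \<union> (\<lambda>d. p * d) ` ?D)" by (simp add: divisor_count_def)
  also have "\<dots> \<le> divisor_count (p ^ k * m)"
    unfolding divisor_count_def
  proof (rule card_mono)
    show "finite {d. d dvd p ^ k * m}" using m p by (auto simp: prime_gt_0_nat)
    show "?D \<union> (\<lambda>d. p * d) ` ?D \<subseteq> {d. d dvd p ^ k * m}" using k by (auto intro!: mult_dvd_mono)
  qed
  finally show ?thesis .
qed

lemma divisor_count_prime_power_le:
  assumes p: "prime p" and m: "coprime p m" "m > 0"
  shows "divisor_count (p ^ k * m) \<le> (k + 1) * divisor_count m"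
proof -
  let ?f = "\<lambda>(i, d). p ^ i * d"
  have "{d. d dvd p ^ k * m} \<subseteq> ?f ` ({..k} \<times> {d. d dvd m})"
  proof
    fix d assume "d \<in> {d. d dvd p ^ k * m}"
    then obtain a b where ab: "d = a * b" "a dvd p ^ k" "b dvd m" using division_decomp[of d "p ^ k" m] by auto
    then obtain i where "i \<le> k" "a = p ^ i" using divides_primepow_nat[OF p] by auto
    then show "d \<in> ?f ` ({..k} \<times> {d. d dvd m})" using ab by (intro image_eqI[of _ _ "(i, b)"]) auto
  qed
  then have "divisor_count (p ^ k * m) \<le> card (?f ` ({..k} \<times> {d. d dvd m}))"
    unfolding divisor_count_def using m by (intro card_mono) auto
  also have "\<dots> \<le> card ({..k} \<times> {d. d dvd m})" using m by (intro card_image_le) auto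
  finally show ?thesis by (simp add: divisor_count_def card_cartesian_product)
qed

text \<open>Each prime power brings the constant 8 = 2^3 and at least doubles the divisor count, so
  the cube of the divisor count absorbs all constants.\<close>

lemma kloosterman_bound:
  assumes "c > 0"
  shows "norm (kloosterman c b h) \<le> divisor_count c ^ 3 * sqrt c * gcd h (int c)"
  using assms
proof (induction c arbitrary: b rule: prime_power_coprime_induct)
  case one
  then show ?case using kloosterman_1 by simp
next
  case (prime_power p k m)
  have p0: "p ^ k > 0" using prime_power prime_gt_0_nat by simp
  have cop: "coprime (p ^ k) m" using prime_power by simp
  obtain b1 b2 where "kloosterman (p ^ k * m) b h = kloosterman (p ^ k) b1 h * kloosterman m b2 h"
    using kloosterman_mult[OF p0 \<open>m > 0\<close> cop] by blast
  then have "norm (kloosterman (p ^ k * m) b h) = norm (kloosterman (p ^ k) b1 h) * norm (kloosterman m b2 h)"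
    by (simp add: norm_mult)
  also have "\<dots> \<le> (8 * sqrt (p ^ k) * gcd h (int (p ^ k))) * (divisor_count m ^ 3 * sqrt m * gcd h (int m))"
    using kloosterman_prime_power_bound[of p k] prime_power by (intro mult_mono) auto
  also have "\<dots> = (2 * real (divisor_count m)) ^ 3 * sqrt (p ^ k * m) * real_of_int (gcd h (int (p ^ k)) * gcd h (int m))"
    by (simp add: power_mult_distrib real_sqrt_mult)
  also have "\<dots> \<le> real (divisor_count (p ^ k * m)) ^ 3 * sqrt (p ^ k * m) * real_of_int (gcd h (int (p ^ k * m)))"
  proof (intro mult_mono power_mono)
    show "2 * real (divisor_count m) \<le> real (divisor_count (p ^ k * m))"
      using divisor_count_prime_power_ge[of p k m] prime_power by linarith
    have "coprime (gcd h (int (p ^ k))) (gcd h (int m))"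
      by (rule coprime_divisors[OF gcd_dvd2 gcd_dvd2]) (use cop in \<open>simp only: coprime_int_iff\<close>)
    then have "gcd h (int (p ^ k)) * gcd h (int m) dvd gcd h (int (p ^ k * m))"
      by (intro gcd_greatest divides_mult) (auto intro!: mult_dvd_mono)
    then have "gcd h (int (p ^ k)) * gcd h (int m) \<le> gcd h (int (p ^ k * m))"
      using p0 \<open>m > 0\<close> by (intro zdvd_imp_le) auto
    then show "real_of_int (gcd h (int (p ^ k)) * gcd h (int m)) \<le> real_of_int (gcd h (int (p ^ k * m)))"
      by linarith
  qed auto
  finally show ?case by simp
qed

text \<open>Inversion permutes the units, so this is the sum of e(b x / p^k) over units: the
  complete sum minus the one over multiples of p, both known from orthogonality.\<close>

lemma ramanujan_prime_power_bound:
  assumes p: "prime p" and k: "k \<ge> 1"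
  shows "norm (kloosterman (p ^ k) b 0) \<le> gcd b (int (p ^ k))"
proof -
  have p0: "p > 0" using p prime_gt_0_nat by blast
  have split: "p ^ k = p ^ (k - 1) * p" using k by (simp add: power_eq_if)
  have J: "modular_inverse (int (p ^ k)) x \<in> units_mod (p ^ k) \<and>
      modular_inverse (int (p ^ k)) (modular_inverse (int (p ^ k)) x) = x" if x: "x \<in> units_mod (p ^ k)" for x
  proof -
    have c: "coprime x (int (p ^ k))" and x': "x \<in> {0..<int (p ^ k)}" using x by (auto simp: units_mod_def)
    have "modular_inverse (int (p ^ k)) x \<in> units_mod (p ^ k)"
      unfolding units_mod_def
      using coprime_modular_inverse[OF c] modular_inverse_int_nonneg[of "int (p ^ k)" x]
        modular_inverse_int_less[of "int (p ^ k)" x] p0 by auto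
    moreover have "modular_inverse (int (p ^ k)) (modular_inverse (int (p ^ k)) x) = x"
      using x' cong_modular_inverse2[OF c] by (rule modular_inverse_int_eqI)
    ultimately show ?thesis by blast
  qed
  have "kloosterman (p ^ k) b 0 = (\<Sum>x\<in>units_mod (p ^ k). ec (p ^ k) (b * x))"
    unfolding kloosterman_def
    by (rule sum.reindex_bij_witness[of _ "modular_inverse (int (p ^ k))" "modular_inverse (int (p ^ k))"])
       (use J in auto)
  also have "units_mod (p ^ k) = {0..<int (p ^ k)} - {x \<in> {0..<int (p ^ k)}. int p dvd x}"
    unfolding units_mod_def using coprime_prime_power_iff[OF p k] by blast
  also have "(\<Sum>x\<in>{0..<int (p ^ k)} - {x \<in> {0..<int (p ^ k)}. int p dvd x}. ec (p ^ k) (b * x))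
     = (\<Sum>x\<in>{0..<int (p ^ k)}. ec (p ^ k) (b * x)) - (\<Sum>x\<in>{x \<in> {0..<int (p ^ k)}. int p dvd x}. ec (p ^ k) (b * x))"
    by (rule sum_diff) (auto intro: finite_subset[of _ "{0..<int (p ^ k)}"])
  also have "(\<Sum>x\<in>{x \<in> {0..<int (p ^ k)}. int p dvd x}. ec (p ^ k) (b * x)) = (\<Sum>y\<in>{0..<int (p ^ (k - 1))}. ec (p ^ (k - 1)) (b * y))"
  proof (rule sum.reindex_bij_witness[of _ "\<lambda>y. int p * y" "\<lambda>x. x div int p"])
    fix x assume "x \<in> {x \<in> {0..<int (p ^ k)}. int p dvd x}"
    then obtain y where y: "x = int p * y" "0 \<le> x" "x < int (p ^ k)" by auto
    then have xy: "x div int p = y" using p0 by simp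
    then show "int p * (x div int p) = x" using y by simp
    have "0 \<le> y" using y p0 by (simp add: zero_le_mult_iff)
    moreover have "y < int (p ^ (k - 1))"
    proof -
      have "int p * y < int p * int (p ^ (k - 1))" using y split by (simp add: mult.commute)
      then show ?thesis using p0 by (simp add: mult_less_cancel_left)
    qed
    ultimately show "x div int p \<in> {0..<int (p ^ (k - 1))}" using xy by simp
    show "ec (p ^ (k - 1)) (b * (x div int p)) = ec (p ^ k) (b * x)"
      unfolding xy using ec_scale[OF p0, of "p ^ (k - 1)" "b * y"] y split by (simp add: mult_ac)
  next
    fix y assume y: "y \<in> {0..<int (p ^ (k - 1))}"
    then show "int p * y div int p = y" using p0 by simp
    have "int p * y < int p * int (p ^ (k - 1))" using y p0 by (intro mult_strict_left_mono) auto
    then show "int p * y \<in> {x \<in> {0..<int (p ^ k)}. int p dvd x}" using y split by (simp add: mult.commute)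
  qed
  finally have K: "kloosterman (p ^ k) b 0 = (if int (p ^ k) dvd b then of_nat (p ^ k) else 0)
      - (if int (p ^ (k - 1)) dvd b then of_nat (p ^ (k - 1)) else 0)"
    using sum_ec[of "p ^ k" b] sum_ec[of "p ^ (k - 1)" b] p0 by simp
  have dvd: "int (p ^ (k - 1)) dvd int (p ^ k)" using split by simp
  have g0: "gcd b (int (p ^ k)) > 0" using p0 by simp
  show ?thesis
  proof (cases "int (p ^ k) dvd b")
    case True
    then have "int (p ^ (k - 1)) dvd b" using dvd dvd_trans by blast
    then have "kloosterman (p ^ k) b 0 = of_real (real (p ^ k) - real (p ^ (k - 1)))" using K True by simp
    then have "norm (kloosterman (p ^ k) b 0) = \<bar>real (p ^ k) - real (p ^ (k - 1))\<bar>" by (simp only: norm_of_real)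
    also have "\<dots> \<le> real (p ^ k)"
    proof -
      have "p ^ (k - 1) \<le> p ^ k" using p0 by (intro power_increasing) auto
      then have "real (p ^ (k - 1)) \<le> real (p ^ k)" by (rule of_nat_mono)
      then show ?thesis by linarith
    qed
    also have "gcd b (int (p ^ k)) = int (p ^ k)" using True by (simp add: gcd_proj2_iff)
    then have "real (p ^ k) = real_of_int (gcd b (int (p ^ k)))" by simp
    finally show ?thesis .
  next
    case False
    show ?thesis
    proof (cases "int (p ^ (k - 1)) dvd b")
      case True
      then have "int (p ^ (k - 1)) dvd gcd b (int (p ^ k))" using dvd by (intro gcd_greatest)
      then have le: "int (p ^ (k - 1)) \<le> gcd b (int (p ^ k))" using g0 zdvd_imp_le by blast
      have "kloosterman (p ^ k) b 0 = - of_real (real (p ^ (k - 1)))" using K False True by simp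
      then have "norm (kloosterman (p ^ k) b 0) = real (p ^ (k - 1))" by (simp add: norm_power)
      also have "\<dots> = real_of_int (int (p ^ (k - 1)))" by simp
      also have "\<dots> \<le> real_of_int (gcd b (int (p ^ k)))" using le by (simp only: of_int_le_iff)
      finally show ?thesis .
    next
      case F: False
      then show ?thesis using K False g0 by simp
    qed
  qed
qed

text \<open>Serves frequency 0 in the completion, where \<open>kloosterman_bound\<close> would only
  offer the gcd c. The twists in \<open>kloosterman_mult\<close> multiply \<open>b\<close> by
  squares of units and do not affect the gcd.\<close>

lemma ramanujan_bound:
  assumes "c > 0"
  shows "norm (kloosterman c b 0) \<le> gcd b (int c)"
  using assms
proof (induction c arbitrary: b rule: prime_power_coprime_induct)
  case one
  then show ?case using kloosterman_1 by simp
next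
  case (prime_power p k m)
  have p0: "p ^ k > 0" using prime_power prime_gt_0_nat by simp
  have cop: "coprime (p ^ k) m" using prime_power by simp
  define i1 where "i1 = modular_inverse (int m) (int (p ^ k))"
  define i2 where "i2 = modular_inverse (int (p ^ k)) (int m)"
  have "coprime (int (p ^ k)) (int m)" "coprime (int m) (int (p ^ k))"
    using cop by (simp_all only: coprime_int_iff coprime_commute)
  then have c1: "coprime i1 (int m)" and c2: "coprime i2 (int (p ^ k))"
    unfolding i1_def i2_def by (auto intro!: coprime_modular_inverse simp del: of_nat_power)
  have "norm (kloosterman (p ^ k * m) b 0) = norm (kloosterman (p ^ k) (b * i2\<^sup>2) 0) * norm (kloosterman m (b * i1\<^sup>2) 0)"
    unfolding i1_def i2_def kloosterman_mult[OF p0 \<open>m > 0\<close> cop] by (simp add: norm_mult)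
  also have "\<dots> \<le> gcd (b * i2\<^sup>2) (int (p ^ k)) * gcd (b * i1\<^sup>2) (int m)"
    using ramanujan_prime_power_bound[of p k] prime_power unfolding of_int_mult by (intro mult_mono) auto
  also have "gcd (b * i2\<^sup>2) (int (p ^ k)) = gcd b (int (p ^ k))"
    using c2 by (intro gcd_mult_left_right_cancel) (simp add: coprime_commute del: of_nat_power)
  also have "gcd (b * i1\<^sup>2) (int m) = gcd b (int m)"
    using c1 by (intro gcd_mult_left_right_cancel) (simp add: coprime_commute)
  also have "gcd b (int (p ^ k)) * gcd b (int m) \<le> gcd b (int (p ^ k * m))"
  proof (rule zdvd_imp_le)
    have "coprime (gcd b (int (p ^ k))) (gcd b (int m))"
      by (rule coprime_divisors[OF gcd_dvd2 gcd_dvd2]) (use cop in \<open>simp only: coprime_int_iff\<close>)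
    then show "gcd b (int (p ^ k)) * gcd b (int m) dvd gcd b (int (p ^ k * m))"
      by (intro gcd_greatest divides_mult) (auto intro!: mult_dvd_mono)
  qed (use p0 \<open>m > 0\<close> in auto)
  finally show ?case by (simp only: of_int_le_iff)
qed

section \<open>Incomplete sums\<close>

lemma sin_ge_linear:
  assumes "0 \<le> x" "x \<le> pi / 2"
  shows "x / 4 \<le> sin x"
proof (cases "x \<le> pi / 3")
  case True
  have "(\<lambda>y. sin y - y / 2) 0 \<le> (\<lambda>y. sin y - y / 2) x"
  proof (rule DERIV_nonneg_imp_nondecreasing[OF assms(1)])
    fix y assume y: "0 \<le> y" "y \<le> x"
    have "((\<lambda>y. sin y - y / 2) has_real_derivative (cos y - 1 / 2)) (at y)"
      by (auto intro!: derivative_eq_intros)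
    moreover have "cos (pi / 3) \<le> cos y" using y True by (intro cos_monotone_0_pi_le) auto
    ultimately show "\<exists>d. ((\<lambda>y. sin y - y / 2) has_real_derivative d) (at y) \<and> 0 \<le> d"
      by (auto simp: cos_60)
  qed
  then show ?thesis using assms by simp
next
  case False
  have "sin (pi / 3) \<le> sin x" using False assms by (intro sin_monotone_2pi_le) auto
  moreover have "sqrt 3 \<ge> 1" by simp
  ultimately have "sin x \<ge> 1 / 2" unfolding sin_60 by linarith
  then show ?thesis using assms pi_less_4 by linarith
qed

lemma norm_1_minus_e: "norm (1 - e t) = 2 * \<bar>sin (pi * t)\<bar>"
proof -
  have e: "e t = cis (2 * (pi * t))" by (simp add: e_def cis_conv_exp mult_ac)
  have "(norm (1 - e t))\<^sup>2 = (1 - cos (2 * (pi * t)))\<^sup>2 + (sin (2 * (pi * t)))\<^sup>2"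
    unfolding e by (simp add: cmod_power2)
  also have "\<dots> = 2 - 2 * cos (2 * (pi * t))"
    using sin_cos_squared_add[of "2 * (pi * t)"] by (simp add: power2_eq_square algebra_simps)
  also have "\<dots> = (2 * \<bar>sin (pi * t)\<bar>)\<^sup>2"
    by (simp add: cos_double_sin power_mult_distrib)
  finally show ?thesis by (metis abs_ge_zero mult_nonneg_nonneg norm_ge_zero power2_eq_imp_eq zero_le_numeral)
qed

lemma norm_e_diff_le: "norm (e s - e t) \<le> 2 * pi * \<bar>s - t\<bar>"
proof -
  have "e s = e t * e (s - t)" using e_add[of t "s - t"] by simp
  then have "e s - e t = - (e t * (1 - e (s - t)))" by (simp add: algebra_simps)
  then have "norm (e s - e t) = norm (1 - e (s - t))" by (simp add: norm_mult)
  also have "\<dots> \<le> 2 * \<bar>pi * (s - t)\<bar>" unfolding norm_1_minus_e by (intro mult_left_mono abs_sin_x_le_abs_x) auto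
  finally show ?thesis by (simp add: abs_mult)
qed

text \<open>A sum of two reciprocals, in place of the reciprocal of the minimum, lets the later sum
  over frequencies split into two parts that h -> c - h exchanges.\<close>

lemma norm_1_minus_e_ge:
  assumes "0 < t" "t < 1"
  shows "1 / norm (1 - e t) \<le> 1 / t + 1 / (1 - t)"
proof -
  have "min t (1 - t) \<le> norm (1 - e t)"
  proof (cases "t \<le> 1 / 2")
    case True
    have "pi * t / 4 \<le> sin (pi * t)" using assms True by (intro sin_ge_linear) auto
    moreover have "2 * t \<le> pi * t" using assms pi_ge_two by (intro mult_right_mono) auto
    ultimately show ?thesis
      unfolding norm_1_minus_e using abs_ge_self[of "sin (pi * t)"] min.cobounded1[of t "1 - t"] by linarith
  next
    case False
    have "pi * (1 - t) / 4 \<le> sin (pi * (1 - t))" using assms False by (intro sin_ge_linear) (auto simp: algebra_simps)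
    also have "sin (pi * (1 - t)) = sin (pi * t)" using sin_pi_minus[of "pi * t"] by (simp add: algebra_simps)
    finally have 1: "pi * (1 - t) / 4 \<le> sin (pi * t)" .
    have 2: "2 * (1 - t) \<le> pi * (1 - t)" using assms pi_ge_two by (intro mult_right_mono) auto
    define u where "u = pi * (1 - t)"
    have u: "2 * (1 - t) \<le> u" "u / 4 \<le> sin (pi * t)" using 1 2 by (simp_all only: u_def)
    have "1 - t \<le> 2 * (u / 4)" using u(1) by simp
    also have "\<dots> \<le> 2 * sin (pi * t)" using u(2) by (rule mult_left_mono) simp
    also have "\<dots> \<le> 2 * \<bar>sin (pi * t)\<bar>" by simp
    finally show ?thesis unfolding norm_1_minus_e by (rule min.coboundedI2)
  qed
  then have "1 / norm (1 - e t) \<le> 1 / min t (1 - t)" using assms by (intro divide_left_mono mult_pos_pos) auto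
  also have "\<dots> \<le> 1 / t + 1 / (1 - t)" using assms by (simp add: min_def)
  finally show ?thesis .
qed

lemma int_interval_Suc: "(A::int) \<le> B \<Longrightarrow> {A<..B + 1} = insert (B + 1) {A<..B}"
  by auto

lemma sum_telescope_int:
  fixes f :: "int \<Rightarrow> 'a::ab_group_add"
  assumes "A \<le> B"
  shows "(\<Sum>m\<in>{A<..B}. f m - f (m + 1)) = f (A + 1) - f (B + 1)"
  using assms by (induction B rule: int_ge_induct) (auto simp: int_interval_Suc)

lemma geometric_sum_bound:
  fixes h c :: nat
  assumes "0 < h" "h < c" "A \<le> B"
  shows "norm (\<Sum>m\<in>{A<..B}. ec c (- (int h * m))) \<le> 2 * real c * (1 / real h + 1 / real (c - h))"
proof -
  define S where "S = (\<Sum>m\<in>{A<..B}. ec c (- (int h * m)))"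
  define t where "t = real h / real c"
  have t: "0 < t" "t < 1" using assms by (auto simp: t_def)
  have z: "ec c (- int h) = cnj (e t)" by (simp add: cnj_e ec_def t_def)
  have nz: "norm (1 - ec c (- int h)) = norm (1 - e t)"
  proof -
    have "1 - ec c (- int h) = cnj (1 - e t)" by (simp add: z)
    then show ?thesis by (simp only: complex_mod_cnj)
  qed
  have "S * (1 - ec c (- int h)) = (\<Sum>m\<in>{A<..B}. ec c (- (int h * m)) - ec c (- (int h * (m + 1))))"
    unfolding S_def sum_distrib_right
    by (intro sum.cong refl) (simp add: algebra_simps flip: ec_add)
  also have "\<dots> = ec c (- (int h * (A + 1))) - ec c (- (int h * (B + 1)))"
    using assms by (intro sum_telescope_int)
  finally have "norm S * norm (1 - e t) = norm (ec c (- (int h * (A + 1))) - ec c (- (int h * (B + 1))))"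
    using nz by (metis norm_mult)
  also have "\<dots> \<le> 2" by (rule order_trans[OF norm_triangle_ineq4]) simp
  finally have S: "norm S * norm (1 - e t) \<le> 2" .
  have "sin (pi * t) > 0" using t by (intro sin_gt_zero) auto
  then have pos: "norm (1 - e t) > 0" unfolding norm_1_minus_e by simp
  have "norm S \<le> 2 * (1 / norm (1 - e t))" using S pos by (simp add: field_simps)
  also have "\<dots> \<le> 2 * (1 / t + 1 / (1 - t))" using norm_1_minus_e_ge[OF t] by (intro mult_left_mono) auto
  also have "1 / t + 1 / (1 - t) = real c * (1 / real h + 1 / real (c - h))"
  proof -
    have "1 - t = real (c - h) / real c" using assms by (simp add: t_def of_nat_diff field_simps)
    then show ?thesis by (simp add: t_def distrib_left)
  qed
  finally show ?thesis by (simp add: S_def)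
qed

lemma harmonic_le: "n > 0 \<Longrightarrow> (\<Sum>j=1..n. 1 / real j) \<le> 1 + ln (real n)"
proof (induction n rule: nat_induct_non_zero)
  case (Suc n)
  have "1 / real (Suc n) \<le> ln (real (Suc n)) - ln (real n)"
  proof -
    have "ln (real n / real (Suc n)) \<le> real n / real (Suc n) - 1" using Suc by (intro ln_le_minus_one) auto
    also have "real n / real (Suc n) - 1 = - (1 / real (Suc n))" by (simp add: field_simps)
    finally show ?thesis using Suc by (simp add: ln_div)
  qed
  then show ?case using Suc by simp
qed simp

lemma gcd_le_sum_divisors:
  assumes "n > 0"
  shows "real (gcd k n) \<le> (\<Sum>d | d dvd n. if d dvd k then real d else 0)"
proof -
  have "real (gcd k n) = (\<Sum>d\<in>{gcd k n}. if d dvd k then real d else 0)" by simp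
  also have "\<dots> \<le> (\<Sum>d | d dvd n. if d dvd k then real d else 0)"
    using assms by (intro sum_mono2) auto
  finally show ?thesis .
qed

text \<open>With the gcd majorized by a sum over common divisors d, only multiples h = d j remain
  for each d; there d / h = 1 / j, which leaves a harmonic sum.\<close>

lemma sum_gcd_over_le:
  fixes c :: nat
  assumes "c > 0"
  shows "(\<Sum>h=1..c. real (gcd h c) / real h) \<le> divisor_count c * (1 + ln c)"
proof -
  have "(\<Sum>h=1..c. real (gcd h c) / real h) \<le> (\<Sum>h=1..c. (\<Sum>d | d dvd c. if d dvd h then real d else 0) / real h)"
    using assms by (intro sum_mono divide_right_mono gcd_le_sum_divisors) auto
  also have "\<dots> = (\<Sum>d | d dvd c. \<Sum>h=1..c. (if d dvd h then real d else 0) / real h)"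
    unfolding sum_divide_distrib by (rule sum.swap)
  also have "\<dots> \<le> (\<Sum>d | d dvd c. 1 + ln (real c))"
  proof (intro sum_mono)
    fix d assume "d \<in> {d. d dvd c}"
    then have d: "d dvd c" "d > 0" using assms by (auto intro: dvd_pos_nat)
    have "(\<Sum>h=1..c. (if d dvd h then real d else 0) / real h) = (\<Sum>h\<in>{h\<in>{1..c}. d dvd h}. real d / real h)"
      by (subst sum.inter_filter) (auto intro!: sum.cong)
    also have "\<dots> = (\<Sum>j=1..c div d. 1 / real j)"
    proof (rule sum.reindex_bij_witness[of _ "\<lambda>j. d * j" "\<lambda>h. h div d"])
      fix j assume j: "j \<in> {1..c div d}"
      then have "d * j \<le> d * (c div d)" by (intro mult_left_mono) auto
      then show "d * j \<in> {h \<in> {1..c}. d dvd h}" using j d by auto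
    next
      fix h assume h: "h \<in> {h \<in> {1..c}. d dvd h}"
      then show "h div d \<in> {1..c div d}" using d by (auto simp: div_le_mono Suc_le_eq div_greater_zero_iff dvd_imp_le)
      show "1 / real (h div d) = real d / real h" using h d by (auto elim!: dvdE)
    qed (use d in auto)
    also have "\<dots> \<le> 1 + ln (real (c div d))"
      using d assms by (intro harmonic_le) (auto simp: div_greater_zero_iff dvd_imp_le)
    also have "ln (real (c div d)) \<le> ln (real c)"
      using d assms by (subst ln_le_cancel_iff) (auto simp: div_greater_zero_iff dvd_imp_le)
    finally show "(\<Sum>h=1..c. (if d dvd h then real d else 0) / real h) \<le> 1 + ln (real c)" by simp
  qed
  also have "\<dots> = divisor_count c * (1 + ln c)" by (simp add: divisor_count_def)
  finally show ?thesis .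
qed

text \<open>The summand, extended by 0 to non-units, has period c and Fourier coefficients
  \<open>kloosterman c b h\<close>. Frequency 0 gives the term proportional to the length. For the
  others the gcd of \<open>kloosterman_bound\<close> is averaged against the geometric sums, which
  costs a fourth divisor count and a logarithm; the 4 is the 2 of \<open>geometric_sum_bound\<close>
  for each of two equal halves.\<close>

lemma incomplete_kloosterman_bound:
  fixes c :: nat and A B :: int
  assumes c: "c > 0" and AB: "A \<le> B"
  shows "norm (\<Sum>m\<in>{m\<in>{A<..B}. coprime m (int c)}. ec c (b * modular_inverse (int c) m))
    \<le> real_of_int (B - A) * gcd b (int c) / c + 4 * (real (divisor_count c) ^ 4 * sqrt c * (1 + ln c))"
proof -
  define f where "f m = (if coprime m (int c) then ec c (b * modular_inverse (int c) m) else 0)" for m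
  have f_cong: "f x = f y" if "[x = y] (mod int c)" for x y
  proof -
    have "coprime x (int c) \<longleftrightarrow> coprime y (int c)" using cong_imp_coprime[OF that] cong_imp_coprime[OF cong_sym[OF that]] by blast
    moreover have "ec c (b * modular_inverse (int c) x) = ec c (b * modular_inverse (int c) y)" if "coprime y (int c)"
    proof -
      have "[x * modular_inverse (int c) y = y * modular_inverse (int c) y] (mod int c)"
        using \<open>[x = y] (mod int c)\<close> by (intro cong_mult) auto
      also have "[y * modular_inverse (int c) y = 1] (mod int c)" using that by (rule cong_modular_inverse1)
      finally have "[x * modular_inverse (int c) y = 1] (mod int c)" .
      from ec_modular_inverse[OF this, of b 0] show ?thesis by simp
    qed
    ultimately show ?thesis by (simp add: f_def)
  qed
  have K: "(\<Sum>x\<in>{0..<int c}. f x * ec c (h * x)) = kloosterman c b h" for h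
  proof -
    have "kloosterman c b h = (\<Sum>x\<in>{x\<in>{0..<int c}. coprime x (int c)}. ec c (b * modular_inverse (int c) x) * ec c (h * x))"
      by (simp add: kloosterman_def units_mod_def ec_add)
    also have "\<dots> = (\<Sum>x\<in>{0..<int c}. f x * ec c (h * x))"
      unfolding f_def by (subst sum.inter_filter) (auto intro!: sum.cong)
    finally show ?thesis by simp
  qed
  have inv: "of_nat c * f m = (\<Sum>h\<in>{0..<int c}. kloosterman c b h * ec c (- (h * m)))" for m
  proof -
    have "(\<Sum>h\<in>{0..<int c}. kloosterman c b h * ec c (- (h * m)))
        = (\<Sum>h\<in>{0..<int c}. \<Sum>x\<in>{0..<int c}. f x * ec c ((x - m) * h))"
      unfolding K[symmetric] sum_distrib_right
      by (intro sum.cong refl) (simp add: algebra_simps flip: ec_add)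
    also have "\<dots> = (\<Sum>x\<in>{0..<int c}. f x * (\<Sum>h\<in>{0..<int c}. ec c ((x - m) * h)))"
      by (subst sum.swap) (simp add: sum_distrib_left)
    also have "\<dots> = (\<Sum>x\<in>{0..<int c}. if x = m mod int c then f x * of_nat c else 0)"
    proof (intro sum.cong refl)
      fix x assume x: "x \<in> {0..<int c}"
      have "int c dvd x - m \<longleftrightarrow> x = m mod int c"
        using x by (metis atLeastLessThan_iff mod_eq_dvd_iff mod_pos_pos_trivial)
      then show "f x * (\<Sum>h\<in>{0..<int c}. ec c ((x - m) * h)) = (if x = m mod int c then f x * of_nat c else 0)"
        using sum_ec[OF c, of "x - m"] by simp
    qed
    also have "\<dots> = f (m mod int c) * of_nat c" using c by simp
    also have "f (m mod int c) = f m" by (rule f_cong) (simp add: cong_def)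
    finally show ?thesis by simp
  qed
  define G where "G h = (\<Sum>m\<in>{A<..B}. ec c (- (int h * m)))" for h
  have "of_nat c * (\<Sum>m\<in>{A<..B}. f m) = (\<Sum>m\<in>{A<..B}. \<Sum>h\<in>{0..<int c}. kloosterman c b h * ec c (- (h * m)))"
    by (simp add: sum_distrib_left inv)
  also have "\<dots> = (\<Sum>h\<in>{0..<int c}. kloosterman c b h * (\<Sum>m\<in>{A<..B}. ec c (- (h * m))))"
    by (subst sum.swap) (simp add: sum_distrib_left)
  also have "\<dots> = (\<Sum>h<c. kloosterman c b (int h) * G h)"
    unfolding G_def by (rule sum.reindex_bij_witness[of _ int nat]) auto
  also have "\<dots> = kloosterman c b 0 * G 0 + (\<Sum>h=1..<c. kloosterman c b (int h) * G h)"
    using c by (simp add: lessThan_atLeast0 sum.atLeast_Suc_lessThan)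
  finally have eq: "of_nat c * (\<Sum>m\<in>{A<..B}. f m) = kloosterman c b 0 * G 0 + (\<Sum>h=1..<c. kloosterman c b (int h) * G h)" .
  have G0: "G 0 = of_int (B - A)" using AB by (simp add: G_def)
  define D where "D = real (divisor_count c)"
  have "norm (\<Sum>h=1..<c. kloosterman c b (int h) * G h) \<le> (\<Sum>h=1..<c. (D ^ 3 * sqrt c * gcd h c) * (2 * real c * (1 / real h + 1 / real (c - h))))"
  proof (rule sum_norm_le)
    fix h assume h: "h \<in> {1..<c}"
    have "norm (kloosterman c b (int h)) \<le> D ^ 3 * sqrt c * gcd h c"
      using kloosterman_bound[OF c, of b "int h"] by (simp add: D_def gcd_int_int_eq)
    moreover have "norm (G h) \<le> 2 * real c * (1 / real h + 1 / real (c - h))"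
      unfolding G_def using h AB by (intro geometric_sum_bound) auto
    ultimately show "norm (kloosterman c b (int h) * G h) \<le> (D ^ 3 * sqrt c * gcd h c) * (2 * real c * (1 / real h + 1 / real (c - h)))"
      unfolding norm_mult by (intro mult_mono) (auto simp: D_def)
  qed
  also have "\<dots> = 2 * real c * D ^ 3 * sqrt c * ((\<Sum>h=1..<c. gcd h c / real h) + (\<Sum>h=1..<c. gcd h c / real (c - h)))"
    by (simp add: sum_distrib_left flip: sum.distrib) (intro sum.cong refl, simp add: algebra_simps)
  also have "(\<Sum>h=1..<c. gcd h c / real (c - h)) = (\<Sum>h=1..<c. gcd h c / real h)"
  proof (rule sum.reindex_bij_witness[of _ "\<lambda>h. c - h" "\<lambda>h. c - h"])
    fix h assume "h \<in> {1..<c}"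
    then show "real (gcd (c - h) c) / real (c - h) = real (gcd h c) / real (c - h)"
      by (simp add: gcd_diff2_nat)
  qed auto
  also have "(\<Sum>h=1..<c. gcd h c / real h) \<le> D * (1 + ln c)"
  proof -
    have "(\<Sum>h=1..<c. gcd h c / real h) \<le> (\<Sum>h=1..c. gcd h c / real h)" by (intro sum_mono2) auto
    then show ?thesis using sum_gcd_over_le[OF c] by (simp add: D_def)
  qed
  finally have "norm (\<Sum>h=1..<c. kloosterman c b (int h) * G h) \<le> 2 * real c * D ^ 3 * sqrt c * (D * (1 + ln c) + D * (1 + ln c))"
    by (simp add: D_def mult_left_mono)
  then have 1: "norm (\<Sum>h=1..<c. kloosterman c b (int h) * G h) \<le> c * (4 * (D ^ 4 * sqrt c * (1 + ln c)))"
    by (simp add: algebra_simps power_numeral_reduce)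
  have 2: "norm (kloosterman c b 0 * G 0) \<le> gcd b (int c) * real_of_int (B - A)"
  proof -
    have "norm (G 0) = real_of_int (B - A)" unfolding G0 norm_of_int using AB by simp
    then show ?thesis
      unfolding norm_mult using ramanujan_bound[OF c, of b] AB by (intro mult_mono) auto
  qed
  have "real c * norm (\<Sum>m\<in>{A<..B}. f m) = norm (of_nat c * (\<Sum>m\<in>{A<..B}. f m))" by (simp add: norm_mult)
  also have "\<dots> \<le> gcd b (int c) * real_of_int (B - A) + c * (4 * (D ^ 4 * sqrt c * (1 + ln c)))"
    unfolding eq by (rule order_trans[OF norm_triangle_ineq]) (use 1 2 in linarith)
  finally have "norm (\<Sum>m\<in>{A<..B}. f m) \<le> real_of_int (B - A) * gcd b (int c) / c + 4 * (D ^ 4 * sqrt c * (1 + ln c))"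
    using c by (simp add: field_simps)
  moreover have "(\<Sum>m\<in>{m\<in>{A<..B}. coprime m (int c)}. ec c (b * modular_inverse (int c) m)) = (\<Sum>m\<in>{A<..B}. f m)"
    unfolding f_def by (rule sum.inter_filter) simp
  ultimately show ?thesis by (simp add: D_def)
qed

section \<open>Partial summation, the divisor bound and reciprocity\<close>

lemma abel_summation_bound:
  fixes w g :: "int \<Rightarrow> complex"
  assumes AB: "A \<le> B" and W: "\<And>n. A \<le> n \<Longrightarrow> n \<le> B \<Longrightarrow> norm (\<Sum>m\<in>{A<..n}. w m) \<le> W"
    and g: "\<And>m. norm (g m) \<le> 1"
  shows "norm (\<Sum>m\<in>{A<..B}. w m * g m) \<le> W * (1 + (\<Sum>m\<in>{A<..B}. norm (g m - g (m + 1))))"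
proof -
  define V where "V n = (\<Sum>m\<in>{A<..n}. w m)" for n
  have id: "(\<Sum>m\<in>{A<..B}. w m * g m) = V B * g (B + 1) + (\<Sum>m\<in>{A<..B}. V m * (g m - g (m + 1)))"
    using AB
  proof (induction B rule: int_ge_induct)
    case base
    then show ?case by (simp add: V_def)
  next
    case (step n)
    have "V (n + 1) = V n + w (n + 1)" using step by (simp add: V_def int_interval_Suc)
    then show ?case using step by (simp add: int_interval_Suc) (simp add: algebra_simps)
  qed
  have W0: "W \<ge> 0" using W[of A] AB by simp
  have "norm (\<Sum>m\<in>{A<..B}. w m * g m) \<le> norm (V B * g (B + 1)) + norm (\<Sum>m\<in>{A<..B}. V m * (g m - g (m + 1)))"
    unfolding id by (rule norm_triangle_ineq)
  also have "norm (V B * g (B + 1)) \<le> W * 1"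
    unfolding norm_mult V_def using W[of B] AB g W0 by (intro mult_mono) auto
  also have "norm (\<Sum>m\<in>{A<..B}. V m * (g m - g (m + 1))) \<le> (\<Sum>m\<in>{A<..B}. W * norm (g m - g (m + 1)))"
    unfolding V_def by (intro sum_norm_le) (auto simp: norm_mult intro!: mult_right_mono W)
  finally show ?thesis by (simp add: distrib_left sum_distrib_left)
qed

text \<open>For primes p >= P one has k + 1 <= 2^k <= p^(k \<epsilon>), without loss. Each smaller
  prime costs at most a factor \<open>K\<close>, and there are at most \<open>P\<close> of
  them.\<close>

lemma divisor_count_powr_bound:
  assumes "\<epsilon> > (0::real)"
  shows "\<exists>C\<ge>1. \<forall>n>0. real (divisor_count n) \<le> C * real n powr \<epsilon>"
proof -
  define P where "P = nat \<lceil>2 powr (1 / \<epsilon>)\<rceil>"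
  \<comment> \<open>Chosen so that k + 1 <= K (1 + k \<epsilon> ln 2) <= K 2^(k \<epsilon>).\<close>
  define K where "K = 1 + 1 / (\<epsilon> * ln 2)"
  have K1: "K \<ge> 1" using assms by (simp add: K_def)
  have big: "real (k + 1) \<le> real (p ^ k) powr \<epsilon>" if p: "p \<ge> P" for p k
  proof -
    have "2 powr (1 / \<epsilon>) \<le> real P" unfolding P_def by linarith
    also have "\<dots> \<le> real p" using p by simp
    finally have "(2 powr (1 / \<epsilon>)) powr \<epsilon> \<le> real p powr \<epsilon>" using assms by (intro powr_mono2) auto
    then have "2 \<le> real p powr \<epsilon>" using assms by (simp add: powr_powr)
    then have "2 ^ k \<le> (real p powr \<epsilon>) ^ k" by (intro power_mono) auto
    also have "(real p powr \<epsilon>) ^ k = real (p ^ k) powr \<epsilon>"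
      by (induction k) (auto simp: powr_mult)
    finally have "2 ^ k \<le> real (p ^ k) powr \<epsilon>" .
    moreover have "k + 1 \<le> 2 ^ k" by (induction k) auto
    then have "real (k + 1) \<le> 2 ^ k" by (metis of_nat_le_iff of_nat_numeral of_nat_power)
    ultimately show ?thesis by linarith
  qed
  have small: "real (k + 1) \<le> K * real (p ^ k) powr \<epsilon>" if p: "p \<ge> 2" for p k :: nat
  proof -
    have "real (k + 1) \<le> K * (1 + k * (\<epsilon> * ln 2))"
    proof -
      have "K * (k * (\<epsilon> * ln 2)) = k * (\<epsilon> * ln 2) + k" using assms by (simp add: K_def field_simps)
      moreover have "0 \<le> k * (\<epsilon> * ln 2)" using assms by simp
      ultimately show ?thesis using K1 by (simp add: distrib_left)
    qed
    also have "\<dots> \<le> K * exp (k * (\<epsilon> * ln 2))" using K1 by (intro mult_left_mono exp_ge_add_one_self) auto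
    also have "exp (k * (\<epsilon> * ln 2)) = (2 ^ k) powr \<epsilon>" by (simp add: powr_def ln_realpow mult_ac)
    also have "K * (2 ^ k) powr \<epsilon> \<le> K * real (p ^ k) powr \<epsilon>"
      using K1 assms p by (intro mult_left_mono powr_mono2) (auto simp: power_mono)
    finally show ?thesis .
  qed
  have main: "real (divisor_count n) \<le> K ^ card {p \<in> prime_factors n. p < P} * real n powr \<epsilon>" if "n > 0" for n
    using that
  proof (induction n rule: prime_power_coprime_induct)
    case (prime_power p k m)
    have p2: "p \<ge> 2" using prime_power prime_ge_2_nat by blast
    have pf: "prime_factors (p ^ k * m) = insert p (prime_factors m)"
      using prime_power p2 by (subst prime_factors_product) (auto simp: prime_factors_power prime_prime_factors)
    have "p \<notin> prime_factors m" using prime_power by (metis coprime_absorb_left in_prime_factors_iff not_prime_unit)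
    then have card: "card {q \<in> prime_factors (p ^ k * m). q < P} = card {q \<in> prime_factors m. q < P} + (if p < P then 1 else 0)"
    proof -
      have "{q \<in> prime_factors (p ^ k * m). q < P} = (if p < P then insert p {q \<in> prime_factors m. q < P} else {q \<in> prime_factors m. q < P})"
        unfolding pf by auto
      then show ?thesis using \<open>p \<notin> prime_factors m\<close> by simp
    qed
    have k1: "real (k + 1) \<le> K ^ (if p < P then 1 else 0) * real (p ^ k) powr \<epsilon>"
      using big[of p k] small[OF p2, of k] by auto
    have "real (divisor_count (p ^ k * m)) \<le> real ((k + 1) * divisor_count m)"
      using divisor_count_prime_power_le[of p m k] prime_power by (intro of_nat_mono) auto
    also have "\<dots> = real (k + 1) * real (divisor_count m)" by (simp only: of_nat_mult)
    also have "\<dots> \<le> (K ^ (if p < P then 1 else 0) * real (p ^ k) powr \<epsilon>) * (K ^ card {p \<in> prime_factors m. p < P} * real m powr \<epsilon>)"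
      using k1 prime_power.IH K1 by (intro mult_mono) auto
    also have "\<dots> = K ^ card {q \<in> prime_factors (p ^ k * m). q < P} * real (p ^ k * m) powr \<epsilon>"
      unfolding card by (simp add: power_add powr_mult mult_ac)
    finally show ?case .
  qed simp
  have "real (divisor_count n) \<le> K ^ P * real n powr \<epsilon>" if "n > 0" for n
  proof -
    have "card {p \<in> prime_factors n. p < P} \<le> card {..<P}" by (intro card_mono) auto
    then have "K ^ card {p \<in> prime_factors n. p < P} \<le> K ^ P" using K1 by (intro power_increasing) auto
    then show ?thesis using main[OF that] by (meson mult_right_mono order_trans powr_ge_zero)
  qed
  moreover have "K ^ P \<ge> 1" using K1 by (rule one_le_power)
  ultimately show ?thesis by blast
qed

text \<open>If n' inverts n modulo m and m' inverts m modulo n, then n n' + m m' is 1 modulo m n;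
  division by m n gives the identity up to an integer. The variable of the outer sum moves from the
  modulus into the argument of an inverse to a fixed modulus.\<close>

lemma kloosterman_reciprocity:
  assumes "m > 0" "n > 0" "coprime m n"
  shows "ec m (t * modular_inverse (int m) (int n))
    = ec n (- t * modular_inverse (int n) (int m)) * e (real_of_int t / (real m * real n))"
proof -
  define i where "i = modular_inverse (int m) (int n)"
  define j where "j = modular_inverse (int n) (int m)"
  have cop: "coprime (int m) (int n)" "coprime (int n) (int m)" using assms(3) by (simp_all add: coprime_commute)
  have "[int n * i + int m * j = 1 + 0] (mod int m)"
    unfolding i_def using cong_modular_inverse1[OF cop(2)] by (intro cong_add) (auto simp: cong_0_iff)
  moreover have "[int n * i + int m * j = 0 + 1] (mod int n)"
    unfolding j_def using cong_modular_inverse1[OF cop(1)] by (intro cong_add) (auto simp: cong_0_iff)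
  ultimately have "[int n * i + int m * j = 1] (mod (int m * int n))" using cop by (simp add: coprime_cong_mult)
  then obtain s where s: "int n * i + int m * j = 1 + int m * int n * s"
    using cong_iff_lin cong_sym by metis
  have eq: "real n * real_of_int i + real m * real_of_int j = 1 + real m * real n * real_of_int s"
    using arg_cong[OF s, of real_of_int] by simp
  have "real_of_int i / real m + real_of_int j / real n
      = (real n * real_of_int i + real m * real_of_int j) / (real m * real n)"
    using assms by (simp add: add_divide_distrib)
  also have "\<dots> = 1 / (real m * real n) + real_of_int s"
    unfolding eq using assms by (simp add: add_divide_distrib)
  finally have "real_of_int i / real m = 1 / (real m * real n) + real_of_int s - real_of_int j / real n" by linarith
  then have "real_of_int t * (real_of_int i / real m) = real_of_int t * (1 / (real m * real n) + real_of_int s - real_of_int j / real n)"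
    by (rule arg_cong)
  then have "real_of_int (t * i) / real m = real_of_int (- t * j) / real n + real_of_int t / (real m * real n) + real_of_int (t * s)"
    by (simp add: algebra_simps)
  then show ?thesis unfolding ec_def i_def[symmetric] j_def[symmetric] by (simp only: e_add e_int mult_1_right)
qed

text \<open>k' times the inverse of k k' l is an inverse of k l, and k times it is one of k' l. So
  the two phases combine into one fraction, to which reciprocity applies.\<close>

lemma kloosterman_fraction_difference:
  fixes a :: int and k k' l m :: nat
  assumes m: "m > 0" and k: "k > 0" "k' > 0" "l > 0" and cop: "coprime (k * l) m" "coprime (k' * l) m"
  defines "t \<equiv> a * (int k' - int k)" and "c \<equiv> k * k' * l"
  shows "ec m (a * modular_inverse (int m) (int (k * l))) * cnj (ec m (a * modular_inverse (int m) (int (k' * l))))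
    = ec c (- t * modular_inverse (int c) (int m)) * e (real_of_int t / (real m * real c))"
proof -
  have copc: "coprime c m" using cop by (simp add: c_def)
  define y where "y = modular_inverse (int m) (int c)"
  have y: "[int c * y = 1] (mod int m)" unfolding y_def using copc by (intro cong_modular_inverse1) simp
  have "[int (k * l) * (int k' * y) = 1] (mod int m)" using y by (simp add: c_def mult_ac)
  from ec_modular_inverse[OF this, of a 0]
  have 1: "ec m (a * modular_inverse (int m) (int (k * l))) = ec m (a * (int k' * y))" by simp
  have "[int (k' * l) * (int k * y) = 1] (mod int m)" using y by (simp add: c_def mult_ac)
  from ec_modular_inverse[OF this, of "- a" 0]
  have 2: "cnj (ec m (a * modular_inverse (int m) (int (k' * l)))) = ec m (- a * (int k * y))" by (simp add: cnj_ec)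
  have "ec m (a * (int k' * y)) * ec m (- a * (int k * y)) = ec m (t * y)"
    by (simp add: t_def algebra_simps flip: ec_add)
  also have "\<dots> = ec c (- t * modular_inverse (int c) (int m)) * e (real_of_int t / (real m * real c))"
    unfolding y_def using m k copc by (intro kloosterman_reciprocity) (auto simp: c_def coprime_commute)
  finally show ?thesis unfolding 1 2 .
qed

lemma nat_interval_to_int:
  assumes "M \<ge> 0"
  shows "bij_betw int {m. M < real m \<and> real m \<le> 2 * M} {\<lfloor>M\<rfloor><..\<lfloor>2 * M\<rfloor>}"
proof (rule bij_betwI[where g = nat])
  show "int \<in> {m. M < real m \<and> real m \<le> 2 * M} \<rightarrow> {\<lfloor>M\<rfloor><..\<lfloor>2 * M\<rfloor>}"
    by (auto simp: floor_less_iff le_floor_iff)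
  show "nat \<in> {\<lfloor>M\<rfloor><..\<lfloor>2 * M\<rfloor>} \<rightarrow> {m. M < real m \<and> real m \<le> 2 * M}"
  proof
    fix i assume i: "i \<in> {\<lfloor>M\<rfloor><..\<lfloor>2 * M\<rfloor>}"
    have "0 \<le> \<lfloor>M\<rfloor>" using assms by simp
    then have "i > 0" using i unfolding greaterThanAtMost_iff by linarith
    moreover have "M < real_of_int i" "real_of_int i \<le> 2 * M" using i by (auto simp: floor_less_iff le_floor_iff)
    ultimately show "nat i \<in> {m. M < real m \<and> real m \<le> 2 * M}" by simp
  qed
  show "int (nat i) = i" if "i \<in> {\<lfloor>M\<rfloor><..\<lfloor>2 * M\<rfloor>}" for i
  proof -
    have "0 \<le> \<lfloor>M\<rfloor>" using assms by simp
    then show ?thesis using that unfolding greaterThanAtMost_iff by linarith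
  qed
qed auto

lemma dyadic_interval:
  assumes "M \<ge> 2"
  shows "finite {m. M < real m \<and> real m \<le> 2 * M}" "real (card {m. M < real m \<and> real m \<le> 2 * M}) \<le> 2 * M"
proof -
  have b: "bij_betw int {m. M < real m \<and> real m \<le> 2 * M} {\<lfloor>M\<rfloor><..\<lfloor>2 * M\<rfloor>}"
    using assms by (intro nat_interval_to_int) simp
  show "finite {m. M < real m \<and> real m \<le> 2 * M}" using bij_betw_finite[OF b] by simp
  have "card {m. M < real m \<and> real m \<le> 2 * M} = nat (\<lfloor>2 * M\<rfloor> - \<lfloor>M\<rfloor>)" using bij_betw_same_card[OF b] by simp
  moreover have "\<lfloor>M\<rfloor> \<le> \<lfloor>2 * M\<rfloor>" using assms by (intro floor_mono) simp
  ultimately have "real (card {m. M < real m \<and> real m \<le> 2 * M}) = real_of_int \<lfloor>2 * M\<rfloor> - real_of_int \<lfloor>M\<rfloor>" by simp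
  also have "\<dots> \<le> 2 * M" using assms by linarith
  finally show "real (card {m. M < real m \<and> real m \<le> 2 * M}) \<le> 2 * M" .
qed

lemma twisted_incomplete_bound:
  fixes c :: nat and t :: int and M :: real
  assumes M: "M \<ge> 2" and c: "c > 0"
  shows "norm (\<Sum>m\<in>{m. (M < real m \<and> real m \<le> 2 * M) \<and> coprime m c}.
      ec c (- t * modular_inverse (int c) (int m)) * e (real_of_int t / (real m * real c)))
    \<le> (1 + 2 * pi * \<bar>real_of_int t\<bar> / (real c * M)) *
      (2 * M * gcd t (int c) / c + 4 * (real (divisor_count c) ^ 4 * sqrt c * (1 + ln c)))"
proof -
  define A where "A = \<lfloor>M\<rfloor>"
  define B where "B = \<lfloor>2 * M\<rfloor>"
  have AB: "A \<le> B" unfolding A_def B_def using M by (intro floor_mono) simp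
  have A0: "A \<ge> 2" using M by (simp add: A_def le_floor_iff)
  have A1: "real_of_int (A + 1) \<ge> M" unfolding A_def by linarith
  have BA: "real_of_int (B - A) \<le> 2 * M" unfolding A_def B_def using M by (simp add: of_int_diff) linarith
  define w where "w m = (if coprime m (int c) then ec c (- t * modular_inverse (int c) m) else 0)" for m
  define g where "g m = e (real_of_int t / (real_of_int m * real c))" for m
  define W where "W = 2 * M * gcd t (int c) / c + 4 * (real (divisor_count c) ^ 4 * sqrt c * (1 + ln c))"
  have lnc: "ln (real c) \<ge> 0" using c by simp
  have "(\<Sum>m\<in>{m. (M < real m \<and> real m \<le> 2 * M) \<and> coprime m c}.
      ec c (- t * modular_inverse (int c) (int m)) * e (real_of_int t / (real m * real c)))
    = (\<Sum>m\<in>{m \<in> {m. M < real m \<and> real m \<le> 2 * M}. coprime m c}. ec c (- t * modular_inverse (int c) (int m)) * g (int m))"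
    by (simp add: g_def)
  also have "\<dots> = (\<Sum>m\<in>{m. M < real m \<and> real m \<le> 2 * M}. w (int m) * g (int m))"
    using dyadic_interval(1)[OF M] unfolding w_def by (subst sum.inter_filter) (auto intro!: sum.cong)
  also have "\<dots> = (\<Sum>m\<in>{A<..B}. w m * g m)"
    unfolding A_def B_def using M by (intro sum.reindex_bij_betw nat_interval_to_int) simp
  finally have eq: "(\<Sum>m\<in>{m. (M < real m \<and> real m \<le> 2 * M) \<and> coprime m c}.
      ec c (- t * modular_inverse (int c) (int m)) * e (real_of_int t / (real m * real c))) = (\<Sum>m\<in>{A<..B}. w m * g m)" .
  have W: "norm (\<Sum>m\<in>{A<..n}. w m) \<le> W" if n: "A \<le> n" "n \<le> B" for n
  proof -
    have "(\<Sum>m\<in>{A<..n}. w m) = (\<Sum>m\<in>{m\<in>{A<..n}. coprime m (int c)}. ec c (- t * modular_inverse (int c) m))"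
      unfolding w_def by (rule sum.inter_filter[symmetric]) simp
    then have "norm (\<Sum>m\<in>{A<..n}. w m) \<le> real_of_int (n - A) * gcd (- t) (int c) / c + 4 * (real (divisor_count c) ^ 4 * sqrt c * (1 + ln c))"
      using incomplete_kloosterman_bound[OF c n(1), of "- t"] by simp
    also have "real_of_int (n - A) * gcd (- t) (int c) / c \<le> 2 * M * gcd t (int c) / c"
    proof -
      have "real_of_int (n - A) \<le> real_of_int (B - A)" using n by simp
      then have "real_of_int (n - A) \<le> 2 * M" using BA by linarith
      then show ?thesis using c by (simp add: divide_right_mono mult_right_mono)
    qed
    finally show ?thesis by (simp add: W_def)
  qed
  have W0: "W \<ge> 0" using W[OF order_refl AB] by simp
  have g1: "norm (g m) \<le> 1" for m unfolding g_def by simp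
  have "norm (\<Sum>m\<in>{A<..B}. w m * g m) \<le> W * (1 + (\<Sum>m\<in>{A<..B}. norm (g m - g (m + 1))))"
    by (rule abel_summation_bound[OF AB W g1])
  also have "\<dots> \<le> W * (1 + 2 * pi * \<bar>real_of_int t\<bar> / (real c * M))"
  proof (intro mult_left_mono add_left_mono W0)
    \<comment> \<open>The variation of the twist between m and m + 1 is at most T / m - T / (m + 1),
      which telescopes to at most T / M.\<close>
    define T where "T = 2 * pi * \<bar>real_of_int t\<bar> / real c"
    have T0: "T \<ge> 0" by (simp add: T_def)
    have "(\<Sum>m\<in>{A<..B}. norm (g m - g (m + 1))) \<le> (\<Sum>m\<in>{A<..B}. T / real_of_int m - T / real_of_int (m + 1))"
    proof (intro sum_mono)
      fix m assume "m \<in> {A<..B}"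
      then have m: "m > 0" using A0 by simp
      have "norm (g m - g (m + 1)) \<le> 2 * pi * \<bar>real_of_int t / (real_of_int m * real c) - real_of_int t / (real_of_int (m + 1) * real c)\<bar>"
        unfolding g_def by (rule norm_e_diff_le)
      also have "real_of_int t / (real_of_int m * real c) - real_of_int t / (real_of_int (m + 1) * real c)
          = (real_of_int t / real c) * (1 / real_of_int m - 1 / real_of_int (m + 1))"
        by (simp add: algebra_simps)
      also have "\<bar>\<dots>\<bar> = (\<bar>real_of_int t\<bar> / real c) * (1 / real_of_int m - 1 / real_of_int (m + 1))"
        using m by (simp add: abs_mult divide_left_mono)
      finally show "norm (g m - g (m + 1)) \<le> T / real_of_int m - T / real_of_int (m + 1)"
        by (simp add: T_def algebra_simps)
    qed
    also have "\<dots> = T / real_of_int (A + 1) - T / real_of_int (B + 1)" using AB by (rule sum_telescope_int)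
    also have "\<dots> \<le> T / real_of_int (A + 1)" using T0 A0 AB by simp
    also have "\<dots> \<le> T / M" using T0 A1 M by (intro divide_left_mono) auto
    finally show "(\<Sum>m\<in>{A<..B}. norm (g m - g (m + 1))) \<le> 2 * pi * \<bar>real_of_int t\<bar> / (real c * M)"
      by (simp add: T_def)
  qed
  finally show ?thesis unfolding eq W_def by (simp add: mult.commute)
qed

section \<open>The bilinear form\<close>

lemma gcd_mult_dvd_gcd: "gcd a (b * c) dvd gcd a b * gcd a (c::nat)"
proof -
  have 1: "gcd a (b * c) dvd gcd a b * a" by (intro dvd_mult gcd_dvd1)
  have 2: "gcd a (b * c) dvd c * a" by (intro dvd_mult gcd_dvd1)
  have 3: "gcd a (b * c) dvd c * b" using gcd_dvd2[of a "b * c"] by (simp only: mult.commute[of c b])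
  have 4: "gcd a (b * c) dvd gcd a b * c"
    using gcd_greatest[OF 2 3] gcd_mult_distrib_nat[of c a b] by (simp only: mult.commute[of "gcd a b" c])
  have "gcd a (b * c) dvd gcd (gcd a b * a) (gcd a b * c)" using 1 4 by (rule gcd_greatest)
  then show ?thesis using gcd_mult_distrib_nat[of "gcd a b" a c] by metis
qed

text \<open>Applied with \<alpha> = |a| and \<delta> = |k' - k|: the difference is given up at its
  full size, after which each remaining gcd couples \<open>a\<close> to a single variable and can be
  averaged separately.\<close>

lemma gcd_difference_le:
  fixes \<alpha> \<delta> k k' l :: nat
  assumes "\<alpha> > 0" "\<delta> > 0"
  shows "gcd (\<alpha> * \<delta>) (k * k' * l) \<le> \<delta> * (gcd \<alpha> k * gcd \<alpha> k' * gcd \<alpha> l)"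
proof -
  have "gcd (\<alpha> * \<delta>) (k * k' * l) dvd gcd (\<alpha> * \<delta>) (k * k' * l * \<delta>)" by (intro gcd_greatest) auto
  also have "gcd (\<alpha> * \<delta>) (k * k' * l * \<delta>) = \<delta> * gcd \<alpha> (k * k' * l)"
    using gcd_mult_distrib_nat[of \<delta> \<alpha> "k * k' * l"] by (simp add: mult_ac)
  also have "\<dots> dvd \<delta> * (gcd \<alpha> (k * k') * gcd \<alpha> l)" by (intro mult_dvd_mono gcd_mult_dvd_gcd) auto
  also have "\<dots> dvd \<delta> * (gcd \<alpha> k * gcd \<alpha> k' * gcd \<alpha> l)" by (intro mult_dvd_mono gcd_mult_dvd_gcd) auto
  finally show ?thesis using assms by (intro dvd_imp_le) auto
qed

lemma sum_gcd_le:
  fixes n \<alpha> :: nat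
  assumes "\<alpha> > 0"
  shows "(\<Sum>k=1..n. real (gcd k \<alpha>)) \<le> divisor_count \<alpha> * n"
proof -
  have "(\<Sum>k=1..n. real (gcd k \<alpha>)) \<le> (\<Sum>k=1..n. \<Sum>d | d dvd \<alpha>. if d dvd k then real d else 0)"
    using assms by (intro sum_mono gcd_le_sum_divisors)
  also have "\<dots> = (\<Sum>d | d dvd \<alpha>. \<Sum>k=1..n. if d dvd k then real d else 0)" by (rule sum.swap)
  also have "\<dots> \<le> (\<Sum>d | d dvd \<alpha>. real n)"
  proof (intro sum_mono)
    fix d assume "d \<in> {d. d dvd \<alpha>}"
    then have d: "d > 0" using assms by (auto intro: dvd_pos_nat)
    have "{k \<in> {1..n}. d dvd k} \<subseteq> (\<lambda>j. d * j) ` {1..n div d}"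
    proof
      fix k assume "k \<in> {k \<in> {1..n}. d dvd k}"
      then obtain j where j: "k = d * j" "1 \<le> k" "k \<le> n" by auto
      then have "j \<le> n div d" using d by (metis div_le_mono nonzero_mult_div_cancel_left not_gr_zero)
      moreover have "j \<ge> 1" using j by (cases j) auto
      ultimately show "k \<in> (\<lambda>j. d * j) ` {1..n div d}" using j by auto
    qed
    then have "card {k \<in> {1..n}. d dvd k} \<le> card {1..n div d}"
      by (meson card_image_le card_mono finite_atLeastAtMost finite_imageI le_trans)
    then have "d * card {k \<in> {1..n}. d dvd k} \<le> d * (n div d)" by simp
    also have "\<dots> \<le> n" by simp
    finally have "real d * real (card {k \<in> {1..n}. d dvd k}) \<le> real n" by (metis of_nat_le_iff of_nat_mult)
    moreover have "(\<Sum>k=1..n. if d dvd k then real d else 0) = real d * real (card {k \<in> {1..n}. d dvd k})"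
      by (subst sum.inter_filter[symmetric]) auto
    ultimately show "(\<Sum>k=1..n. if d dvd k then real d else 0) \<le> real n" by simp
  qed
  finally show ?thesis by (simp add: divisor_count_def)
qed

text \<open>Cauchy-Schwarz over the at most 2 M moduli m, after which the square is opened. The
  range Y / 2 <= k < Y gives c >= Y^2 l / 4 against |t| <= |a| Y / 2, so one factor covers the
  twists of all pairs. \<open>E\<close> collects the divisor counts and logarithms of the c that
  occur. Of the 10, the pairs of distinct k account for 8 and the diagonal for 2.\<close>

lemma bilinear_row_bound:
  fixes M Y E :: real and a :: int and l :: nat and Ks :: "nat set"
  assumes M: "M \<ge> 2" and a: "a \<noteq> 0" and l: "l > 0" and Y: "Y > 0"
    and Ks: "\<And>k. k \<in> Ks \<Longrightarrow> k > 0 \<and> Y / 2 \<le> real k \<and> real k < Y"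
    and E: "\<And>c. c > 0 \<Longrightarrow> real c \<le> Y\<^sup>2 * real l \<Longrightarrow> 4 * (real (divisor_count c) ^ 4 * (1 + ln (real c))) \<le> E"
    and E0: "E \<ge> 0"
  shows "(\<Sum>m | M < real m \<and> real m \<le> 2 * M.
      norm (\<Sum>k | k \<in> Ks \<and> coprime (k * l) m. ec m (a * modular_inverse (int m) (int (k * l)))))\<^sup>2
    \<le> 2 * M * (1 + 4 * pi * \<bar>real_of_int a\<bar> / (l * Y * M)) *
      (10 * (real (divisor_count (nat \<bar>a\<bar>)))\<^sup>2 * M * Y + E * Y ^ 3 * sqrt l)"
proof -
  define Ms where "Ms = {m::nat. M < real m \<and> real m \<le> 2 * M}"
  have finMs: "finite Ms" and cardMs: "real (card Ms) \<le> 2 * M" using dyadic_interval[OF M] by (auto simp: Ms_def)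
  have Ms0: "m > 0" if "m \<in> Ms" for m using that M by (auto simp: Ms_def intro!: Nat.gr0I)
  define \<phi> where "\<phi> m k = (if coprime (k * l) m then ec m (a * modular_inverse (int m) (int (k * l))) else 0)" for m k
  define F where "F m = (\<Sum>k\<in>Ks. \<phi> m k)" for m
  define N where "N = nat \<lfloor>Y\<rfloor>"
  have N: "real N \<le> Y" unfolding N_def using Y by simp
  have Ks_sub: "Ks \<subseteq> {1..N}"
  proof
    fix k assume "k \<in> Ks"
    then have "k > 0" "real k < Y" using Ks by auto
    then show "k \<in> {1..N}" unfolding N_def by (auto simp: le_nat_floor)
  qed
  have finKs: "finite Ks" using Ks_sub finite_subset by blast
  have cardKs: "real (card Ks) \<le> Y" using card_mono[OF _ Ks_sub] N by simp
  define \<alpha> where "\<alpha> = nat \<bar>a\<bar>"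
  have \<alpha>: "\<alpha> > 0" "\<bar>real_of_int a\<bar> = real \<alpha>" using a by (auto simp: \<alpha>_def)
  define R where "R = 1 + 4 * pi * real \<alpha> / (l * Y * M)"
  have R1: "R \<ge> 1" unfolding R_def using M Y by simp
  define D where "D = real (divisor_count \<alpha>)"
  have D1: "D \<ge> 1" using divisor_count_pos[OF \<alpha>(1)] by (simp add: D_def)
  define P where "P k k' = norm (\<Sum>m\<in>Ms. \<phi> m k * cnj (\<phi> m k'))" for k k'
  have diag: "P k k \<le> 2 * M" for k
  proof -
    have "P k k \<le> (\<Sum>m\<in>Ms. 1)" unfolding P_def
      by (rule sum_norm_le) (auto simp: \<phi>_def norm_mult)
    then show ?thesis using cardMs by simp
  qed
  have offdiag: "P k k' \<le> R * (8 * M * (real (gcd k \<alpha>) * real (gcd k' \<alpha>)) / Y + E * Y * sqrt l)"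
    if k: "k \<in> Ks" "k' \<in> Ks" "k \<noteq> k'" for k k'
  proof -
    define t where "t = a * (int k' - int k)"
    define c where "c = k * k' * l"
    define \<delta> where "\<delta> = nat \<bar>int k' - int k\<bar>"
    have kp: "k > 0" "k' > 0" using k Ks by auto
    have c0: "c > 0" using kp l by (simp add: c_def)
    have \<delta>: "\<delta> > 0" using k(3) by (auto simp: \<delta>_def)
    have \<delta>real: "real \<delta> = \<bar>real k' - real k\<bar>" by (simp add: \<delta>_def)
    have \<delta>Y: "real \<delta> \<le> Y / 2" unfolding \<delta>real using Ks[OF k(1)] Ks[OF k(2)] by (simp add: abs_if)
    have tabs: "\<bar>real_of_int t\<bar> = real \<alpha> * real \<delta>" by (simp add: t_def \<alpha>(2)[symmetric] \<delta>real abs_mult)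
    have kk: "real k * real k' \<ge> (Y / 2) * (Y / 2)" using Ks[OF k(1)] Ks[OF k(2)] Y by (intro mult_mono) auto
    have c_low: "real c \<ge> Y * Y / 4 * real l" using mult_right_mono[OF kk, of "real l"] by (simp add: c_def)
    have "real k * real k' \<le> Y * Y" using Ks[OF k(1)] Ks[OF k(2)] Y by (intro mult_mono) auto
    from mult_right_mono[OF this, of "real l"]
    have c_up: "real c \<le> Y\<^sup>2 * real l" by (simp add: c_def power2_eq_square)
    have "P k k' = norm (\<Sum>m\<in>{m. (M < real m \<and> real m \<le> 2 * M) \<and> coprime m c}.
        ec c (- t * modular_inverse (int c) (int m)) * e (real_of_int t / (real m * real c)))"
    proof -
      have "(\<Sum>m\<in>Ms. \<phi> m k * cnj (\<phi> m k')) = (\<Sum>m\<in>Ms. if coprime m c then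
          ec c (- t * modular_inverse (int c) (int m)) * e (real_of_int t / (real m * real c)) else 0)"
      proof (intro sum.cong refl)
        fix m assume m: "m \<in> Ms"
        have iff: "coprime m c \<longleftrightarrow> coprime (k * l) m \<and> coprime (k' * l) m"
          by (auto simp: c_def coprime_commute)
        show "\<phi> m k * cnj (\<phi> m k') = (if coprime m c then
          ec c (- t * modular_inverse (int c) (int m)) * e (real_of_int t / (real m * real c)) else 0)"
        proof (cases "coprime m c")
          case True
          then show ?thesis
            using kloosterman_fraction_difference[OF Ms0[OF m] kp l, of a] iff
            unfolding \<phi>_def t_def c_def by simp
        next
          case False
          then show ?thesis using iff by (auto simp: \<phi>_def)
        qed
      qed
      also have "\<dots> = (\<Sum>m\<in>{m \<in> Ms. coprime m c}.
          ec c (- t * modular_inverse (int c) (int m)) * e (real_of_int t / (real m * real c)))"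
        by (rule sum.inter_filter[symmetric, OF finMs])
      finally show ?thesis by (simp add: P_def Ms_def)
    qed
    also have "\<dots> \<le> (1 + 2 * pi * \<bar>real_of_int t\<bar> / (real c * M)) *
      (2 * M * gcd t (int c) / c + 4 * (real (divisor_count c) ^ 4 * sqrt c * (1 + ln c)))"
      by (rule twisted_incomplete_bound[OF M c0])
    also have "\<dots> \<le> R * (8 * M * (real (gcd k \<alpha>) * real (gcd k' \<alpha>)) / Y + E * Y * sqrt l)"
    proof -
      have "2 * pi * \<bar>real_of_int t\<bar> / (real c * M) \<le> 2 * pi * (real \<alpha> * (Y / 2)) / (Y * Y / 4 * real l * M)"
        unfolding tabs using c_low \<delta>Y Y l M c0
        by (intro frac_le mult_mono mult_left_mono mult_nonneg_nonneg mult_pos_pos) auto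
      also have "\<dots> = 4 * pi * real \<alpha> / (l * Y * M)" using Y l M by (simp add: field_simps)
      finally have 1: "1 + 2 * pi * \<bar>real_of_int t\<bar> / (real c * M) \<le> R" by (simp add: R_def)
      have "gcd t (int c) = int (gcd (\<alpha> * \<delta>) c)"
        by (simp add: gcd_int_def t_def \<alpha>_def \<delta>_def abs_mult nat_mult_distrib)
      then have "real_of_int (gcd t (int c)) = real (gcd (\<alpha> * \<delta>) c)" by simp
      also have "\<dots> \<le> real (\<delta> * (gcd \<alpha> k * gcd \<alpha> k' * gcd \<alpha> l))"
        unfolding c_def using gcd_difference_le[OF \<alpha>(1) \<delta>] by (rule of_nat_mono)
      \<comment> \<open>The gcd with \<open>l\<close> is estimated by \<open>l\<close>, which
        cancels against the \<open>l\<close> in the lower bound for \<open>c\<close>. Those with k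
        and k' are kept, since on average they cost only a divisor count of |a|.\<close>
      also have "\<dots> \<le> Y * (real (gcd k \<alpha>) * real (gcd k' \<alpha>) * real l)"
        unfolding of_nat_mult using \<delta>Y Y l
        by (intro mult_mono mult_nonneg_nonneg) (auto simp: gcd.commute dvd_imp_le)
      finally have g: "real_of_int (gcd t (int c)) \<le> Y * (real (gcd k \<alpha>) * real (gcd k' \<alpha>) * real l)" .
      have "2 * M * gcd t (int c) / c \<le> 2 * M * (Y * (real (gcd k \<alpha>) * real (gcd k' \<alpha>) * real l)) / (Y * Y / 4 * real l)"
        using g c_low Y l M c0 by (intro frac_le mult_left_mono mult_nonneg_nonneg mult_pos_pos) auto
      also have "\<dots> = 8 * M * (real (gcd k \<alpha>) * real (gcd k' \<alpha>)) / Y" using Y l by (simp add: field_simps)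
      finally have 2: "2 * M * gcd t (int c) / c \<le> 8 * M * (real (gcd k \<alpha>) * real (gcd k' \<alpha>)) / Y" .
      have "sqrt c \<le> sqrt (Y\<^sup>2 * real l)" using c_up by simp
      then have sq: "sqrt c \<le> Y * sqrt l" using Y by (simp add: real_sqrt_mult)
      have "4 * (real (divisor_count c) ^ 4 * sqrt c * (1 + ln c)) = 4 * (real (divisor_count c) ^ 4 * (1 + ln c)) * sqrt c"
        by simp
      also have "\<dots> \<le> E * (Y * sqrt l)" using E[OF c0 c_up] sq E0 by (intro mult_mono) auto
      finally have 3: "4 * (real (divisor_count c) ^ 4 * sqrt c * (1 + ln c)) \<le> E * Y * sqrt l" by simp
      have "ln (real c) \<ge> 0" using c0 by simp
      then have 4: "0 \<le> 2 * M * gcd t (int c) / c + 4 * (real (divisor_count c) ^ 4 * sqrt c * (1 + ln c))" using M by simp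
      have "0 \<le> R" using R1 by simp
      from mult_mono[OF 1 add_mono[OF 2 3] this 4] show ?thesis .
    qed
    finally show ?thesis .
  qed
  have sumg: "(\<Sum>k\<in>Ks. real (gcd k \<alpha>)) \<le> D * Y"
  proof -
    have "(\<Sum>k\<in>Ks. real (gcd k \<alpha>)) \<le> (\<Sum>k=1..N. real (gcd k \<alpha>))" using Ks_sub by (intro sum_mono2) auto
    also have "\<dots> \<le> D * N" using sum_gcd_le[OF \<alpha>(1), of N] by (simp add: D_def)
    also have "\<dots> \<le> D * Y" using N D1 by (intro mult_left_mono) auto
    finally show ?thesis .
  qed
  have "(\<Sum>k\<in>Ks. \<Sum>k'\<in>Ks. P k k') \<le> (\<Sum>k\<in>Ks. \<Sum>k'\<in>Ks. (if k = k' then 2 * M else 0)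
      + R * (8 * M * (real (gcd k \<alpha>) * real (gcd k' \<alpha>)) / Y + E * Y * sqrt l))"
  proof (intro sum_mono)
    fix k k' assume kk: "k \<in> Ks" "k' \<in> Ks"
    have "0 \<le> R * (8 * M * (real (gcd k \<alpha>) * real (gcd k' \<alpha>)) / Y + E * Y * sqrt l)"
      using R1 M Y E0 by (intro mult_nonneg_nonneg add_nonneg_nonneg divide_nonneg_nonneg) auto
    then show "P k k' \<le> (if k = k' then 2 * M else 0) + R * (8 * M * (real (gcd k \<alpha>) * real (gcd k' \<alpha>)) / Y + E * Y * sqrt l)"
      using diag[of k] offdiag[OF kk] by (cases "k = k'") auto
  qed
  also have "\<dots> = 2 * M * card Ks + R * (8 * M / Y * ((\<Sum>k\<in>Ks. real (gcd k \<alpha>)) * (\<Sum>k\<in>Ks. real (gcd k \<alpha>))) + E * Y * sqrt l * (card Ks * card Ks))"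
  proof -
    have "(\<Sum>k\<in>Ks. \<Sum>k'\<in>Ks. R * (8 * M * (real (gcd k \<alpha>) * real (gcd k' \<alpha>)) / Y + E * Y * sqrt l))
      = R * ((\<Sum>k\<in>Ks. \<Sum>k'\<in>Ks. 8 * M / Y * (real (gcd k \<alpha>) * real (gcd k' \<alpha>))) + (\<Sum>k\<in>Ks. \<Sum>k'\<in>Ks. E * Y * sqrt l))"
      unfolding sum.distrib[symmetric] sum_distrib_left by (intro sum.cong refl) simp
    also have "(\<Sum>k\<in>Ks. \<Sum>k'\<in>Ks. 8 * M / Y * (real (gcd k \<alpha>) * real (gcd k' \<alpha>))) = 8 * M / Y * ((\<Sum>k\<in>Ks. real (gcd k \<alpha>)) * (\<Sum>k\<in>Ks. real (gcd k \<alpha>)))"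
      unfolding sum_product by (simp only: sum_distrib_left)
    finally show ?thesis using finKs by (simp add: sum.distrib mult_ac)
  qed
  also have "\<dots> \<le> 2 * M * Y + R * (8 * M / Y * ((D * Y) * (D * Y)) + E * Y * sqrt l * (Y * Y))"
  proof -
    have "real (card Ks) * real (card Ks) \<le> Y * Y" using cardKs Y by (intro mult_mono) auto
    then show ?thesis using M R1 Y E0 cardKs sumg D1
      by (intro add_mono mult_mono mult_left_mono mult_nonneg_nonneg sum_nonneg) auto
  qed
  also have "\<dots> = 1 * 1 * (2 * M * Y) + R * (8 * D\<^sup>2 * M * Y + E * Y ^ 3 * sqrt l)"
    using Y by (simp add: power2_eq_square power3_eq_cube field_simps)
  \<comment> \<open>The diagonal is enlarged to the shape of the off-diagonal main term and merged
    with it.\<close>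
  also have "1 * 1 * (2 * M * Y) \<le> R * D\<^sup>2 * (2 * M * Y)"
    using R1 D1 M Y by (intro mult_right_mono mult_mono) auto
  finally have sumP: "(\<Sum>k\<in>Ks. \<Sum>k'\<in>Ks. P k k') \<le> R * (10 * D\<^sup>2 * M * Y + E * Y ^ 3 * sqrt l)"
    by (simp add: algebra_simps)
  have "complex_of_real (\<Sum>m\<in>Ms. (norm (F m))\<^sup>2) = (\<Sum>m\<in>Ms. F m * cnj (F m))"
    by (simp add: complex_norm_square[symmetric])
  also have "\<dots> = (\<Sum>m\<in>Ms. \<Sum>k\<in>Ks. \<Sum>k'\<in>Ks. \<phi> m k * cnj (\<phi> m k'))"
    by (simp add: F_def cnj_sum sum_product)
  also have "\<dots> = (\<Sum>k\<in>Ks. \<Sum>m\<in>Ms. \<Sum>k'\<in>Ks. \<phi> m k * cnj (\<phi> m k'))" by (rule sum.swap)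
  also have "\<dots> = (\<Sum>k\<in>Ks. \<Sum>k'\<in>Ks. \<Sum>m\<in>Ms. \<phi> m k * cnj (\<phi> m k'))"
    by (rule sum.cong[OF refl]) (rule sum.swap)
  finally have "\<bar>\<Sum>m\<in>Ms. (norm (F m))\<^sup>2\<bar> = norm (\<Sum>k\<in>Ks. \<Sum>k'\<in>Ks. \<Sum>m\<in>Ms. \<phi> m k * cnj (\<phi> m k'))"
    by (metis norm_of_real)
  also have "\<dots> \<le> (\<Sum>k\<in>Ks. \<Sum>k'\<in>Ks. P k k')"
    unfolding P_def by (intro sum_norm_le) (auto intro: norm_sum)
  finally have sumF: "(\<Sum>m\<in>Ms. (norm (F m))\<^sup>2) \<le> R * (10 * D\<^sup>2 * M * Y + E * Y ^ 3 * sqrt l)" using sumP by linarith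
  have "(\<Sum>m\<in>Ms. norm (F m))\<^sup>2 \<le> (\<Sum>m\<in>Ms. (norm (F m))\<^sup>2) * card Ms"
    by (rule sum_squared_le_sum_of_squares)
  also have "\<dots> \<le> (R * (10 * D\<^sup>2 * M * Y + E * Y ^ 3 * sqrt l)) * (2 * M)"
    using sumF cardMs M R1 Y E0 by (intro mult_mono mult_nonneg_nonneg add_nonneg_nonneg) auto
  finally have "(\<Sum>m\<in>Ms. norm (F m))\<^sup>2 \<le> 2 * M * R * (10 * D\<^sup>2 * M * Y + E * Y ^ 3 * sqrt l)"
    by (simp add: mult_ac)
  moreover have "F m = (\<Sum>k | k \<in> Ks \<and> coprime (k * l) m. ec m (a * modular_inverse (int m) (int (k * l))))" for m
    unfolding F_def \<phi>_def by (rule sum.inter_filter[symmetric, OF finKs])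
  ultimately show ?thesis by (simp add: Ms_def R_def D_def \<alpha>(2) \<alpha>_def[symmetric])
qed

section \<open>Divisors of smooth numbers, sums over l and dyadic ranges\<close>

lemma smooth_divisor_exists:
  fixes n :: nat and y z :: real
  assumes n: "n \<ge> 1" "real n > z" and z: "z \<ge> 1" and smooth: "real (largest_prime_factor n) \<le> y"
  shows "\<exists>l. l dvd n \<and> z < real l \<and> real l \<le> y * z"
proof -
  define l where "l = (LEAST l. l dvd n \<and> z < real l)"
  have ex: "n dvd n \<and> z < real n" using n by simp
  have l: "l dvd n" "z < real l" unfolding l_def using LeastI[of "\<lambda>l. l dvd n \<and> z < real l", OF ex] by auto
  have "l \<noteq> 1" using l z by auto
  then obtain p where p: "prime p" "p dvd l" using prime_factor_nat by blast
  then obtain d where d: "l = p * d" by (auto simp: dvd_def)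
  have "l > 0" using l z by (auto intro!: Nat.gr0I)
  then have d0: "d > 0" using d by (auto intro!: Nat.gr0I)
  \<comment> \<open>Removing a prime p from the least divisor above \<open>z\<close> leaves a
    smaller divisor, hence one that is at most \<open>z\<close>; smoothness gives p <= y.\<close>
  have "d < l" using d d0 prime_gt_1_nat[OF p(1)] by simp
  moreover have "d dvd n" using d l dvd_trans by auto
  ultimately have "real d \<le> z" unfolding l_def using not_less_Least[of d] by (metis l_def linorder_not_le)
  have "p \<in> prime_factors n" using p l n by (auto simp: in_prime_factors_iff intro: dvd_trans)
  moreover have "n > 1" using n z by linarith
  ultimately have "p \<le> largest_prime_factor n" by (simp add: largest_prime_factor_def)
  then have "real p \<le> y" using smooth by linarith
  then have "real p * real d \<le> y * z" using \<open>real d \<le> z\<close> z by (intro mult_mono) auto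
  then show ?thesis using l d by (intro exI[of _ l]) auto
qed

lemma sum_inverse_sqrt_le:
  fixes n :: nat
  shows "(\<Sum>l=1..n. 1 / sqrt l) \<le> 2 * sqrt n"
proof (induction n)
  case (Suc n)
  have "sqrt n * sqrt (Suc n) \<le> real n + 1 / 2"
    using arith_geo_mean_sqrt[of "real n" "real (Suc n)"] by (simp add: real_sqrt_mult)
  then have "1 + 2 * (sqrt n * sqrt (Suc n)) \<le> 2 * (sqrt (Suc n) * sqrt (Suc n))" by simp
  then have "1 / sqrt (Suc n) + 2 * sqrt n \<le> 2 * sqrt (Suc n)" by (simp add: field_simps)
  then show ?case using Suc by simp
qed simp

lemma powr_tail_step:
  fixes l :: nat
  assumes "l \<ge> 2"
  shows "real l powr (-5/4) \<le> 4 * (real (l - 1) powr (-1/4) - real l powr (-1/4))"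
proof -
  have "\<exists>\<xi>. real (l - 1) < \<xi> \<and> \<xi> < real l \<and>
      real l powr (-1/4) - real (l - 1) powr (-1/4) = (real l - real (l - 1)) * ((-1/4) * \<xi> powr (-1/4 - 1))"
    using assms by (intro MVT2) (auto intro!: derivative_eq_intros simp: of_nat_diff)
  then obtain \<xi> where \<xi>: "real (l - 1) < \<xi>" "\<xi> < real l"
    "real l powr (-1/4) - real (l - 1) powr (-1/4) = (real l - real (l - 1)) * ((-1/4) * \<xi> powr (-1/4 - 1))" by blast
  have "real l - real (l - 1) = 1" using assms by (simp add: of_nat_diff)
  then have "4 * (real (l - 1) powr (-1/4) - real l powr (-1/4)) = \<xi> powr (-5/4)" using \<xi>(3) by simp
  moreover have "real l powr (-5/4) \<le> \<xi> powr (-5/4)" using \<xi> assms by (intro powr_mono2') auto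
  ultimately show ?thesis by simp
qed

lemma sum_powr_tail_le:
  fixes n N :: nat
  assumes "n \<ge> 1"
  shows "(\<Sum>l\<in>{n<..N}. real l powr (-5/4)) \<le> 4 * real n powr (-1/4)"
proof -
  have "(\<Sum>l\<in>{n<..N}. real l powr (-5/4)) \<le> 4 * (real n powr (-1/4) - real N powr (-1/4))" if "n \<le> N"
    using that
  proof (induction N rule: dec_induct)
    case (step k)
    have "{n<..Suc k} = insert (Suc k) {n<..k}" using step by auto
    then show ?case using step powr_tail_step[of "Suc k"] assms by simp
  qed simp
  moreover have "4 * (real n powr (-1/4) - real N powr (-1/4)) \<le> 4 * real n powr (-1/4)" by simp
  moreover have "{n<..N} = {}" if "\<not> n \<le> N" using that by auto
  ultimately show ?thesis by (cases "n \<le> N") (auto intro: order_trans)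
qed

text \<open>A factor Y is moved from the second bracket of \<open>bilinear_row_bound\<close> to the
  first. Since Y (1 + 4 pi |a| / (l Y M)) increases with Y, it may be estimated with x / l in place
  of Y, and no negative power of Y is left: all dyadic ranges of a given \<open>l\<close> obey the
  same bound.\<close>

lemma row_norm_bound:
  fixes M x Y E :: real and a :: int and l :: nat
  assumes M: "M \<ge> 2" and a: "a \<noteq> 0" and l: "l > 0" and Y: "Y > 0" "real l * Y \<le> x"
    and Ks: "\<And>k. k \<in> Ks \<Longrightarrow> k > 0 \<and> Y / 2 \<le> real k \<and> real k < Y"
    and E: "\<And>c. c > 0 \<Longrightarrow> real c \<le> x\<^sup>2 \<Longrightarrow> 4 * (real (divisor_count c) ^ 4 * (1 + ln (real c))) \<le> E"
    and E0: "E \<ge> 0"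
  defines "D \<equiv> real (divisor_count (nat \<bar>a\<bar>))"
  shows "(\<Sum>m | M < real m \<and> real m \<le> 2 * M.
      norm (\<Sum>k | k \<in> Ks \<and> coprime (k * l) m. ec m (a * modular_inverse (int m) (int (k * l)))))
    \<le> 18 * sqrt (1 + \<bar>real_of_int a\<bar> / (x * M)) *
      (D * M * sqrt x * (1 / sqrt l) + sqrt E * (x powr (3/2) * sqrt M) * real l powr (-5/4))"
    (is "?T \<le> _")
proof -
  have x0: "x > 0" using Y l by (meson less_le_trans mult_pos_pos of_nat_0_less_iff)
  define A where "A = \<bar>real_of_int a\<bar>"
  have A0: "A \<ge> 0" by (simp add: A_def)
  define R where "R = 1 + A / (x * M)"
  have R1: "R \<ge> 1" unfolding R_def using A0 x0 M by simp
  have l1: "real l \<ge> 1" using l by simp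
  have D0: "D \<ge> 0" by (simp add: D_def)
  \<comment> \<open>Y^2 l <= (l Y)^2 <= x^2, so a single \<open>E\<close> serves all rows.\<close>
  have E': "4 * (real (divisor_count c) ^ 4 * (1 + ln (real c))) \<le> E" if "c > 0" "real c \<le> Y\<^sup>2 * real l" for c
  proof (rule E[OF that(1)])
    have "Y\<^sup>2 * real l * 1 \<le> Y\<^sup>2 * real l * real l" using l1 by (intro mult_left_mono) auto
    then have "Y\<^sup>2 * real l \<le> (real l * Y)\<^sup>2"
      by (simp add: power2_eq_square mult_ac)
    also have "\<dots> \<le> x\<^sup>2" using Y l1 by (intro power_mono) auto
    finally show "real c \<le> x\<^sup>2" using that by linarith
  qed
  have Yx: "Y \<le> x / l" using Y l1 by (simp add: field_simps)
  have pi16: "1 \<le> 4 * pi" "4 * pi \<le> 16" using pi_ge_two pi_less_4 by linarith+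
  have YR: "Y * (1 + 4 * pi * A / (l * Y * M)) \<le> 16 * (x / l) * R"
  proof -
    have "Y * (1 + 4 * pi * A / (l * Y * M)) = Y + 4 * pi * (A / (l * M))"
      using Y l1 M by (simp add: field_simps)
    also have "\<dots> \<le> x / l + 16 * (A / (l * M))"
      using Yx pi16 A0 l1 M by (intro add_mono mult_right_mono) auto
    also have "\<dots> \<le> 16 * (x / l) + 16 * (A / (l * M))"
    proof -
      have "x / l \<ge> 0" using x0 by simp
      then show ?thesis by linarith
    qed
    also have "\<dots> = 16 * (x / l) * R" using x0 l1 M by (simp add: R_def field_simps)
    finally show ?thesis .
  qed
  have Q: "10 * D\<^sup>2 * M + E * Y\<^sup>2 * sqrt l \<le> 10 * D\<^sup>2 * M + E * (x / l)\<^sup>2 * sqrt l"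
    using Yx Y E0 by (intro add_left_mono mult_right_mono mult_left_mono power_mono) auto
  have "?T\<^sup>2 \<le> 2 * M * (1 + 4 * pi * A / (l * Y * M)) * (10 * D\<^sup>2 * M * Y + E * Y ^ 3 * sqrt l)"
    unfolding A_def D_def by (rule bilinear_row_bound[OF M a l Y(1) Ks E' E0])
  also have "\<dots> = 2 * M * ((Y * (1 + 4 * pi * A / (l * Y * M))) * (10 * D\<^sup>2 * M + E * Y\<^sup>2 * sqrt l))"
    by (simp add: power2_eq_square power3_eq_cube algebra_simps)
  also have "\<dots> \<le> 2 * M * ((16 * (x / l) * R) * (10 * D\<^sup>2 * M + E * (x / l)\<^sup>2 * sqrt l))"
    using M E0 R1 x0 l1 Y by (intro mult_left_mono mult_mono YR Q) auto
  also have "\<dots> = 32 * R * (10 * (D\<^sup>2 * M\<^sup>2 * x / l) + E * (x ^ 3 * M) * (sqrt l / l ^ 3))"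
    using l1 by (simp add: power2_eq_square power3_eq_cube field_simps)
  \<comment> \<open>320 is rounded up to the square 324 = 18^2, whose root is the 18 of the
    statement.\<close>
  also have "\<dots> \<le> 324 * R * (D\<^sup>2 * M\<^sup>2 * x / l + E * (x ^ 3 * M) * (sqrt l / l ^ 3))"
  proof -
    define s1 where "s1 = D\<^sup>2 * M\<^sup>2 * x / l"
    define s2 where "s2 = E * (x ^ 3 * M) * (sqrt l / l ^ 3)"
    have s: "0 \<le> s1" "0 \<le> s2" using E0 x0 M by (auto simp: s1_def s2_def)
    have "32 * R * (10 * s1 + s2) \<le> 32 * R * (10 * (s1 + s2))" using R1 s by (intro mult_left_mono) auto
    also have "\<dots> = 320 * (R * (s1 + s2))" by simp
    also have "\<dots> \<le> 324 * (R * (s1 + s2))" using R1 s by (intro mult_right_mono) auto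
    finally have "32 * R * (10 * s1 + s2) \<le> 324 * R * (s1 + s2)" by (simp only: mult.assoc)
    then show ?thesis by (simp only: s1_def s2_def)
  qed
  finally have T2: "?T\<^sup>2 \<le> 324 * R * (D\<^sup>2 * M\<^sup>2 * x / l + E * (x ^ 3 * M) * (sqrt l / l ^ 3))" .
  define u where "u = D * M * sqrt x * (1 / sqrt l)"
  define v where "v = sqrt E * (x powr (3/2) * sqrt M) * real l powr (-5/4)"
  have uv0: "u \<ge> 0" "v \<ge> 0" using D0 M x0 E0 by (auto simp: u_def v_def)
  have u2: "u\<^sup>2 = D\<^sup>2 * M\<^sup>2 * x / l" using x0 l1 by (simp add: u_def power_mult_distrib power_divide)
  have xp: "(x powr (3/2))\<^sup>2 = x ^ 3" using x0 by (simp add: powr_powr powr_numeral flip: powr_numeral)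
  have lp: "(real l powr (-5/4))\<^sup>2 = sqrt l / l ^ 3"
  proof -
    have "(real l powr (-5/4))\<^sup>2 = real l powr (-5/2)" using l1 by (simp add: powr_powr flip: powr_numeral)
    also have "\<dots> = real l powr (1/2 - 3)" by simp
    also have "\<dots> = real l powr (1/2) / real l powr 3" by (rule powr_diff)
    also have "\<dots> = sqrt l / l ^ 3" using l1 by (simp add: powr_half_sqrt powr_numeral)
    finally show ?thesis .
  qed
  have v2: "v\<^sup>2 = E * (x ^ 3 * M) * (sqrt l / l ^ 3)"
    unfolding v_def power_mult_distrib xp lp using E0 M by simp
  have "?T\<^sup>2 \<le> 324 * R * (u\<^sup>2 + v\<^sup>2)" using T2 unfolding u2 v2 .
  also have "\<dots> \<le> 324 * R * (u + v)\<^sup>2"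
    using R1 uv0 by (intro mult_left_mono) (auto simp: power2_sum)
  also have "\<dots> = (18 * sqrt R * (u + v))\<^sup>2" using R1 by (simp add: power_mult_distrib)
  finally have "?T \<le> 18 * sqrt R * (u + v)" by (rule power2_le_imp_le) (use R1 uv0 in auto)
  then show ?thesis by (simp add: u_def v_def R_def A_def)
qed

lemma dyadic_index:
  fixes x :: real and n :: nat
  assumes n: "n \<ge> 1" "real n < x"
  shows "\<exists>j<nat \<lceil>log 2 x\<rceil>. x / 2 ^ Suc j \<le> real n \<and> real n < x / 2 ^ j"
proof -
  have n1: "real n \<ge> 1" using n by simp
  then have x1: "x > 1" using n by linarith
  define j where "j = (LEAST j. x / 2 ^ Suc j \<le> real n)"
  obtain i :: nat where "x < 2 ^ i" using real_arch_pow[of 2 x] by auto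
  moreover have "(0::real) < 2 ^ i" by simp
  ultimately have "x \<le> 2 ^ Suc i" unfolding power_Suc by linarith
  then have "x / 2 ^ Suc i \<le> 1" by simp
  then have ex: "x / 2 ^ Suc i \<le> real n" using n by linarith
  have 1: "x / 2 ^ Suc j \<le> real n" unfolding j_def using LeastI[of "\<lambda>j. x / 2 ^ Suc j \<le> real n", OF ex] .
  have 2: "real n < x / 2 ^ j"
  proof (cases j)
    case 0
    then show ?thesis using n by simp
  next
    case (Suc k)
    then have "\<not> x / 2 ^ Suc k \<le> real n" unfolding j_def using not_less_Least[of k] by (metis lessI)
    then show ?thesis using Suc by simp
  qed
  have "1 < x / 2 ^ j" using 2 n1 by linarith
  then have "2 ^ j < x" by (simp add: field_simps)
  then have "2 powr real j < x" by (simp add: powr_realpow)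
  then have "real j < log 2 x" using x1 by (simp add: less_log_iff)
  then have "j < nat \<lceil>log 2 x\<rceil>" by linarith
  then show ?thesis using 1 2 by blast
qed

lemma sum_range_inverse_sqrt:
  fixes y z :: real
  assumes "z \<ge> 2" "y \<ge> 2"
  shows "(\<Sum>l | z < real l \<and> real l \<le> y * z. 1 / sqrt l) \<le> 2 * sqrt (y * z)"
proof -
  define N where "N = nat \<lfloor>y * z\<rfloor>"
  have yz: "y * z \<ge> 0" using assms by simp
  have "{l. z < real l \<and> real l \<le> y * z} \<subseteq> {1..N}"
  proof
    fix l assume "l \<in> {l. z < real l \<and> real l \<le> y * z}"
    then show "l \<in> {1..N}" using assms by (auto simp: N_def le_nat_floor intro!: Suc_leI Nat.gr0I)
  qed
  then have "(\<Sum>l | z < real l \<and> real l \<le> y * z. 1 / sqrt l) \<le> (\<Sum>l=1..N. 1 / sqrt l)"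
    by (intro sum_mono2) auto
  also have "\<dots> \<le> 2 * sqrt N" by (rule sum_inverse_sqrt_le)
  also have "\<dots> \<le> 2 * sqrt (y * z)" using yz by (simp add: N_def)
  finally show ?thesis .
qed

lemma sum_range_powr:
  fixes y z :: real
  assumes "z \<ge> 2"
  shows "(\<Sum>l | z < real l \<and> real l \<le> y * z. real l powr (-5/4)) \<le> 8 * z powr (-1/4)"
proof -
  define n where "n = nat \<lfloor>z\<rfloor>"
  define N where "N = nat \<lfloor>y * z\<rfloor>"
  \<comment> \<open>Replacing z by its integer part, which is at least z / 2, costs 2^(1/4) <= 2;
    this turns the 4 of \<open>sum_powr_tail_le\<close> into 8.\<close>
  have n: "real n \<ge> z / 2" "n \<ge> 1" unfolding n_def using assms by linarith+
  have "{l. z < real l \<and> real l \<le> y * z} \<subseteq> {n<..N}"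
  proof
    fix l assume "l \<in> {l. z < real l \<and> real l \<le> y * z}"
    then have l: "z < real l" "real l \<le> y * z" by auto
    have "n < l" unfolding n_def using l assms by linarith
    moreover have "l \<le> N" unfolding N_def using l by (simp add: le_nat_floor)
    ultimately show "l \<in> {n<..N}" by simp
  qed
  then have "(\<Sum>l | z < real l \<and> real l \<le> y * z. real l powr (-5/4)) \<le> (\<Sum>l\<in>{n<..N}. real l powr (-5/4))"
    by (intro sum_mono2) auto
  also have "\<dots> \<le> 4 * real n powr (-1/4)" using n by (intro sum_powr_tail_le)
  also have "\<dots> \<le> 4 * (z / 2) powr (-1/4)" using n assms by (intro mult_left_mono powr_mono2') auto
  also have "(z / 2) powr (-1/4) = z powr (-1/4) * 2 powr (1/4)"
    using assms by (simp add: powr_divide powr_minus field_simps)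
  also have "(2::real) powr (1/4) \<le> 2 powr 1" by (intro powr_mono) auto
  finally show ?thesis by (simp add: mult_left_mono)
qed

text \<open>Each n > z is assigned one divisor \<open>lf n\<close> and one dyadic index
  \<open>jf n\<close>, so the classes \<open>B (l, j)\<close> partition these n without any
  multiplicity to correct for. The n <= z contribute at most z for each of the at most 2 M
  moduli.\<close>

lemma Kl_le:
  fixes M x y z E :: real and a :: int and q :: nat
  assumes M: "M \<ge> 2" and a: "a \<noteq> 0" and y: "2 \<le> y" and yz: "y \<le> z" and zx: "z < x"
    and E: "\<And>c. c > 0 \<Longrightarrow> real c \<le> x\<^sup>2 \<Longrightarrow> 4 * (real (divisor_count c) ^ 4 * (1 + ln (real c))) \<le> E"
    and E0: "E \<ge> 0"
  shows "Kl y M x a q \<le> 2 * M * z + real (nat \<lceil>log 2 x\<rceil>) * (18 * sqrt (1 + \<bar>real_of_int a\<bar> / (x * M)) *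
      (real (divisor_count (nat \<bar>a\<bar>)) * M * sqrt x * (2 * sqrt (y * z))
        + sqrt E * (x powr (3/2) * sqrt M) * (8 * z powr (-1/4))))"
proof -
  define J where "J = nat \<lceil>log 2 x\<rceil>"
  define D where "D = real (divisor_count (nat \<bar>a\<bar>))"
  define R where "R = sqrt (1 + \<bar>real_of_int a\<bar> / (x * M))"
  define Ms where "Ms = {m::nat. M < real m \<and> real m \<le> 2 * M}"
  have finMs: "finite Ms" and cardMs: "real (card Ms) \<le> 2 * M" using dyadic_interval[OF M] by (auto simp: Ms_def)
  have z2: "z \<ge> 2" using y yz by simp
  have x0: "x > 0" using z2 zx by simp
  define f where "f m n = ec m (a * modular_inverse (int m) (int n))" for m n
  \<comment> \<open>Coprimality to \<open>q\<close> does not involve m and is absorbed into the set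
    of n; hence the bound is uniform in \<open>q\<close>.\<close>
  define G where "G = {n. n \<ge> 1 \<and> real n < x \<and> real (largest_prime_factor n) \<le> y \<and> coprime n q}"
  have finG: "finite G"
  proof (rule finite_subset)
    show "G \<subseteq> {..nat \<lfloor>x\<rfloor>}" by (auto simp: G_def le_nat_floor)
  qed simp
  define Big where "Big = {n \<in> G. z < real n}"
  define Sm where "Sm = {n \<in> G. real n \<le> z}"
  have finBig: "finite Big" and finSm: "finite Sm" using finG by (auto simp: Big_def Sm_def)
  have Sm: "real (card Sm) \<le> z"
  proof -
    have "Sm \<subseteq> {1..nat \<lfloor>z\<rfloor>}" by (auto simp: Sm_def G_def le_nat_floor)
    then have "card Sm \<le> nat \<lfloor>z\<rfloor>" using card_mono[of "{1..nat \<lfloor>z\<rfloor>}" Sm] by simp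
    then show ?thesis using z2 by linarith
  qed
  have "\<forall>n\<in>Big. \<exists>l. l dvd n \<and> z < real l \<and> real l \<le> y * z"
    using smooth_divisor_exists z2 by (auto simp: Big_def G_def)
  then obtain lf where lf: "\<And>n. n \<in> Big \<Longrightarrow> lf n dvd n \<and> z < real (lf n) \<and> real (lf n) \<le> y * z" by metis
  have "\<forall>n\<in>Big. \<exists>j<J. x / 2 ^ Suc j \<le> real n \<and> real n < x / 2 ^ j"
    using dyadic_index by (auto simp: Big_def G_def J_def)
  then obtain jf where jf: "\<And>n. n \<in> Big \<Longrightarrow> jf n < J \<and> x / 2 ^ Suc (jf n) \<le> real n \<and> real n < x / 2 ^ jf n" by metis
  define Ls where "Ls = {l::nat. z < real l \<and> real l \<le> y * z}"
  have finLs: "finite Ls"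
  proof (rule finite_subset)
    show "Ls \<subseteq> {..nat \<lfloor>y * z\<rfloor>}" by (auto simp: Ls_def le_nat_floor)
  qed simp
  define B where "B lj = {n \<in> Big. (lf n, jf n) = lj}" for lj
  define T where "T lj = (\<Sum>m\<in>Ms. norm (\<Sum>n | n \<in> B lj \<and> coprime n m. f m n))" for lj
  have row: "T (l, j) \<le> 18 * R * (D * M * sqrt x * (1 / sqrt l) + sqrt E * (x powr (3/2) * sqrt M) * real l powr (-5/4))"
    if l: "l \<in> Ls" for l j
  proof -
    have l0: "l > 0" using l z2 by (auto simp: Ls_def intro!: Nat.gr0I)
    define Y where "Y = x / (2 ^ j * real l)"
    \<comment> \<open>Smoothness and the choices of \<open>lf\<close> and \<open>jf\<close>
      disappear into this set, of which \<open>row_norm_bound\<close> uses only that its elements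
      are positive and lie in [Y / 2, Y).\<close>
    define Ks where "Ks = {k. k * l \<in> B (l, j)}"
    have eq: "(\<Sum>n | n \<in> B (l, j) \<and> coprime n m. f m n) = (\<Sum>k | k \<in> Ks \<and> coprime (k * l) m. f m (k * l))" for m
    proof (rule sum.reindex_bij_witness[of _ "\<lambda>k. k * l" "\<lambda>n. n div l"])
      fix n assume n: "n \<in> {n. n \<in> B (l, j) \<and> coprime n m}"
      then have "l dvd n" using lf[of n] by (auto simp: B_def)
      then have "n div l * l = n" by simp
      then show "n div l * l = n" "n div l \<in> {k. k \<in> Ks \<and> coprime (k * l) m}" "f m (n div l * l) = f m n"
        using n by (simp_all add: Ks_def del: coprime_mult_left_iff)
    qed (use l0 in \<open>auto simp: Ks_def\<close>)
    have "(\<Sum>m | M < real m \<and> real m \<le> 2 * M. norm (\<Sum>k | k \<in> Ks \<and> coprime (k * l) m. ec m (a * modular_inverse (int m) (int (k * l)))))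
      \<le> 18 * sqrt (1 + \<bar>real_of_int a\<bar> / (x * M)) * (real (divisor_count (nat \<bar>a\<bar>)) * M * sqrt x * (1 / sqrt l) + sqrt E * (x powr (3/2) * sqrt M) * real l powr (-5/4))"
    proof (rule row_norm_bound[OF M a l0 _ _ _ E E0])
      show "Y > 0" using x0 l0 by (simp add: Y_def)
      have "real l * Y = x / 2 ^ j" using l0 by (simp add: Y_def)
      also have "\<dots> \<le> x / 1" using x0 by (intro divide_left_mono) auto
      finally show "real l * Y \<le> x" by simp
    next
      fix k assume "k \<in> Ks"
      then have k: "k * l \<in> Big" "jf (k * l) = j" by (auto simp: Ks_def B_def)
      have k0: "k > 0" using k by (auto simp: Big_def G_def intro!: Nat.gr0I)
      have "x / 2 ^ Suc j \<le> real k * real l" "real k * real l < x / 2 ^ j" using jf[OF k(1)] k(2) by auto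
      then have "Y / 2 \<le> real k" "real k < Y" using l0 by (auto simp: Y_def field_simps)
      then show "k > 0 \<and> Y / 2 \<le> real k \<and> real k < Y" using k0 by blast
    qed
    then show ?thesis unfolding T_def eq by (simp add: f_def Ms_def R_def D_def)
  qed
  have split: "norm (\<Sum>n | n \<in> G \<and> coprime n m. f m n) \<le> z + (\<Sum>lj\<in>Ls \<times> {..<J}. norm (\<Sum>n | n \<in> B lj \<and> coprime n m. f m n))" for m
  proof -
    have "{n. n \<in> G \<and> coprime n m} = {n \<in> Sm. coprime n m} \<union> {n \<in> Big. coprime n m}"
      by (auto simp: Sm_def Big_def)
    then have "(\<Sum>n | n \<in> G \<and> coprime n m. f m n) = (\<Sum>n\<in>{n \<in> Sm. coprime n m}. f m n) + (\<Sum>n\<in>{n \<in> Big. coprime n m}. f m n)"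
      using finG by (subst sum.union_disjoint[symmetric]) (auto simp: Sm_def Big_def)
    then have "norm (\<Sum>n | n \<in> G \<and> coprime n m. f m n) \<le> norm (\<Sum>n\<in>{n \<in> Sm. coprime n m}. f m n) + norm (\<Sum>n\<in>{n \<in> Big. coprime n m}. f m n)"
      by (simp add: norm_triangle_ineq)
    also have "norm (\<Sum>n\<in>{n \<in> Sm. coprime n m}. f m n) \<le> (\<Sum>n\<in>{n \<in> Sm. coprime n m}. 1)"
      by (rule sum_norm_le) (simp add: f_def)
    also have "\<dots> \<le> card Sm" using finSm by (simp add: card_mono)
    also have "real (card Sm) \<le> z" by (rule Sm)
    also have "(\<Sum>n\<in>{n \<in> Big. coprime n m}. f m n)
        = (\<Sum>lj\<in>Ls \<times> {..<J}. \<Sum>n\<in>{n \<in> {n \<in> Big. coprime n m}. (lf n, jf n) = lj}. f m n)"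
      using finBig finLs lf jf by (intro sum.group[symmetric]) (auto simp: Ls_def)
    also have "norm \<dots> \<le> (\<Sum>lj\<in>Ls \<times> {..<J}. norm (\<Sum>n\<in>{n \<in> {n \<in> Big. coprime n m}. (lf n, jf n) = lj}. f m n))"
      by (rule norm_sum)
    also have "\<dots> = (\<Sum>lj\<in>Ls \<times> {..<J}. norm (\<Sum>n | n \<in> B lj \<and> coprime n m. f m n))"
      by (intro sum.cong refl arg_cong[where f = norm]) (auto simp: B_def)
    finally show ?thesis by simp
  qed
  have "Kl y M x a q = (\<Sum>m\<in>Ms. norm (\<Sum>n | n \<in> G \<and> coprime n m. f m n))"
    unfolding Kl_def Ms_def
    by (intro sum.cong refl arg_cong[where f = norm]) (auto simp: G_def f_def ec_def)
  also have "\<dots> \<le> (\<Sum>m\<in>Ms. z + (\<Sum>lj\<in>Ls \<times> {..<J}. norm (\<Sum>n | n \<in> B lj \<and> coprime n m. f m n)))"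
    by (intro sum_mono split)
  also have "\<dots> = card Ms * z + (\<Sum>lj\<in>Ls \<times> {..<J}. T lj)"
    unfolding T_def by (simp add: sum.distrib sum.swap[of _ Ms])
  also have "card Ms * z \<le> 2 * M * z" using cardMs z2 by (intro mult_right_mono) auto
  also have "(\<Sum>lj\<in>Ls \<times> {..<J}. T lj) = (\<Sum>l\<in>Ls. \<Sum>j<J. T (l, j))"
    by (simp add: sum.cartesian_product)
  also have "\<dots> \<le> (\<Sum>l\<in>Ls. \<Sum>j<J. 18 * R * (D * M * sqrt x * (1 / sqrt l) + sqrt E * (x powr (3/2) * sqrt M) * real l powr (-5/4)))"
    by (intro sum_mono row)
  also have "\<dots> = real J * (18 * R * (D * M * sqrt x * (\<Sum>l\<in>Ls. 1 / sqrt l) + sqrt E * (x powr (3/2) * sqrt M) * (\<Sum>l\<in>Ls. real l powr (-5/4))))"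
    by (simp only: sum_constant card_lessThan sum_distrib_left sum.distrib[symmetric] distrib_left)
  also have "\<dots> \<le> real J * (18 * R * (D * M * sqrt x * (2 * sqrt (y * z)) + sqrt E * (x powr (3/2) * sqrt M) * (8 * z powr (-1/4))))"
  proof (intro mult_left_mono add_mono)
    show "(\<Sum>l\<in>Ls. 1 / sqrt l) \<le> 2 * sqrt (y * z)" unfolding Ls_def using z2 y by (rule sum_range_inverse_sqrt)
    show "(\<Sum>l\<in>Ls. real l powr (-5/4)) \<le> 8 * z powr (-1/4)" unfolding Ls_def using z2 by (rule sum_range_powr)
  qed (use M x0 E0 in \<open>auto simp: D_def R_def\<close>)
  finally show ?thesis by (simp add: J_def R_def D_def)
qed

theorem theorem4p1:
  fixes \<eta> :: real
  assumes "\<eta> > 0"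
  shows "\<exists>C>0. \<forall>(M::real) (q::nat) (a::int) (x::real) (y::real) (z::real).
    M \<ge> 2 \<longrightarrow> q \<ge> 1 \<longrightarrow> a \<noteq> 0 \<longrightarrow> 2 \<le> y \<longrightarrow> y \<le> z \<longrightarrow> z < x \<longrightarrow>
    Kl y M x a q \<le> C *
      ((\<bar>real_of_int a\<bar> * x * M) powr \<eta> * (1 + \<bar>real_of_int a\<bar> / (x * M)) powr (1/2) *
        (M * x powr (1/2) * y powr (1/2) * z powr (1/2)
          + x powr (3/2) * M powr (1/2) * z powr (-1/4))
       + M * z)"
proof -
  \<comment> \<open>The budget is 6 \<delta>. Four divisor counts and a logarithm at c <= x^2 put
    x^(10 \<delta>) into \<open>E\<close>, hence x^(5 \<delta>) into its root, and the number of
    dyadic ranges takes one more \<delta>.\<close>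
  define \<delta> where "\<delta> = \<eta> / 6"
  have \<delta>: "\<delta> > 0" using assms by (simp add: \<delta>_def)
  \<comment> \<open>This one is for the divisor count of |a|, which enters only once, so it may use
    the full exponent of |a|.\<close>
  obtain C1 where C1: "C1 \<ge> 1" "\<And>n. n > 0 \<Longrightarrow> real (divisor_count n) \<le> C1 * real n powr \<eta>"
    using divisor_count_powr_bound[OF assms] by blast
  obtain C2 where C2: "C2 \<ge> 1" "\<And>n. n > 0 \<Longrightarrow> real (divisor_count n) \<le> C2 * real n powr \<delta>"
    using divisor_count_powr_bound[OF \<delta>] by blast
  define CE where "CE = 4 * (C2 ^ 4 * (1 + 1 / \<delta>))"
  have CE0: "CE \<ge> 0" using C2 \<delta> by (simp add: CE_def)
  \<comment> \<open>Makes 1 + log_2 x <= C3 x^\<delta>, a bound for the number of dyadic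
    ranges.\<close>
  define C3 where "C3 = 1 + 1 / (\<delta> * ln 2)"
  have C30: "C3 \<ge> 0" using \<delta> by (simp add: C3_def)
  \<comment> \<open>The 2 pays for the n <= z; the 18 with the inner 2 and 8 are the constants of
    the two main terms in \<open>Kl_le\<close>.\<close>
  define C where "C = 2 + 18 * C3 * (2 * C1 + 8 * sqrt CE)"
  have C0: "C > 0" using C30 C1 CE0 by (simp add: C_def add_pos_nonneg)
  have "Kl y M x a q \<le> C *
      ((\<bar>real_of_int a\<bar> * x * M) powr \<eta> * (1 + \<bar>real_of_int a\<bar> / (x * M)) powr (1/2) *
        (M * x powr (1/2) * y powr (1/2) * z powr (1/2)
          + x powr (3/2) * M powr (1/2) * z powr (-1/4))
       + M * z)"
    if M: "M \<ge> 2" and a: "a \<noteq> 0" and y: "2 \<le> y" and yz: "y \<le> z" and zx: "z < x"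
    for M x y z :: real and q :: nat and a :: int
  proof -
    have z2: "z \<ge> 2" and x1: "x \<ge> 1" using y yz zx by linarith+
    define A where "A = \<bar>real_of_int a\<bar>"
    have A1: "A \<ge> 1" using a by (simp add: A_def)
    have xpow: "x powr s \<ge> 1" if "s \<ge> 0" for s using x1 that by (simp add: ge_one_powr_ge_zero)
    define E where "E = CE * x powr (10 * \<delta>)"
    have E0: "E \<ge> 0" using CE0 by (simp add: E_def)
    have E: "4 * (real (divisor_count c) ^ 4 * (1 + ln (real c))) \<le> E" if c: "c > 0" "real c \<le> x\<^sup>2" for c
    proof -
      have c1: "real c \<ge> 1" using c by simp
      have "1 \<le> real c powr \<delta>" using c1 \<delta> by (simp add: ge_one_powr_ge_zero)
      moreover have "ln (real c) \<le> real c powr \<delta> / \<delta>" using c1 \<delta> by (rule ln_powr_bound)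
      ultimately have ln: "1 + ln (real c) \<le> (1 + 1 / \<delta>) * real c powr \<delta>" by (simp add: algebra_simps)
      have "real (divisor_count c) ^ 4 \<le> (C2 * real c powr \<delta>) ^ 4" using C2(2)[OF c(1)] by (intro power_mono) auto
      then have "real (divisor_count c) ^ 4 * (1 + ln (real c)) \<le> (C2 * real c powr \<delta>) ^ 4 * ((1 + 1 / \<delta>) * real c powr \<delta>)"
        using ln c1 C2 by (intro mult_mono) auto
      also have "\<dots> = (C2 ^ 4 * (1 + 1 / \<delta>)) * ((real c powr \<delta>) ^ 4 * real c powr \<delta>)"
        by (simp add: power_mult_distrib)
      also have "(real c powr \<delta>) ^ 4 * real c powr \<delta> = real c powr (5 * \<delta>)"
        using c1 by (simp add: powr_power flip: powr_add)
      finally have "4 * (real (divisor_count c) ^ 4 * (1 + ln (real c))) \<le> CE * real c powr (5 * \<delta>)"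
        by (simp add: CE_def)
      also have "\<dots> \<le> CE * (x\<^sup>2) powr (5 * \<delta>)" using CE0 c c1 \<delta> by (intro mult_left_mono powr_mono2) auto
      also have "(x\<^sup>2) powr (5 * \<delta>) = x powr (10 * \<delta>)"
        using x1 powr_powr[of x 2 "5 * \<delta>"] by (simp add: powr_numeral)
      finally show ?thesis by (simp add: E_def)
    qed
    have sqrtE: "sqrt E = sqrt CE * x powr (5 * \<delta>)"
    proof -
      have "x powr (10 * \<delta>) = (x powr (5 * \<delta>))\<^sup>2" using x1 by (simp add: powr_power)
      then show ?thesis by (simp add: E_def real_sqrt_mult)
    qed
    define J where "J = real (nat \<lceil>log 2 x\<rceil>)"
    have J: "J \<le> C3 * x powr \<delta>"
    proof -
      have "J \<le> 1 + log 2 x"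
      proof -
        have "log 2 x \<ge> 0" using x1 by simp
        then show ?thesis unfolding J_def by linarith
      qed
      also have "log 2 x = ln x / ln 2" by (simp add: log_def)
      also have "\<dots> \<le> (x powr \<delta> / \<delta>) / ln 2" using x1 \<delta> by (intro divide_right_mono ln_powr_bound) auto
      also have "1 + (x powr \<delta> / \<delta>) / ln 2 \<le> x powr \<delta> + (x powr \<delta> / \<delta>) / ln 2" using xpow[of \<delta>] \<delta> by simp
      also have "\<dots> = C3 * x powr \<delta>" using \<delta> by (simp add: C3_def field_simps)
      finally show ?thesis by simp
    qed
    define U where "U = (A * x * M) powr \<eta>"
    define R where "R = sqrt (1 + A / (x * M))"
    define D where "D = real (divisor_count (nat \<bar>a\<bar>))"
    define V1 where "V1 = M * sqrt x * sqrt y * sqrt z"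
    define V2 where "V2 = x powr (3/2) * sqrt M * z powr (-1/4)"
    have U: "U = A powr \<eta> * x powr \<eta> * M powr \<eta>" using A1 x1 M by (simp add: U_def powr_mult)
    have Mp: "M powr \<eta> \<ge> 1" and Ap: "A powr \<eta> \<ge> 1" using M A1 assms by (simp_all add: ge_one_powr_ge_zero)
    have JD: "J * D \<le> C3 * C1 * U"
    proof -
      have "D \<le> C1 * A powr \<eta>" using C1(2)[of "nat \<bar>a\<bar>"] a by (simp add: D_def A_def)
      then have "J * D \<le> (C3 * x powr \<delta>) * (C1 * A powr \<eta>)" using J C30 by (intro mult_mono) (auto simp: D_def)
      also have "\<dots> \<le> (C3 * x powr \<eta>) * (C1 * A powr \<eta>)"
        using C30 C1 x1 assms by (intro mult_right_mono mult_left_mono powr_mono) (auto simp: \<delta>_def)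
      also have "\<dots> = C3 * C1 * (A powr \<eta> * x powr \<eta> * 1)" by simp
      also have "\<dots> \<le> C3 * C1 * U" unfolding U using C30 C1 Mp by (intro mult_left_mono) auto
      finally show ?thesis .
    qed
    have JE: "J * sqrt E \<le> C3 * sqrt CE * U"
    proof -
      have "J * sqrt E \<le> (C3 * x powr \<delta>) * sqrt E" using J E0 by (intro mult_right_mono) auto
      also have "\<dots> = C3 * sqrt CE * (x powr \<delta> * x powr (5 * \<delta>))" by (simp add: sqrtE)
      also have "x powr \<delta> * x powr (5 * \<delta>) = x powr \<eta>" by (simp add: \<delta>_def flip: powr_add)
      also have "C3 * sqrt CE * x powr \<eta> \<le> C3 * sqrt CE * U"
      proof (intro mult_left_mono)
        have "1 * x powr \<eta> * 1 \<le> A powr \<eta> * x powr \<eta> * M powr \<eta>" using Ap Mp by (intro mult_mono) auto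
        then show "x powr \<eta> \<le> U" by (simp add: U)
      qed (use C30 CE0 in auto)
      finally show ?thesis .
    qed
    have R0: "R \<ge> 0" and V0: "V1 \<ge> 0" "V2 \<ge> 0" and U0: "U \<ge> 0"
      using A1 x1 M y z2 by (auto simp: R_def V1_def V2_def U_def)
    have "Kl y M x a q \<le> 2 * M * z + J * (18 * R * (D * M * sqrt x * (2 * sqrt (y * z)) + sqrt E * (x powr (3/2) * sqrt M) * (8 * z powr (-1/4))))"
      unfolding J_def R_def A_def D_def by (rule Kl_le[OF M a y yz zx E E0])
    also have "\<dots> = 2 * (M * z) + 18 * R * (2 * V1 * (J * D) + 8 * V2 * (J * sqrt E))"
      by (simp add: V1_def V2_def real_sqrt_mult algebra_simps)
    also have "\<dots> \<le> 2 * (M * z) + 18 * R * (2 * V1 * (C3 * C1 * U) + 8 * V2 * (C3 * sqrt CE * U))"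
      using R0 V0 JD JE by (intro add_left_mono mult_left_mono add_mono) auto
    also have "\<dots> = 2 * (M * z) + (18 * C3 * (2 * C1)) * (U * R * V1) + (18 * C3 * (8 * sqrt CE)) * (U * R * V2)"
      by (simp add: algebra_simps)
    also have "\<dots> \<le> C * (M * z) + C * (U * R * V1) + C * (U * R * V2)"
    proof -
      have nn: "0 \<le> C3 * C1" "0 \<le> C3 * sqrt CE" using C30 C1 CE0 by auto
      then have "2 \<le> C" "18 * C3 * (2 * C1) \<le> C" "18 * C3 * (8 * sqrt CE) \<le> C"
        by (simp_all add: C_def distrib_left)
      then show ?thesis using M z2 U0 R0 V0 by (intro add_mono mult_right_mono mult_nonneg_nonneg) auto
    qed
    also have "\<dots> = C * (U * R * (V1 + V2) + M * z)" by (simp add: algebra_simps)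
    also have "U * R * (V1 + V2) = (\<bar>real_of_int a\<bar> * x * M) powr \<eta> * (1 + \<bar>real_of_int a\<bar> / (x * M)) powr (1/2) *
        (M * x powr (1/2) * y powr (1/2) * z powr (1/2) + x powr (3/2) * M powr (1/2) * z powr (-1/4))"
      using x1 M y z2 A1 by (simp add: U_def R_def V1_def V2_def A_def powr_half_sqrt add_nonneg_nonneg)
    finally show ?thesis .
  qed
  then show ?thesis using C0 by blast
qed

end
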